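(* Let $n\ge2$, let $\Gamma$ be a convex cocompact subgroup of $G=\mathrm{SO}_0(1,n)$, and let $\mu$ be the Patterson-Sullivan measure on the limit set $\Lambda_\Gamma$. Then there exists a probability measure $\nu$ on $\Gamma$ with a finite exponential moment such that $\mu$ is $\nu$-stationary and $\Gamma_\nu=\Gamma$.
   Context: $G=\mathrm{SO}_0(1,n)$ acts by isometries on hyperbolic space $X=\mathbb H^n$ (ball model with origin $o$) and on its boundary $\partial X\cong\mathbb S^{n-1}$. A discrete subgroup $\Gamma$ is convex cocompact if $\Gamma\backslash(\mathrm{hull}(\Lambda_\Gamma)\cap X)$ is compact, where $\Lambda_\Gamma\subset\partial X$ is the limit set and $\mathrm{hull}(\Lambda_\Gamma)$ its convex hull. Let $d$ be the hyperbolic distance and $\delta$ the critical exponent of $\sum_{\gamma\in\Gamma}e^{-sd(o,\gamma o)}$. The Patterson-Sullivan measure $\mu$ (based at $o$) is the probability measure on $\Lambda_\Gamma$ obtained as a weak limit as $s\downarrow\delta$ of $\big(\sum_{\gamma}e^{-sd(o,\gamma o)}\big)^{-1}\sum_{\gamma\in\Gamma}e^{-sd(o,\gamma o)}\mathcal D_{\gamma o}$, with $\mathcal D_x$ the Dirac mass at $x$. For a Borel probability measure $\nu$ on $G$, $\mu$ is $\nu$-stationary if $\mu=\nu*\mu:=\int_G\gamma_*\mu\,d\nu(\gamma)$. $\nu$ has a finite exponential moment if there is $\epsilon_e>0$ with $\int_G\|\gamma\|^{\epsilon_e}d\nu(\gamma)<\infty$, where $\|\gamma\|$ is the operator norm of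 $\gamma$ acting on $\mathbb R^{n+1}$ with its Euclidean norm. $\Gamma_\nu$ is the subgroup generated by the support of $\nu$. *)

theory Defs
  imports "HOL-Probability.Probability" "HOL-Algebra.Generated_Groups"
begin

text \<open>Vectors of \<open>\<real>\<^bsup>n+1\<^esup>\<close> are indexed by \<open>'n option\<close> with \<open>n = CARD('n)\<close>;
  \<open>None\<close> is the time coordinate, and the form has signature \<open>(1, n)\<close>.\<close>

definition mink_form :: "real ^ ('n::finite) option \<Rightarrow> real ^ 'n option \<Rightarrow> real" where
  "mink_form u v = u $ None * v $ None - (\<Sum>i\<in>UNIV. u $ Some i * v $ Some i)"

definition SO_mink :: "(real ^ ('n::finite) option ^ 'n option) set" where
  "SO_mink = {A. (\<forall>u v. mink_form (A *v u) (A *v v) = mink_form u v) \<and> det A = 1}"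

definition SO0_mink :: "(real ^ ('n::finite) option ^ 'n option) monoid" where
  "SO0_mink = \<lparr>carrier = connected_component_set SO_mink (mat 1), mult = (**), one = mat 1\<rparr>"

text \<open>The ball model is the projective (Beltrami--Klein) one: \<open>x\<close> in the closed unit ball stands
  for the line spanned by \<open>(1, x)\<close>. Hyperbolic space is \<open>ball 0 1\<close>, its boundary is
  \<open>sphere 0 1\<close>, and the origin is \<open>0\<close>. Geodesics are chords (see
  \<open>hyp_dist_add_eq_iff_chord\<close>), so hyperbolic convex hulls are the usual ones.\<close>

definition lift_mink :: "real ^ 'n \<Rightarrow> real ^ ('n::finite) option" where
  "lift_mink x = (\<chi> i. case i of None \<Rightarrow> 1 | Some j \<Rightarrow> x $ j)"

definition hyp_act :: "real ^ 'n option ^ 'n option \<Rightarrow> real ^ 'n \<Rightarrow> real ^ ('n::finite)" where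
  "hyp_act A x = (\<chi> i. (A *v lift_mink x) $ Some i / (A *v lift_mink x) $ None)"

definition hyp_dist :: "real ^ ('n::finite) \<Rightarrow> real ^ 'n \<Rightarrow> real" where
  "hyp_dist x y = arcosh (mink_form (lift_mink x) (lift_mink y) /
     (sqrt (mink_form (lift_mink x) (lift_mink x)) * sqrt (mink_form (lift_mink y) (lift_mink y))))"

definition limit_set :: "(real ^ ('n::finite) option ^ 'n option) set \<Rightarrow> (real ^ 'n) set" where
  "limit_set \<Gamma> = {\<xi> \<in> sphere 0 1. \<xi> islimpt (\<lambda>\<gamma>. hyp_act \<gamma> 0) ` \<Gamma>}"

text \<open>A quotient map determines the topology of its target, so \<open>Q\<close> is the quotient
  by \<open>\<Gamma>\<close>, its points being orbits.\<close>

definition convex_cocompact :: "(real ^ ('n::finite) option ^ 'n option) set \<Rightarrow> bool" where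
  "convex_cocompact \<Gamma> \<longleftrightarrow> subgroup \<Gamma> SO0_mink \<and> topological_space_class.discrete \<Gamma> \<and>
     (\<exists>Q. quotient_map (top_of_set (convex hull (limit_set \<Gamma>) \<inter> ball 0 1)) Q
            (\<lambda>x. (\<lambda>\<gamma>. hyp_act \<gamma> x) ` \<Gamma>) \<and> compact_space Q)"

definition critical_exponent :: "(real ^ ('n::finite) option ^ 'n option) set \<Rightarrow> ereal" where
  "critical_exponent \<Gamma> =
     (INF s\<in>{s. (\<lambda>\<gamma>. exp (- s * hyp_dist 0 (hyp_act \<gamma> 0))) summable_on \<Gamma>}. ereal s)"

definition orbit_measure ::
  "(real ^ ('n::finite) option ^ 'n option) set \<Rightarrow> real \<Rightarrow> (real ^ 'n) measure" where
  "orbit_measure \<Gamma> s =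
     distr (point_measure \<Gamma> (\<lambda>\<gamma>. ennreal (exp (- s * hyp_dist 0 (hyp_act \<gamma> 0)) /
         (\<Sum>\<^sub>\<infinity>\<gamma>\<in>\<Gamma>. exp (- s * hyp_dist 0 (hyp_act \<gamma> 0))))))
       borel (\<lambda>\<gamma>. hyp_act \<gamma> 0)"

definition weakly_converges :: "(nat \<Rightarrow> 'a::topological_space measure) \<Rightarrow> 'a measure \<Rightarrow> bool" where
  "weakly_converges M \<mu> \<longleftrightarrow> (\<forall>f :: 'a \<Rightarrow> real. continuous_on UNIV f \<longrightarrow> bounded (range f) \<longrightarrow>
     (\<lambda>k. integral\<^sup>L (M k) f) \<longlonglongrightarrow> integral\<^sup>L \<mu> f)"

text \<open>Weak limits are taken along sequences \<open>s k\<close> decreasing to the critical exponent, as in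
  Patterson's construction; a limit as \<open>s\<close> tends to it from above is a special case.\<close>

definition patterson_sullivan ::
  "(real ^ ('n::finite) option ^ 'n option) set \<Rightarrow> (real ^ 'n) measure \<Rightarrow> bool" where
  "patterson_sullivan \<Gamma> \<mu> \<longleftrightarrow> prob_space \<mu> \<and> sets \<mu> = sets borel \<and> emeasure \<mu> (limit_set \<Gamma>) = 1 \<and>
     (\<exists>s :: nat \<Rightarrow> real. decseq s \<and> (\<forall>k. critical_exponent \<Gamma> < ereal (s k)) \<and>
        (\<lambda>k. ereal (s k)) \<longlonglongrightarrow> critical_exponent \<Gamma> \<and>
        weakly_converges (\<lambda>k. orbit_measure \<Gamma> (s k)) \<mu>)"

definition convolve ::
  "(real ^ ('n::finite) option ^ 'n option) measure \<Rightarrow> (real ^ 'n) measure \<Rightarrow> (real ^ 'n) measure" where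
  "convolve \<nu> \<mu> = bind \<nu> (\<lambda>\<gamma>. distr \<mu> borel (hyp_act \<gamma>))"

definition stationary ::
  "(real ^ ('n::finite) option ^ 'n option) measure \<Rightarrow> (real ^ 'n) measure \<Rightarrow> bool" where
  "stationary \<nu> \<mu> \<longleftrightarrow> \<mu> = convolve \<nu> \<mu>"

definition finite_exponential_moment :: "(real ^ ('m::finite) ^ 'm) measure \<Rightarrow> bool" where
  "finite_exponential_moment \<nu> \<longleftrightarrow>
     (\<exists>\<epsilon>>0. (\<integral>\<^sup>+\<gamma>. ennreal (onorm ((*v) \<gamma>) powr \<epsilon>) \<partial>\<nu>) < \<infinity>)"

definition measure_support :: "'a::topological_space measure \<Rightarrow> 'a set" where
  "measure_support \<nu> = {x. \<forall>U. open U \<longrightarrow> x \<in> U \<longrightarrow> 0 < emeasure \<nu> U}"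

definition generated_subgroup ::
  "(real ^ ('n::finite) option ^ 'n option) measure \<Rightarrow> (real ^ 'n option ^ 'n option) set" where
  "generated_subgroup \<nu> = generate SO0_mink (measure_support \<nu>)"

lemma mink_form_lift: "mink_form (lift_mink x) (lift_mink y) = 1 - x \<bullet> y"
  by (simp add: mink_form_def lift_mink_def inner_vec_def)

lemma inner_less_one:
  fixes x y :: "real ^ 'n::finite"
  assumes "norm x < 1" "norm y \<le> 1"
  shows "x \<bullet> y < 1"
proof -
  have "x \<bullet> y \<le> norm x * norm y" by (rule norm_cauchy_schwarz)
  also have "\<dots> \<le> norm x * 1" using assms by (intro mult_left_mono) auto
  finally show ?thesis using assms by simp
qed

lemma arcosh_add_eq_iff:
  fixes a b c :: real
  assumes "1 \<le> a" "1 \<le> b" "1 \<le> c"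
  shows "arcosh a + arcosh b = arcosh c \<longleftrightarrow> c = a * b + sqrt (a\<^sup>2 - 1) * sqrt (b\<^sup>2 - 1)"
proof -
  have nn: "0 \<le> arcosh t" if "1 \<le> t" for t :: real
    using that by (simp add: arcosh_nonneg_real)
  have ch: "cosh (arcosh a + arcosh b) = a * b + sqrt (a\<^sup>2 - 1) * sqrt (b\<^sup>2 - 1)"
    using assms by (simp add: cosh_add cosh_arcosh_real sinh_arcosh_real)
  have "arcosh a + arcosh b = arcosh c \<longleftrightarrow> cosh (arcosh a + arcosh b) = cosh (arcosh c)"
    using nn[OF assms(1)] nn[OF assms(2)] nn[OF assms(3)]
    by (metis add_nonneg_nonneg arcosh_cosh_real)
  then show ?thesis
    using ch assms by (auto simp: cosh_arcosh_real)
qed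

lemma hyp_dist_alt:
  "hyp_dist x y = arcosh ((1 - x \<bullet> y) / (sqrt (1 - x \<bullet> x) * sqrt (1 - y \<bullet> y)))"
  by (simp add: hyp_dist_def mink_form_lift)

lemma hyp_dist_add_eq_iff_chord:
  fixes x y z :: "real ^ 'n::finite"
  assumes "x \<in> ball 0 1" "y \<in> ball 0 1" "z \<in> ball 0 1"
  shows "hyp_dist x z + hyp_dist z y = hyp_dist x y \<longleftrightarrow> z \<in> closed_segment x y"
proof -
  have lt: "norm x < 1" "norm y < 1" "norm z < 1" using assms by auto
  define N where "N = 1 - z \<bullet> z"
  define Nx where "Nx = 1 - x \<bullet> x"
  define Ny where "Ny = 1 - y \<bullet> y"
  have pos: "N > 0" "Nx > 0" "Ny > 0"
    unfolding N_def Nx_def Ny_def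
    using lt inner_less_one[of x x] inner_less_one[of y y] inner_less_one[of z z] by simp_all
  define h where "h u v = (u \<bullet> z) * (v \<bullet> z) + N * (u \<bullet> v)" for u v :: "real ^ 'n"
  have h0: "0 \<le> h u u" for u unfolding h_def using pos by simp
  have h00: "h u u = 0 \<Longrightarrow> u = 0" for u
  proof -
    assume "h u u = 0"
    moreover have "0 \<le> (u \<bullet> z) * (u \<bullet> z)" "0 \<le> N * (u \<bullet> u)" using pos by simp_all
    ultimately have "N * (u \<bullet> u) = 0" unfolding h_def by linarith
    then show "u = 0" using pos by simp
  qed
  define H where "H u v = (1 - u \<bullet> z) * (1 - z \<bullet> v) - (1 - u \<bullet> v) * N" for u v :: "real ^ 'n"
  have Hh: "H u v = h (u - z) (v - z)" for u v
    unfolding H_def h_def N_def by (simp add: inner_diff_left inner_diff_right algebra_simps inner_commute)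
  define p where "p = x - z"
  define q where "q = y - z"
  define s where "s = sqrt (h q q)"
  define t where "t = sqrt (h p p)"
  have st: "0 \<le> s" "0 \<le> t" "s\<^sup>2 = h q q" "t\<^sup>2 = h p p"
    unfolding s_def t_def using h0 by auto
  have hsym: "h u v = h v u" for u v unfolding h_def by (simp add: inner_commute mult.commute)
  have hexp: "h (\<alpha> *\<^sub>R p + \<beta> *\<^sub>R q) (\<alpha> *\<^sub>R p + \<beta> *\<^sub>R q)
      = \<alpha>\<^sup>2 * h p p + 2 * \<alpha> * \<beta> * h p q + \<beta>\<^sup>2 * h q q" for \<alpha> \<beta>
    unfolding h_def by (simp add: inner_add_left inner_add_right algebra_simps inner_commute power2_eq_square)
  define a where "a = (1 - x \<bullet> z) / (sqrt Nx * sqrt N)"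
  define b where "b = (1 - z \<bullet> y) / (sqrt N * sqrt Ny)"
  define c where "c = (1 - x \<bullet> y) / (sqrt Nx * sqrt Ny)"
  have num: "1 - x \<bullet> z > 0" "1 - z \<bullet> y > 0" "1 - x \<bullet> y > 0"
    using lt inner_less_one[of x z] inner_less_one[of z y] inner_less_one[of x y] by simp_all
  have sq: "a\<^sup>2 - 1 = t\<^sup>2 / (Nx * N)"
  proof -
    have "a\<^sup>2 = (1 - x \<bullet> z)\<^sup>2 / (Nx * N)" unfolding a_def using pos
      by (simp add: power_divide power_mult_distrib)
    moreover have "(1 - x \<bullet> z)\<^sup>2 - Nx * N = t\<^sup>2"
      using Hh[of x x] unfolding st(4) p_def H_def Nx_def by (simp add: power2_eq_square inner_commute mult.commute)
    ultimately show ?thesis using pos by (simp add: field_simps)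
  qed
  have sq': "b\<^sup>2 - 1 = s\<^sup>2 / (N * Ny)"
  proof -
    have "b\<^sup>2 = (1 - z \<bullet> y)\<^sup>2 / (N * Ny)" unfolding b_def using pos
      by (simp add: power_divide power_mult_distrib)
    moreover have "(1 - z \<bullet> y)\<^sup>2 - N * Ny = s\<^sup>2"
      using Hh[of y y] unfolding st(3) q_def H_def Ny_def by (simp add: power2_eq_square inner_commute mult.commute)
    ultimately show ?thesis using pos by (simp add: field_simps)
  qed
  have apos: "a > 0" "b > 0" "c > 0" unfolding a_def b_def c_def using num pos by simp_all
  have ge1: "1 \<le> r" if "0 \<le> r\<^sup>2 - 1" "0 < r" for r :: real
    using that by (intro power2_le_imp_le[of 1 r]) simp_all
  have a1: "1 \<le> a" using sq apos pos by (intro ge1) simp_all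
  have b1: "1 \<le> b" using sq' apos pos by (intro ge1) simp_all
  have c1: "1 \<le> c"
  proof (intro ge1)
    have "c\<^sup>2 = (1 - x \<bullet> y)\<^sup>2 / (Nx * Ny)" unfolding c_def using pos
      by (simp add: power_divide power_mult_distrib)
    moreover have "(1 - x \<bullet> y)\<^sup>2 - Nx * Ny = ((x - y) \<bullet> y)\<^sup>2 + Ny * ((x - y) \<bullet> (x - y))"
      unfolding Nx_def Ny_def
      by (simp add: inner_diff_left inner_diff_right algebra_simps inner_commute power2_eq_square)
    moreover have "0 \<le> ((x - y) \<bullet> y)\<^sup>2 + Ny * ((x - y) \<bullet> (x - y))" using pos by simp
    ultimately have "c\<^sup>2 = (1 - x \<bullet> y)\<^sup>2 / (Nx * Ny)" "Nx * Ny \<le> (1 - x \<bullet> y)\<^sup>2" by linarith+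
    then show "0 \<le> c\<^sup>2 - 1" using pos by (simp add: le_divide_eq)
  qed (rule apos)
  have eq1: "hyp_dist x z + hyp_dist z y = hyp_dist x y \<longleftrightarrow>
      c = a * b + sqrt (a\<^sup>2 - 1) * sqrt (b\<^sup>2 - 1)"
    unfolding hyp_dist_alt N_def[symmetric] Nx_def[symmetric] Ny_def[symmetric]
      a_def[symmetric] b_def[symmetric] c_def[symmetric]
    by (rule arcosh_add_eq_iff[OF a1 b1 c1])
  have r1: "sqrt (a\<^sup>2 - 1) = t / (sqrt Nx * sqrt N)"
    unfolding sq using st(1,2) pos by (simp add: real_sqrt_divide real_sqrt_mult)
  have r2: "sqrt (b\<^sup>2 - 1) = s / (sqrt N * sqrt Ny)"
    unfolding sq' using st(1,2) pos by (simp add: real_sqrt_divide real_sqrt_mult)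
  have e1: "a * b + sqrt (a\<^sup>2 - 1) * sqrt (b\<^sup>2 - 1)
      = ((1 - x \<bullet> z) * (1 - z \<bullet> y) + t * s) / (N * (sqrt Nx * sqrt Ny))"
  proof -
    have "(sqrt Nx * sqrt N) * (sqrt N * sqrt Ny) = (sqrt N * sqrt N) * (sqrt Nx * sqrt Ny)"
      by (simp only: ac_simps)
    also have "sqrt N * sqrt N = N" using pos by simp
    finally show ?thesis
      unfolding r1 r2 unfolding a_def b_def by (simp only: times_divide_times_eq add_divide_distrib)
  qed
  have e2: "c = ((1 - x \<bullet> y) * N) / (N * (sqrt Nx * sqrt Ny))"
    unfolding c_def using pos by simp
  have den: "N * (sqrt Nx * sqrt Ny) \<noteq> 0" using pos by simp
  have "c = a * b + sqrt (a\<^sup>2 - 1) * sqrt (b\<^sup>2 - 1) \<longleftrightarrow>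
      (1 - x \<bullet> y) * N = (1 - x \<bullet> z) * (1 - z \<bullet> y) + t * s"
    unfolding e1 e2 divide_cancel_right by (simp only: den simp_thms)
  also have "\<dots> \<longleftrightarrow> h p q = - (t * s)"
    unfolding p_def q_def Hh[symmetric] H_def by linarith
  finally have eq2: "hyp_dist x z + hyp_dist z y = hyp_dist x y \<longleftrightarrow> h p q = - (t * s)"
    by (rule trans[OF eq1])
  show ?thesis
  proof
    assume "hyp_dist x z + hyp_dist z y = hyp_dist x y"
    then have hpq: "h p q = - (t * s)" using eq2 by simp
    have "h (s *\<^sub>R p + t *\<^sub>R q) (s *\<^sub>R p + t *\<^sub>R q) = 0"
      unfolding hexp hpq st(3)[symmetric] st(4)[symmetric] by (simp add: power2_eq_square algebra_simps)
    then have comb: "s *\<^sub>R p + t *\<^sub>R q = 0" by (rule h00)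
    show "z \<in> closed_segment x y"
    proof (cases "s + t = 0")
      case True
      then have "t = 0" using st by linarith
      then have "p = 0" using st h00[of p] by simp
      then show ?thesis by (simp add: p_def)
    next
      case False
      then have pos': "s + t > 0" using st by linarith
      have "(s + t) *\<^sub>R z = s *\<^sub>R x + t *\<^sub>R y"
        using comb unfolding p_def q_def by (simp add: algebra_simps add_eq_0_iff)
      then have "(1 / (s + t)) *\<^sub>R ((s + t) *\<^sub>R z) = (1 / (s + t)) *\<^sub>R (s *\<^sub>R x + t *\<^sub>R y)" by simp
      then have "z = (s / (s + t)) *\<^sub>R x + (t / (s + t)) *\<^sub>R y"
        using pos' by (simp add: scaleR_add_right)
      moreover have "s / (s + t) = 1 - t / (s + t)" using pos' by (simp add: field_simps)
      ultimately have "z = (1 - t / (s + t)) *\<^sub>R x + (t / (s + t)) *\<^sub>R y" by (simp only:)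
      moreover have "0 \<le> t / (s + t)" "t / (s + t) \<le> 1" using st(1,2) pos' by simp_all
      ultimately show ?thesis unfolding in_segment by blast
    qed
  next
    assume "z \<in> closed_segment x y"
    then obtain u where u: "0 \<le> u" "u \<le> 1" "z = (1 - u) *\<^sub>R x + u *\<^sub>R y"
      unfolding in_segment by blast
    define w where "w = x - y"
    have pw: "p = u *\<^sub>R w" unfolding p_def u(3) w_def by (simp add: algebra_simps)
    have qw: "q = (- (1 - u)) *\<^sub>R w" unfolding q_def u(3) w_def by (simp add: algebra_simps)
    have hsc: "h (\<alpha> *\<^sub>R w) (\<beta> *\<^sub>R w) = \<alpha> * \<beta> * h w w" for \<alpha> \<beta>
      unfolding h_def by (simp add: algebra_simps)
    have "t = u * sqrt (h w w)" unfolding t_def pw hsc using u by (simp add: real_sqrt_mult)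
    moreover have "s = (1 - u) * sqrt (h w w)"
      unfolding s_def qw hsc using u by (simp add: real_sqrt_mult flip: power2_eq_square)
    moreover have "sqrt (h w w) * sqrt (h w w) = h w w" using h0 by simp
    ultimately have "t * s = u * (1 - u) * h w w" by (metis mult.assoc mult.left_commute)
    then have "h p q = - (t * s)" unfolding pw qw hsc by (simp add: algebra_simps)
    then show "hyp_dist x z + hyp_dist z y = hyp_dist x y" using eq2 by simp
  qed
qed

lemma mat1_SO_mink: "mat 1 \<in> SO_mink"
  by (simp add: SO_mink_def)

lemma SO0_mink_subset: "carrier SO0_mink \<subseteq> SO_mink"
  by (simp add: SO0_mink_def connected_component_subset)

lemma SO_mink_mult: "A \<in> SO_mink \<Longrightarrow> B \<in> SO_mink \<Longrightarrow> A ** B \<in> SO_mink"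
  by (simp add: SO_mink_def det_mul flip: matrix_vector_mul_assoc)

lemma SO_mink_inverse:
  assumes "A \<in> SO_mink"
  obtains B where "B \<in> SO_mink" "A ** B = mat 1" "B ** A = mat 1"
proof -
  have "invertible A" using assms by (simp add: SO_mink_def invertible_det_nz)
  then obtain B where B: "A ** B = mat 1" "B ** A = mat 1" unfolding invertible_def by blast
  have "mink_form (B *v u) (B *v v) = mink_form u v" for u v
  proof -
    have "mink_form (B *v u) (B *v v) = mink_form (A *v (B *v u)) (A *v (B *v v))"
      using assms by (simp add: SO_mink_def)
    then show ?thesis by (simp add: matrix_vector_mul_assoc B)
  qed
  moreover have "det B = 1"
    using B(1) assms det_mul[of A B] by (simp add: SO_mink_def)
  ultimately have "B \<in> SO_mink" by (simp add: SO_mink_def)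
  then show ?thesis using B by (rule that)
qed

lemma connected_left_mult:
  fixes A :: "real ^ 'm::finite ^ 'm"
  assumes "connected S"
  shows "connected ((**) A ` S)"
proof (rule connected_continuous_image[OF _ assms])
  show "continuous_on S ((**) A)"
    unfolding matrix_matrix_mult_def by (intro continuous_intros)
qed

lemma group_SO0_mink: "group (SO0_mink :: (real ^ ('n::finite) option ^ 'n option) monoid)"
proof -
  let ?C = "connected_component_set SO_mink (mat 1) :: (real ^ 'n option ^ 'n option) set"
  have conn: "connected ?C" by simp
  have sub: "?C \<subseteq> SO_mink" by (rule connected_component_subset)
  have one: "mat 1 \<in> ?C" using mat1_SO_mink by simp
  have img: "(**) A ` ?C \<subseteq> ?C" if "A \<in> SO_mink" "A ** B \<in> ?C" "B \<in> ?C" for A B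
  proof -
    have "(**) A ` ?C \<subseteq> SO_mink" using SO_mink_mult[OF that(1)] sub by auto
    moreover have "connected ((**) A ` ?C)" by (rule connected_left_mult[OF conn])
    ultimately have "(**) A ` ?C \<subseteq> connected_component_set SO_mink (A ** B)"
      using that by (intro connected_component_maximal) auto
    then show ?thesis using connected_component_eq[OF that(2)] by simp
  qed
  have mult: "A ** B \<in> ?C" if "A \<in> ?C" "B \<in> ?C" for A B
    using img[of A "mat 1"] that sub one by auto
  show ?thesis
  proof (rule groupI)
    fix A :: "real ^ 'n option ^ 'n option" assume "A \<in> carrier SO0_mink"
    then have A: "A \<in> ?C" by (simp add: SO0_mink_def)
    then obtain B where B: "B \<in> SO_mink" "A ** B = mat 1" "B ** A = mat 1"
      using SO_mink_inverse sub by blast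
    have "(**) B ` ?C \<subseteq> ?C" using img[of B A] B A one by simp
    then have "B ** mat 1 \<in> ?C" using one by (meson image_eqI subsetD)
    then show "\<exists>B\<in>carrier SO0_mink. B \<otimes>\<^bsub>SO0_mink\<^esub> A = \<one>\<^bsub>SO0_mink\<^esub>"
      using B by (intro bexI[of _ B]) (simp_all add: SO0_mink_def)
  qed (use mult one in \<open>simp_all add: SO0_mink_def matrix_mul_assoc\<close>)
qed

lemma SO0_mink_time_pos:
  assumes A: "A \<in> carrier SO0_mink" and x: "x \<in> cball 0 1"
  shows "0 < (A *v lift_mink x) $ None"
proof -
  let ?C = "connected_component_set SO_mink (mat 1)"
  have nz: "(B *v lift_mink x) $ None \<noteq> 0" if B: "B \<in> SO_mink" for B
  proof
    define v where "v = B *v lift_mink x"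
    assume "(B *v lift_mink x) $ None = 0"
    then have v0: "v $ None = 0" by (simp add: v_def)
    have "mink_form v v = 1 - x \<bullet> x"
      using that by (simp add: v_def SO_mink_def mink_form_lift)
    moreover have "x \<bullet> x \<le> 1"
      using x by (simp add: power2_norm_eq_inner[symmetric] power_le_one)
    ultimately have "(\<Sum>i\<in>UNIV. v $ Some i * v $ Some i) \<le> 0"
      using v0 by (simp add: mink_form_def)
    then have "(\<Sum>i\<in>UNIV. v $ Some i * v $ Some i) = 0"
      by (intro antisym sum_nonneg) auto
    then have "v $ Some i = 0" for i
      by (subst (asm) sum_nonneg_eq_0_iff) auto
    then have "v = 0" using v0 by (metis option.exhaust vec_eq_iff zero_index)
    moreover obtain B' where "B' ** B = mat 1" using SO_mink_inverse[OF B] by blast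
    ultimately have "lift_mink x = 0"
      by (metis v_def matrix_vector_mul_assoc matrix_vector_mul_lid matrix_vector_mult_0_right)
    then have "lift_mink x $ None = 0" by simp
    then show False by (simp add: lift_mink_def)
  qed
  have "connected ((\<lambda>B. (B *v lift_mink x) $ None) ` ?C)"
  proof (rule connected_continuous_image)
    show "continuous_on ?C (\<lambda>B. (B *v lift_mink x) $ None)"
      by (simp add: matrix_vector_mult_def) (intro continuous_intros)
  qed simp
  moreover have "1 \<in> (\<lambda>B. (B *v lift_mink x) $ None) ` ?C"
    using mat1_SO_mink by (intro image_eqI[of _ _ "mat 1"]) (simp_all add: lift_mink_def)
  moreover have "(A *v lift_mink x) $ None \<in> (\<lambda>B. (B *v lift_mink x) $ None) ` ?C"
    using A by (simp add: SO0_mink_def)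
  moreover have "0 \<notin> (\<lambda>B. (B *v lift_mink x) $ None) ` ?C"
    using nz connected_component_subset[of SO_mink "mat 1"] by (metis (no_types, lifting) imageE subsetD)
  ultimately show ?thesis
    unfolding connected_iff_interval
    by (metis (no_types, lifting) linorder_not_less zero_le_one)
qed

lemma lift_hyp_act:
  assumes "A \<in> carrier SO0_mink" "x \<in> cball 0 1"
  shows "lift_mink (hyp_act A x) = (1 / (A *v lift_mink x) $ None) *\<^sub>R (A *v lift_mink x)"
  using SO0_mink_time_pos[OF assms]
  by (auto simp: vec_eq_iff lift_mink_def hyp_act_def split: option.split)

lemma mink_form_scale: "mink_form (a *\<^sub>R u) (b *\<^sub>R v) = a * b * mink_form u v"
  by (simp add: mink_form_def sum_distrib_left algebra_simps)

lemma mink_form_hyp_act: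
  assumes "A \<in> carrier SO0_mink" "x \<in> cball 0 1" "y \<in> cball 0 1"
  shows "1 - hyp_act A x \<bullet> hyp_act A y =
    (1 - x \<bullet> y) / ((A *v lift_mink x) $ None * (A *v lift_mink y) $ None)"
proof -
  have "A \<in> SO_mink" using assms(1) SO0_mink_subset by blast
  then have "mink_form (A *v lift_mink x) (A *v lift_mink y) = 1 - x \<bullet> y"
    by (simp add: SO_mink_def mink_form_lift)
  then show ?thesis
    unfolding mink_form_lift[symmetric] lift_hyp_act[OF assms(1,2)] lift_hyp_act[OF assms(1,3)]
      mink_form_scale by (simp add: mink_form_lift)
qed

lemma hyp_act_ball:
  assumes "A \<in> carrier SO0_mink" "x \<in> ball 0 1" shows "hyp_act A x \<in> ball 0 1"
proof -
  have x: "x \<in> cball 0 1" using assms by simp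
  have "x \<bullet> x < 1" using assms inner_less_one[of x x] by simp
  then have "0 < 1 - hyp_act A x \<bullet> hyp_act A x"
    unfolding mink_form_hyp_act[OF assms(1) x x] using SO0_mink_time_pos[OF assms(1) x] by simp
  then show ?thesis by (simp add: norm_eq_sqrt_inner)
qed

lemma hyp_act_sphere:
  assumes "A \<in> carrier SO0_mink" "x \<in> sphere 0 1" shows "hyp_act A x \<in> sphere 0 1"
proof -
  have x: "x \<in> cball 0 1" using assms by simp
  have "x \<bullet> x = 1" using assms by (simp add: norm_eq_1)
  then have "0 = 1 - hyp_act A x \<bullet> hyp_act A x"
    unfolding mink_form_hyp_act[OF assms(1) x x] by simp
  then show ?thesis by (simp add: norm_eq_1)
qed

lemma hyp_act_mult:
  assumes "A \<in> carrier SO0_mink" "B \<in> carrier SO0_mink" "x \<in> cball 0 1"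
  shows "hyp_act (A ** B) x = hyp_act A (hyp_act B x)"
  using SO0_mink_time_pos[OF assms(2,3)]
  by (simp add: hyp_act_def[of "A ** B"] hyp_act_def[of A] lift_hyp_act[OF assms(2,3)]
      matrix_vector_mul_assoc matrix_vector_mult_scaleR)

lemma hyp_dist_hyp_act:
  assumes "A \<in> carrier SO0_mink" "x \<in> ball 0 1" "y \<in> ball 0 1"
  shows "hyp_dist (hyp_act A x) (hyp_act A y) = hyp_dist x y"
proof -
  have x: "x \<in> cball 0 1" and y: "y \<in> cball 0 1" using assms by simp_all
  define a where "a = (A *v lift_mink x) $ None"
  define b where "b = (A *v lift_mink y) $ None"
  have pos: "0 < a" "0 < b" using SO0_mink_time_pos[OF assms(1)] x y by (simp_all add: a_def b_def)
  have r: "sqrt ((1 - x \<bullet> x) / (a * a)) = sqrt (1 - x \<bullet> x) / a"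
    "sqrt ((1 - y \<bullet> y) / (b * b)) = sqrt (1 - y \<bullet> y) / b"
    using pos by (simp_all add: real_sqrt_divide)
  show ?thesis
    unfolding hyp_dist_alt mink_form_hyp_act[OF assms(1) x y] mink_form_hyp_act[OF assms(1) x x]
      mink_form_hyp_act[OF assms(1) y y] a_def[symmetric] b_def[symmetric] r
    using pos by simp
qed

lemma emeasure_convolve:
  fixes \<nu> :: "(real ^ ('n::finite) option ^ 'n option) measure" and \<mu> :: "(real ^ 'n) measure"
  assumes "prob_space \<mu>" "sets \<mu> = sets borel" "sets \<nu> = sets borel" "B \<in> sets borel"
  shows "emeasure (convolve \<nu> \<mu>) B = (\<integral>\<^sup>+\<gamma>. emeasure (distr \<mu> borel (hyp_act \<gamma>)) B \<partial>\<nu>)"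
proof -
  have comp: "(\<lambda>z :: (real ^ 'n option ^ 'n option) \<times> (real ^ 'n).
      (fst z *v lift_mink (snd z)) $ i) \<in> borel_measurable borel" for i
  proof (rule borel_measurable_continuous_onI)
    have "continuous_on UNIV (\<lambda>z :: (real ^ 'n option ^ 'n option) \<times> (real ^ 'n).
        case j of None \<Rightarrow> 1 | Some k \<Rightarrow> snd z $ k)" for j
      by (cases j) (auto intro!: continuous_intros)
    then show "continuous_on UNIV (\<lambda>z :: (real ^ 'n option ^ 'n option) \<times> (real ^ 'n).
        (fst z *v lift_mink (snd z)) $ i)"
      unfolding matrix_vector_mult_def lift_mink_def vec_lambda_beta by (intro continuous_intros)
  qed
  have "(\<lambda>z :: (real ^ 'n option ^ 'n option) \<times> (real ^ 'n). hyp_act (fst z) (snd z))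
      \<in> borel_measurable borel"
  proof (subst borel_measurable_euclidean_space, intro ballI)
    fix e :: "real ^ 'n" assume "e \<in> Basis"
    then obtain i where i: "e = axis i 1" by (auto simp: Basis_vec_def)
    show "(\<lambda>z :: (real ^ 'n option ^ 'n option) \<times> (real ^ 'n). hyp_act (fst z) (snd z) \<bullet> e)
        \<in> borel_measurable borel"
      unfolding i inner_axis hyp_act_def vec_lambda_beta inner_real_def mult_1_right
      by (intro borel_measurable_divide comp)
  qed
  then have "case_prod hyp_act \<in>
      measurable (\<nu> \<Otimes>\<^sub>M \<mu>) (borel :: (real ^ 'n) measure)"
    using assms by (simp add: case_prod_unfold borel_prod[symmetric] cong: measurable_cong_sets sets_pair_measure_cong)
  moreover have "(\<lambda>_. \<mu>) \<in> measurable \<nu> (subprob_algebra \<mu>)"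
    using assms(1) by (intro measurable_const) (simp add: space_subprob_algebra prob_space_imp_subprob_space)
  ultimately have "(\<lambda>\<gamma>. distr \<mu> borel (hyp_act \<gamma>)) \<in> measurable \<nu> (subprob_algebra borel)"
    by (rule measurable_distr2)
  moreover have "space \<nu> \<noteq> {}" using sets_eq_imp_space_eq[OF assms(3)] by simp
  ultimately show ?thesis unfolding convolve_def using assms(4) by (intro emeasure_bind)
qed

end

theory Submission
  imports Defs
begin

text \<open>Write \<open>f \<gamma> = d\<gamma>\<mu>/d\<mu>\<close>. Weak convergence gives conformality, \<open>f \<gamma> = (conf_factor \<gamma>)\<^bsup>-\<delta>\<^esup>\<close>, and
  \<open>\<mu>\<close> is \<open>\<nu>\<close>-stationary as soon as \<open>\<Sum>\<nu>(\<gamma>) f \<gamma> = 1\<close> on the limit set. By convex cocompactness every limit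
  point \<open>\<xi>\<close> has at every scale \<open>2\<^bsup>-k\<^esup>\<close> an element \<open>\<sigma> k \<xi>\<close> of \<open>\<Gamma>\<close> whose orbit point lies at bounded distance
  from the point at height \<open>2\<^bsup>-k\<^esup>\<close> over \<open>\<xi>\<close>. The constant 1 is exhausted greedily: from the remainder
  \<open>R\<^sub>k\<close> subtract \<open>c \<integral> R\<^sub>k(\<eta>) f (\<sigma> k \<eta>) d\<mu>(\<eta>)\<close>. As long as \<open>R\<^sub>k\<close> is log-Lipschitz at scale \<open>2\<^bsup>-k\<^esup>\<close>, this
  integral is comparable to \<open>R\<^sub>k\<close>, so for small \<open>c\<close> the remainder stays positive, is again
  log-Lipschitz at the next scale, and decays geometrically. Since step \<open>k\<close> only uses elements of norm about
  \<open>2\<^sup>k\<close>, the weights have an exponential moment. The kernels are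
  nearly symmetric in \<open>\<xi>\<close> and \<open>\<eta>\<close> and each \<open>f \<gamma>\<close> has integral 1, which replaces the shadow lemma.
  If \<open>\<delta> = 0\<close> or the limit set is a single point, \<open>\<mu>\<close> is \<open>\<Gamma>\<close>-invariant and any weights will do.\<close>

section \<open>Greedy decomposition of the constant function\<close>

text \<open>Three rates compete. A greedy step multiplies the remainder by a factor between
  \<open>\<tau>\<close> and \<open>r < 1\<close>, and the kernel loses
  \<open>\<theta> = 2 powr (- \<delta>)\<close> per scale between separated points. At distance
  about \<open>1 / 2 ^ j\<close> the remainder may be larger by
  \<open>(1 / \<tau>) ^ (k - j)\<close>, so averages stay bounded by the remainder only if
  \<open>\<theta> < \<tau>\<close>: steps must be small, and \<open>\<delta> > 0\<close>. The factor
  \<open>r\<close> pays for the moment, through \<open>2 powr \<epsilon> * r < 1\<close>. The greedy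
  elements need not generate \<Gamma>. Hence a small positive multiple of every
  \<open>f \<gamma>\<close> is removed first, and the recursion exhausts what is left, not the
  constant 1 itself. Near symmetry holds because the conformal factor of an element of size
  \<open>s\<close> with orbit point near \<open>y\<close> is comparable to
  \<open>s * (|x - y|^2 + 1 / s^2)\<close>. For conformality, test functions live on the whole space
  while the action is continuous on the closed ball, and the exponents vary along the sequence; a
  retraction and a uniform estimate settle this.\<close>

definition log_lipschitz_on :: "real \<Rightarrow> 'a::metric_space set \<Rightarrow> ('a \<Rightarrow> real) \<Rightarrow> bool" where
  "log_lipschitz_on B X g \<longleftrightarrow>
     (\<forall>x\<in>X. 0 < g x) \<and> (\<forall>x\<in>X. \<forall>y\<in>X. g x \<le> g y * exp (B * dist x y))"

lemma log_lipschitz_on_pos: "log_lipschitz_on B X g \<Longrightarrow> x \<in> X \<Longrightarrow> 0 < g x"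
  by (auto simp: log_lipschitz_on_def)

lemma log_lipschitz_onD:
  "log_lipschitz_on B X g \<Longrightarrow> x \<in> X \<Longrightarrow> y \<in> X \<Longrightarrow> g x \<le> g y * exp (B * dist x y)"
  by (auto simp: log_lipschitz_on_def)

lemma log_lipschitz_on_continuous:
  assumes "log_lipschitz_on B X g"
  shows "continuous_on X g"
  unfolding continuous_on_def
proof
  fix y assume y: "y \<in> X"
  have d: "((\<lambda>x. dist x y) \<longlongrightarrow> 0) (at y within X)"
    using tendsto_dist[OF tendsto_ident_at tendsto_const, of y y X] by simp
  have u: "((\<lambda>x. g y * exp (B * dist x y)) \<longlongrightarrow> g y) (at y within X)"
    using tendsto_mult[OF tendsto_const[of "g y"] tendsto_exp[OF tendsto_mult[OF tendsto_const[of B] d]]]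
    by simp
  have l: "((\<lambda>x. g y * exp (- B * dist x y)) \<longlongrightarrow> g y) (at y within X)"
    using tendsto_mult[OF tendsto_const[of "g y"] tendsto_exp[OF tendsto_mult[OF tendsto_const[of "- B"] d]]]
    by simp
  show "(g \<longlongrightarrow> g y) (at y within X)"
  proof (rule tendsto_sandwich[OF _ _ l u])
    show "\<forall>\<^sub>F x in at y within X. g y * exp (- B * dist x y) \<le> g x"
      unfolding eventually_at_filter
    proof (intro always_eventually allI impI)
      fix x assume "x \<in> X"
      then have "g y \<le> g x * exp (B * dist y x)" using assms y by (intro log_lipschitz_onD)
      then show "g y * exp (- B * dist x y) \<le> g x"
        by (simp add: exp_minus dist_commute field_simps)
    qed
    show "\<forall>\<^sub>F x in at y within X. g x \<le> g y * exp (B * dist x y)"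
      unfolding eventually_at_filter
      by (intro always_eventually allI impI log_lipschitz_onD[OF assms _ y])
  qed
qed

text \<open>With \<open>z = B * dist x y\<close> the claim reduces to \<open>h y * (exp (2 z) - exp
  (- b z)) \<le> g y * (exp (2 z) - exp z)\<close>. Since \<open>m \<ge> b + 2\<close>, Bernoulli's
  inequality bounds the first bracket by \<open>m\<close> times the second, and
  \<open>h \<le> g / m\<close> absorbs the \<open>m\<close>.\<close>

lemma log_lipschitz_on_diff:
  assumes g: "log_lipschitz_on B X g" and "0 \<le> B" "2 \<le> m" "b + 2 \<le> real m"
    and h0: "\<And>x. x \<in> X \<Longrightarrow> 0 \<le> h x" and hg: "\<And>x. x \<in> X \<Longrightarrow> h x \<le> g x / real m"
    and h: "\<And>x y. x \<in> X \<Longrightarrow> y \<in> X \<Longrightarrow> h x \<le> h y * exp (b * B * dist x y)"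
  shows "log_lipschitz_on (2 * B) X (\<lambda>x. g x - h x)"
  unfolding log_lipschitz_on_def
proof (intro conjI ballI)
  fix x assume x: "x \<in> X"
  have "g x / real m < g x" using log_lipschitz_on_pos[OF g x] assms(3) by (simp add: field_simps)
  then show "0 < g x - h x" using hg[OF x] by linarith
next
  fix x y assume x: "x \<in> X" and y: "y \<in> X"
  define z where "z = B * dist x y"
  have z: "0 \<le> z" using assms(2) by (simp add: z_def)
  have gy: "0 < g y" by (rule log_lipschitz_on_pos[OF g y])
  have 1: "g x \<le> g y * exp z" using log_lipschitz_onD[OF g x y] by (simp add: z_def)
  have "h y \<le> h x * exp (b * z)" using h[OF y x] by (simp add: z_def dist_commute mult.assoc)
  then have 2: "h y * exp (- (b * z)) \<le> h x" by (simp add: exp_minus field_simps)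
  have "exp (- (b * z)) \<ge> exp (2 * z + real m * (- z))"
    using mult_right_mono[OF assms(4) z] by (simp add: algebra_simps)
  then have 3: "exp (2 * z) * exp (- z) ^ m \<le> exp (- (b * z))"
    by (simp only: exp_add exp_of_nat_mult)
  have 4: "1 + real m * (exp (- z) - 1) \<le> (1 + (exp (- z) - 1)) ^ m"
    by (rule Bernoulli_inequality) (simp add: add_increasing)
  have "exp (2 * z) - exp (- (b * z)) \<le> exp (2 * z) * (1 - exp (- z) ^ m)"
    using 3 by (simp add: algebra_simps)
  also have "\<dots> \<le> exp (2 * z) * (real m * (1 - exp (- z)))"
    using 4 by (intro mult_left_mono) (auto simp: algebra_simps)
  also have "\<dots> = real m * (exp (2 * z) - exp z)"
    by (simp add: algebra_simps flip: exp_add)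
  finally have 5: "exp (2 * z) - exp (- (b * z)) \<le> real m * (exp (2 * z) - exp z)" .
  have "h y * (exp (2 * z) - exp (- (b * z))) \<le> h y * (real m * (exp (2 * z) - exp z))"
    using h0[OF y] 5 by (intro mult_left_mono)
  also have "\<dots> \<le> g y / real m * (real m * (exp (2 * z) - exp z))"
    using hg[OF y] z by (intro mult_right_mono) auto
  also have "\<dots> = g y * (exp (2 * z) - exp z)" using assms(3) by simp
  finally have "g x - h x \<le> (g y - h y) * exp (2 * z)"
    using 1 2 by (simp add: algebra_simps)
  then show "g x - h x \<le> (g y - h y) * exp (2 * B * dist x y)" by (simp add: z_def mult.assoc)
qed

text \<open>Dividing by \<open>1 + b i\<close> makes the weights summable against any prescribed
  \<open>b\<close>. The bound 1/2 leaves at least half of the constant 1 for the greedy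
  scheme.\<close>

lemma ex_pos_weights:
  fixes b :: "'i \<Rightarrow> real"
  assumes "countable I" "\<And>i. i \<in> I \<Longrightarrow> 0 \<le> b i"
  obtains w where "\<And>i. i \<in> I \<Longrightarrow> 0 < w i"
    "(\<integral>\<^sup>+i. ennreal (w i * b i) \<partial>count_space I) \<le> ennreal (1/2)"
proof -
  \<comment> \<open>The shift by 2 makes the geometric series sum to 1/2.\<close>
  define w where "w i = (1/2) ^ (to_nat_on I i + 2) / (1 + b i)" for i
  have wpos: "0 < w i" if "i \<in> I" for i
    unfolding w_def using assms(2)[OF that] by (intro divide_pos_pos) auto
  have "(\<integral>\<^sup>+i. ennreal (w i * b i) \<partial>count_space I)
      \<le> (\<integral>\<^sup>+i. ennreal ((1/2) ^ (to_nat_on I i + 2)) \<partial>count_space I)"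
  proof (intro nn_integral_mono ennreal_leI)
    fix i assume "i \<in> space (count_space I)"
    then have "0 \<le> b i" using assms by simp
    then have "b i / (1 + b i) \<le> 1" by simp
    then have "(1/2) ^ (to_nat_on I i + 2) * (b i / (1 + b i)) \<le> (1/2) ^ (to_nat_on I i + 2) * 1"
      by (intro mult_left_mono) auto
    then show "w i * b i \<le> (1/2) ^ (to_nat_on I i + 2)" by (simp add: w_def)
  qed
  also have "\<dots> = (\<integral>\<^sup>+n. ennreal ((1/2) ^ (n + 2)) \<partial>count_space (to_nat_on I ` I))"
    using assms(1) by (intro nn_integral_bij_count_space) (auto simp: bij_betw_def)
  also have "\<dots> \<le> (\<integral>\<^sup>+n. ennreal ((1/2) ^ (n + 2)) \<partial>count_space UNIV)"
    by (subst nn_integral_count_space_indicator) (auto intro!: nn_integral_mono split: split_indicator)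
  also have "\<dots> = (\<Sum>n. ennreal ((1/2) ^ (n + 2)))"
    by (rule nn_integral_count_space_nat)
  also have "\<dots> = ennreal (1/2)"
  proof (rule suminf_ennreal_eq)
    have "(\<lambda>n. (1/4) * (1/2) ^ n) sums ((1/4) * (1 / (1 - 1/2 :: real)))"
      by (intro sums_mult geometric_sums) auto
    then show "(\<lambda>n. (1 / 2 :: real) ^ (n + 2)) sums (1/2)"
      by (simp add: power_add mult.commute)
  qed auto
  finally show thesis using wpos that by blast
qed

section \<open>Kernel systems and averages over one scale\<close>

text \<open>In the application \<open>X\<close> is the limit set, \<open>I\<close> the group,
  \<open>f i\<close> the density of a translated measure, \<open>a i\<close> the size
  \<open>boost i\<close>, and \<open>\<sigma> k y\<close> the element that shadows \<open>y\<close>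
  at scale \<open>1 / 2 ^ k\<close>. In \<open>kernel\<close>, the case \<open>j = k\<close> is near
  symmetry under exchange of the two points; \<open>j < k\<close> gives decay between points already
  separated at scale \<open>j\<close>.\<close>

locale shadow_system = prob_space M
  for M :: "'a::metric_space measure" +
  fixes X :: "'a set" and I :: "'i set" and f :: "'i \<Rightarrow> 'a \<Rightarrow> real" and a :: "'i \<Rightarrow> real"
    and \<sigma> :: "nat \<Rightarrow> 'a \<Rightarrow> 'i" and L C \<theta> :: real
  assumes sets_M: "sets M = sets (restrict_space borel X)"
    and diam: "x \<in> X \<Longrightarrow> y \<in> X \<Longrightarrow> dist x y \<le> 2"
    and countable_I: "countable I"
    and f_lip: "i \<in> I \<Longrightarrow> log_lipschitz_on (L * a i) X (f i)"
    and f_int: "i \<in> I \<Longrightarrow> (\<integral>x. f i x \<partial>M) = 1"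
    and a_ge: "i \<in> I \<Longrightarrow> 1 \<le> a i"
    and L_nonneg: "0 \<le> L"
    and sigma_meas: "\<sigma> k \<in> measurable M (count_space I)"
    and sigma_size: "x \<in> X \<Longrightarrow> a (\<sigma> k x) \<le> C * 2 ^ k"
    and C_ge: "1 \<le> C"
    and theta: "0 < \<theta>" "\<theta> < 1"
    and kernel: "x \<in> X \<Longrightarrow> y \<in> X \<Longrightarrow> j \<le> k \<Longrightarrow> j = k \<or> 1 / 2 ^ j < dist x y \<Longrightarrow>
      f (\<sigma> k y) x \<le> C * \<theta> ^ (k - j) * f (\<sigma> j x) y"
begin

lemma space_M: "space M = X"
  using sets_eq_imp_space_eq[OF sets_M] by (simp add: space_restrict_space)

lemma X_nonempty: "X \<noteq> {}"
  using not_empty space_M by simp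

lemma sigma_in: "x \<in> X \<Longrightarrow> \<sigma> k x \<in> I"
  using measurable_space[OF sigma_meas] space_M by auto

lemma log_lipschitz_measurable: "log_lipschitz_on B X g \<Longrightarrow> g \<in> borel_measurable M"
  using borel_measurable_continuous_on_restrict[OF log_lipschitz_on_continuous]
  by (simp cong: measurable_cong_sets add: sets_M)

lemma f_pos: "i \<in> I \<Longrightarrow> x \<in> X \<Longrightarrow> 0 < f i x"
  using f_lip log_lipschitz_on_pos by blast

text \<open>A non-integrable function has Bochner integral 0, so mean 1 already contains
  integrability.\<close>

lemma f_integrable: "i \<in> I \<Longrightarrow> integrable M (f i)"
  using f_int not_integrable_integral_eq by fastforce

text \<open>On a set of diameter 2, \<open>f i\<close> is everywhere at least
  \<open>exp (- 2 * L * a i)\<close> times any one of its values; the mean 1 then bounds that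
  value.\<close>

lemma f_le: assumes "i \<in> I" "x \<in> X" shows "f i x \<le> exp (2 * L * a i)"
proof -
  have "f i x * exp (- 2 * L * a i) \<le> (\<integral>y. f i y \<partial>M)"
  proof (rule integral_ge_const[OF f_integrable[OF assms(1)]], rule AE_I2)
    fix y assume "y \<in> space M"
    then have y: "y \<in> X" by (simp add: space_M)
    have "f i x \<le> f i y * exp (L * a i * dist x y)"
      using f_lip assms y by (intro log_lipschitz_onD)
    also have "\<dots> \<le> f i y * exp (L * a i * 2)"
      using f_pos[OF assms(1) y] diam[OF assms(2) y] L_nonneg a_ge[OF assms(1)]
      by (intro mult_left_mono) (auto intro!: mult_left_mono)
    finally show "f i x * exp (- 2 * L * a i) \<le> f i y"
      by (simp add: exp_minus field_simps)
  qed
  then show ?thesis using f_int[OF assms(1)] by (simp add: exp_minus field_simps)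
qed

lemma kernel_measurable[measurable]: "(\<lambda>y. f (\<sigma> k y) x) \<in> borel_measurable M"
  by (rule measurable_compose[OF sigma_meas]) simp

lemma kernel_pos: "x \<in> X \<Longrightarrow> y \<in> X \<Longrightarrow> 0 < f (\<sigma> k y) x"
  using f_pos sigma_in by blast

lemma kernel_le: assumes "x \<in> X" "y \<in> X" shows "f (\<sigma> k y) x \<le> exp (2 * L * (C * 2 ^ k))"
proof -
  have "f (\<sigma> k y) x \<le> exp (2 * L * a (\<sigma> k y))" using assms sigma_in f_le by blast
  also have "\<dots> \<le> exp (2 * L * (C * 2 ^ k))"
    using sigma_size[OF assms(2), of k] L_nonneg by (auto intro!: mult_left_mono)
  finally show ?thesis .
qed

lemma log_lipschitz_bounded:
  assumes "log_lipschitz_on B X g" "0 \<le> B"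
  obtains S where "0 < S" "\<And>x. x \<in> X \<Longrightarrow> g x \<le> S"
proof -
  obtain z where z: "z \<in> X" using X_nonempty by blast
  have "g x \<le> g z * exp (B * 2)" if "x \<in> X" for x
  proof -
    have "g x \<le> g z * exp (B * dist x z)" by (rule log_lipschitz_onD[OF assms(1) that z])
    also have "\<dots> \<le> g z * exp (B * 2)"
      using log_lipschitz_on_pos[OF assms(1) z] diam[OF that z] assms(2)
      by (intro mult_left_mono) (auto intro!: mult_left_mono)
    finally show ?thesis .
  qed
  then show thesis using that[of "g z * exp (B * 2)"] log_lipschitz_on_pos[OF assms(1) z] by simp
qed

text \<open>A positive combination of the functions \<open>f i\<close>: the coefficient of
  \<open>f i\<close> is the integral of \<open>g\<close> over the set where
  \<open>\<sigma> k\<close> takes the value \<open>i\<close>.\<close>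

definition avg :: "nat \<Rightarrow> ('a \<Rightarrow> real) \<Rightarrow> 'a \<Rightarrow> real" where
  "avg k g x = (\<integral>y. g y * f (\<sigma> k y) x \<partial>M)"

lemma avg_integrable:
  assumes "log_lipschitz_on B X g" "0 \<le> B" "x \<in> X"
  shows "integrable M (\<lambda>y. g y * f (\<sigma> k y) x)"
proof -
  obtain S where S: "0 < S" "\<And>x. x \<in> X \<Longrightarrow> g x \<le> S"
    using log_lipschitz_bounded[OF assms(1,2)] by metis
  have [measurable]: "g \<in> borel_measurable M" by (rule log_lipschitz_measurable[OF assms(1)])
  show ?thesis
  proof (rule integrable_const_bound[where B = "S * exp (2 * L * (C * 2 ^ k))"], rule AE_I2)
    fix y assume "y \<in> space M"
    then have y: "y \<in> X" by (simp add: space_M)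
    show "norm (g y * f (\<sigma> k y) x) \<le> S * exp (2 * L * (C * 2 ^ k))"
      using kernel_le[OF assms(3) y, of k] kernel_pos[OF assms(3) y, of k] S(2)[OF y] S(1)
        log_lipschitz_on_pos[OF assms(1) y]
      by (simp add: abs_mult mult_mono)
  qed measurable
qed

text \<open>Elements used at scale \<open>k\<close> have size at most \<open>C * 2 ^ k\<close>, so
  all kernels of that scale share one log-Lipschitz constant, and positive averages inherit
  it.\<close>

lemma avg_le_exp:
  assumes "log_lipschitz_on B X g" "0 \<le> B" "x \<in> X" "x' \<in> X"
  shows "avg k g x \<le> avg k g x' * exp (L * C * 2 ^ k * dist x x')"
proof -
  have "avg k g x \<le> (\<integral>y. g y * f (\<sigma> k y) x' * exp (L * C * 2 ^ k * dist x x') \<partial>M)"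
    unfolding avg_def
  proof (rule integral_mono)
    fix y assume "y \<in> space M"
    then have y: "y \<in> X" by (simp add: space_M)
    have "f (\<sigma> k y) x \<le> f (\<sigma> k y) x' * exp (L * a (\<sigma> k y) * dist x x')"
      using f_lip[OF sigma_in[OF y]] assms(3,4) by (rule log_lipschitz_onD)
    also have "\<dots> \<le> f (\<sigma> k y) x' * exp (L * (C * 2 ^ k) * dist x x')"
      using kernel_pos[OF assms(4) y, of k] sigma_size[OF y, of k] L_nonneg
      by (intro mult_left_mono) (auto intro!: mult_right_mono mult_left_mono)
    finally show "g y * f (\<sigma> k y) x \<le> g y * f (\<sigma> k y) x' * exp (L * C * 2 ^ k * dist x x')"
      using log_lipschitz_on_pos[OF assms(1) y] by (simp add: mult.assoc)
  qed (use assms in \<open>auto intro!: avg_integrable\<close>)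
  then show ?thesis by (simp add: avg_def)
qed

text \<open>Sorts the points around \<open>x\<close> into dyadic shells, with everything closer than
  the finest scale put into shell \<open>k\<close>. The largest admissible \<open>j\<close> works;
  \<open>j = 0\<close> is admissible because the diameter is at most 2.\<close>

lemma ex_separation_scale:
  assumes "x \<in> X" "y \<in> X"
  obtains j where "j \<le> k" "dist x y \<le> 2 / 2 ^ j" "j = k \<or> 1 / 2 ^ j < dist x y"
proof -
  define j where "j = Max {j. j \<le> k \<and> dist x y \<le> 2 / 2 ^ j}"
  have fin: "finite {j. j \<le> k \<and> dist x y \<le> 2 / 2 ^ j}" by (rule finite_subset[of _ "{..k}"]) auto
  have "0 \<in> {j. j \<le> k \<and> dist x y \<le> 2 / 2 ^ j}" using diam[OF assms] by simp
  then have j: "j \<le> k" "dist x y \<le> 2 / 2 ^ j"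
    using Max_in[OF fin] unfolding j_def by blast+
  have "j = k \<or> 1 / 2 ^ j < dist x y"
  proof (rule ccontr)
    assume *: "\<not> (j = k \<or> 1 / 2 ^ j < dist x y)"
    then have "Suc j \<in> {j. j \<le> k \<and> dist x y \<le> 2 / 2 ^ j}" using j by auto
    then have "Suc j \<le> j" unfolding j_def by (intro Max_ge fin)
    then show False by simp
  qed
  then show thesis using that j by blast
qed

lemma sum_power_diff_le:
  fixes r :: real
  assumes "0 \<le> r" "r < 1"
  shows "(\<Sum>j\<le>k. r ^ (k - j)) \<le> 1 / (1 - r)"
proof -
  have "(\<Sum>j\<le>k. r ^ (k - j)) = (\<Sum>j\<le>k. r ^ j)"
    by (rule sum.nat_diff_reindex[of "\<lambda>j. r ^ j" "Suc k", unfolded lessThan_Suc_atMost diff_Suc_Suc, simplified])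
  also have "\<dots> \<le> (\<Sum>j. r ^ j)" using assms by (intro sum_le_suminf summable_geometric) auto
  finally show ?thesis using assms by (simp add: suminf_geometric)
qed

text \<open>If \<open>x\<close> and \<open>y\<close> separate at scale \<open>j\<close>, then \<open>S k y \<le> S j y \<le> e\<^sup>2 S j x \<le> e\<^sup>2 \<tau>\<^bsup>j-k\<^esup> S k x\<close>, whereas the
  kernel at scale \<open>k\<close> is at most \<open>C \<theta>\<^bsup>k-j\<^esup>\<close> times the kernel at scale \<open>j\<close>, which has integral 1.\<close>

lemma avg_upper:
  fixes S :: "nat \<Rightarrow> 'a \<Rightarrow> real"
  assumes lip: "\<And>j. j \<le> k \<Longrightarrow> log_lipschitz_on (2 ^ j) X (S j)"
    and dec: "\<And>j y. j < k \<Longrightarrow> y \<in> X \<Longrightarrow> S (Suc j) y \<le> S j y"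
    and low: "\<And>j y. j < k \<Longrightarrow> y \<in> X \<Longrightarrow> \<tau> * S j y \<le> S (Suc j) y"
    and tau: "0 < \<tau>" "\<theta> / \<tau> < 1" and x: "x \<in> X"
  shows "avg k (S k) x \<le> exp 2 * C / (1 - \<theta> / \<tau>) * S k x"
proof -
  have pos: "0 < S j y" if "j \<le> k" "y \<in> X" for j y
    using lip[OF that(1)] that(2) by (rule log_lipschitz_on_pos)
  have mono: "j \<le> k \<Longrightarrow> S k y \<le> S j y" if "y \<in> X" for j y
  proof (induction "k - j" arbitrary: j)
    case (Suc n)
    then have "S k y \<le> S (Suc j) y" by (intro Suc.hyps(1)) auto
    also have "\<dots> \<le> S j y" using Suc that by (intro dec) auto
    finally show ?case .
  qed simp
  have slow: "j \<le> k \<Longrightarrow> \<tau> ^ (k - j) * S j y \<le> S k y" if "y \<in> X" for j y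
  proof (induction "k - j" arbitrary: j)
    case (Suc n)
    then have "k - j = Suc (k - Suc j)" by simp
    then have "\<tau> ^ (k - j) * S j y = \<tau> ^ (k - Suc j) * (\<tau> * S j y)" by simp
    also have "\<dots> \<le> \<tau> ^ (k - Suc j) * S (Suc j) y"
      using Suc that tau by (intro mult_left_mono low) auto
    also have "\<dots> \<le> S k y" using Suc by (intro Suc.hyps(1)) auto
    finally show ?case .
  qed simp
  define c where "c j = exp 2 * C * S k x * (\<theta> / \<tau>) ^ (k - j)" for j
  have cpos: "0 \<le> c j" for j
    using C_ge theta tau pos[OF order_refl x] unfolding c_def by auto
  \<comment> \<open>The mean of \<open>f (\<sigma> k y) x\<close> over \<open>y\<close> is not
    known; it is \<open>f (\<sigma> j x)\<close> that has mean 1 in \<open>y\<close>. So the kernels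
    are exchanged pointwise, and as the scale \<open>j\<close> depends on \<open>y\<close>, the
    bound sums over all scales.\<close>
  have "avg k (S k) x \<le> (\<integral>y. (\<Sum>j\<le>k. c j * f (\<sigma> j x) y) \<partial>M)"
    unfolding avg_def
  proof (rule integral_mono)
    show "integrable M (\<lambda>y. S k y * f (\<sigma> k y) x)"
      by (rule avg_integrable[OF lip[OF order_refl] _ x]) simp
    show "integrable M (\<lambda>y. \<Sum>j\<le>k. c j * f (\<sigma> j x) y)"
      by (intro Bochner_Integration.integrable_sum integrable_mult_right f_integrable sigma_in x)
    fix y assume "y \<in> space M"
    then have y: "y \<in> X" by (simp add: space_M)
    have c0: "0 \<le> c i * f (\<sigma> i x) y" for i
      by (intro mult_nonneg_nonneg cpos less_imp_le[OF kernel_pos[OF y x]])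
    obtain j where j: "j \<le> k" "dist x y \<le> 2 / 2 ^ j" "j = k \<or> 1 / 2 ^ j < dist x y"
      using ex_separation_scale[OF x y] by metis
    have "S k y \<le> S j y" using mono y j by blast
    also have "\<dots> \<le> S j x * exp (2 ^ j * dist y x)" by (rule log_lipschitz_onD[OF lip[OF j(1)] y x])
    also have "\<dots> \<le> S j x * exp 2"
      using j pos[OF j(1) x] by (intro mult_left_mono) (auto simp: dist_commute field_simps)
    also have "\<dots> \<le> S k x / \<tau> ^ (k - j) * exp 2"
      using slow[OF x j(1)] tau by (intro mult_right_mono) (auto simp: field_simps)
    finally have "S k y * f (\<sigma> k y) x \<le> (S k x / \<tau> ^ (k - j) * exp 2) * (C * \<theta> ^ (k - j) * f (\<sigma> j x) y)"
      using kernel[OF x y j(1,3)] kernel_pos[OF x y, of k] pos[OF order_refl y]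
        pos[OF order_refl x] tau by (intro mult_mono) auto
    also have "\<dots> = c j * f (\<sigma> j x) y" by (simp add: c_def power_divide)
    also have "\<dots> \<le> (\<Sum>j\<le>k. c j * f (\<sigma> j x) y)"
      using j by (intro member_le_sum c0) auto
    finally show "S k y * f (\<sigma> k y) x \<le> (\<Sum>j\<le>k. c j * f (\<sigma> j x) y)" .
  qed
  also have "\<dots> = (\<Sum>j\<le>k. c j)"
    using x by (simp add: f_integrable f_int sigma_in)
  also have "\<dots> = exp 2 * C * S k x * (\<Sum>j\<le>k. (\<theta> / \<tau>) ^ (k - j))"
    by (simp add: c_def sum_distrib_left)
  also have "\<dots> \<le> exp 2 * C * S k x * (1 / (1 - \<theta> / \<tau>))"
    using C_ge theta tau pos[OF order_refl x] by (intro mult_left_mono sum_power_diff_le) auto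
  finally show ?thesis by (simp add: field_simps)
qed

text \<open>The points \<open>y\<close> with \<open>dist x y > 2 \<cdot> 2\<^bsup>m-k\<^esup>\<close> carry at most half of the unit mass of the kernel, and on
  the others \<open>g y\<close> is comparable to \<open>g x\<close>.\<close>

lemma avg_lower:
  obtains q where "0 < q"
    "\<And>k g x. log_lipschitz_on (2 ^ k) X g \<Longrightarrow> x \<in> X \<Longrightarrow> q * g x \<le> avg k g x"
proof -
  \<comment> \<open>This bounds the kernel mass in the shells \<open>j < k - m\<close>; the square
    of \<open>C\<close> comes from two uses of \<open>kernel\<close>.\<close>
  have "(\<lambda>m. C\<^sup>2 / (1 - \<theta>) * \<theta> ^ m) \<longlonglongrightarrow> C\<^sup>2 / (1 - \<theta>) * 0"
    using theta by (intro tendsto_mult tendsto_const LIMSEQ_power_zero) auto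
  then have "\<forall>\<^sub>F m in sequentially. C\<^sup>2 / (1 - \<theta>) * \<theta> ^ m < 1/2"
    by (rule order_tendstoD) simp
  then obtain m where m: "C\<^sup>2 / (1 - \<theta>) * \<theta> ^ m < 1/2" by (auto simp: eventually_sequentially)
  define E where "E = exp (2 * 2 ^ m :: real)"
  have E: "0 < E" by (simp add: E_def)
  have "1 / (2 * C * E) * g x \<le> avg k g x" if g: "log_lipschitz_on (2 ^ k) X g" and x: "x \<in> X" for k g x
  proof -
    have gx: "0 < g x" by (rule log_lipschitz_on_pos[OF g x])
    define c where "c j = C\<^sup>2 * \<theta> ^ (k - j) * g x" for j
    define J where "J = {j. j + m < k}"
    have J: "finite J" by (rule finite_subset[of _ "{..k}"]) (auto simp: J_def)
    have cpos: "0 \<le> c j" for j using theta gx by (simp add: c_def)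
    have int: "integrable M (\<lambda>y. C * E * (g y * f (\<sigma> k y) x) + (\<Sum>j\<in>J. c j * f (\<sigma> j x) y))"
      by (intro Bochner_Integration.integrable_sum integrable_mult_right Bochner_Integration.integrable_add f_integrable sigma_in x
          avg_integrable[OF g]) auto
    have int': "integrable M (\<lambda>y. C * E * (g y * f (\<sigma> k y) x))"
      by (intro integrable_mult_right avg_integrable[OF g] x) auto
    have int'': "integrable M (\<lambda>y. (\<Sum>j\<in>J. c j * f (\<sigma> j x) y))"
      by (intro Bochner_Integration.integrable_sum integrable_mult_right f_integrable sigma_in x)
    \<comment> \<open>The left side is \<open>g x\<close>, because \<open>f (\<sigma> k x)\<close>
      has mean 1.\<close>
    have "(\<integral>y. g x * f (\<sigma> k x) y \<partial>M) \<le>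
        (\<integral>y. C * E * (g y * f (\<sigma> k y) x) + (\<Sum>j\<in>J. c j * f (\<sigma> j x) y) \<partial>M)"
    proof (rule integral_mono[OF _ int])
      show "integrable M (\<lambda>y. g x * f (\<sigma> k x) y)"
        by (intro integrable_mult_right f_integrable sigma_in x)
      fix y assume "y \<in> space M"
      then have y: "y \<in> X" by (simp add: space_M)
      have gy: "0 < g y" by (rule log_lipschitz_on_pos[OF g y])
      obtain j where j: "j \<le> k" "dist x y \<le> 2 / 2 ^ j" "j = k \<or> 1 / 2 ^ j < dist x y"
        using ex_separation_scale[OF x y] by metis
      have c0: "0 \<le> c i * f (\<sigma> i x) y" for i
        by (intro mult_nonneg_nonneg cpos less_imp_le[OF kernel_pos[OF y x]])
      have s0: "0 \<le> (\<Sum>j\<in>J. c j * f (\<sigma> j x) y)"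
        by (intro sum_nonneg c0)
      have t0: "0 \<le> C * E * (g y * f (\<sigma> k y) x)"
        using C_ge E gy kernel_pos[OF x y, of k] by simp
      show "g x * f (\<sigma> k x) y \<le> C * E * (g y * f (\<sigma> k y) x) + (\<Sum>j\<in>J. c j * f (\<sigma> j x) y)"
      proof (cases "j \<in> J")
        case True
        then have jk: "j < k" by (simp add: J_def)
        \<comment> \<open>Decay from scale \<open>k\<close> to \<open>j\<close> with the points
          exchanged, then symmetry at scale \<open>j\<close>, leads back to
          \<open>f (\<sigma> j x)\<close>, whose mean in \<open>y\<close> is 1.\<close>
        have "f (\<sigma> k x) y \<le> C * \<theta> ^ (k - j) * f (\<sigma> j y) x"
          using kernel[OF y x j(1)] j(3) by (simp add: dist_commute)
        also have "\<dots> \<le> C * \<theta> ^ (k - j) * (C * f (\<sigma> j x) y)"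
          using kernel[OF x y, of j j] C_ge theta by (intro mult_left_mono) auto
        finally have "g x * f (\<sigma> k x) y \<le> g x * (C * \<theta> ^ (k - j) * (C * f (\<sigma> j x) y))"
          using gx by (intro mult_left_mono) auto
        also have "\<dots> = c j * f (\<sigma> j x) y"
          by (simp add: c_def power2_eq_square)
        also have "\<dots> \<le> (\<Sum>j\<in>J. c j * f (\<sigma> j x) y)"
          using True J by (intro member_le_sum c0) auto
        finally show ?thesis using t0 by linarith
      next
        case False
        then have "k \<le> j + m" by (simp add: J_def)
        then have "(2::real) ^ k \<le> 2 ^ j * 2 ^ m" by (simp flip: power_add add: power_increasing)
        then have "2 ^ k * (2 / 2 ^ j) \<le> 2 * (2 ^ m :: real)" by (simp add: field_simps)
        moreover have "2 ^ k * dist x y \<le> 2 ^ k * (2 / 2 ^ j)" using j by (intro mult_left_mono) auto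
        ultimately have d: "exp (2 ^ k * dist x y) \<le> E" unfolding E_def by simp
        have "g x \<le> g y * exp (2 ^ k * dist x y)" by (rule log_lipschitz_onD[OF g x y])
        also have "\<dots> \<le> g y * E" using gy d by (intro mult_left_mono) auto
        finally have "g x * f (\<sigma> k x) y \<le> (g y * E) * (C * f (\<sigma> k y) x)"
          using kernel[OF y x, of k k] kernel_pos[OF y x, of k] gy E by (intro mult_mono) auto
        then show ?thesis using s0 by (simp add: ac_simps)
      qed
    qed
    also have "\<dots> = C * E * avg k g x + (\<Sum>j\<in>J. c j)"
      unfolding Bochner_Integration.integral_add[OF int' int''] using x
      by (simp add: f_integrable f_int sigma_in avg_def)
    finally have main: "g x \<le> C * E * avg k g x + (\<Sum>j\<in>J. c j)"
      using x by (simp add: f_int sigma_in)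
    have "(\<Sum>j\<in>J. \<theta> ^ (k - j)) \<le> \<theta> ^ m / (1 - \<theta>)"
    proof (cases "m \<le> k")
      case True
      have "(\<Sum>j\<in>J. \<theta> ^ (k - j)) = (\<Sum>j\<in>J. \<theta> ^ m * \<theta> ^ (k - m - j))"
        by (intro sum.cong refl) (auto simp: J_def simp flip: power_add)
      also have "\<dots> \<le> (\<Sum>j\<le>k - m. \<theta> ^ m * \<theta> ^ (k - m - j))"
        using theta by (intro sum_mono2) (auto simp: J_def)
      also have "\<dots> = \<theta> ^ m * (\<Sum>j\<le>k - m. \<theta> ^ (k - m - j))" by (simp add: sum_distrib_left)
      also have "\<dots> \<le> \<theta> ^ m * (1 / (1 - \<theta>))"
        using theta by (intro mult_left_mono sum_power_diff_le) auto
      finally show ?thesis by simp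
    next
      case False
      then have "J = {}" by (auto simp: J_def)
      then show ?thesis using theta by simp
    qed
    then have "C\<^sup>2 * g x * (\<Sum>j\<in>J. \<theta> ^ (k - j)) \<le> C\<^sup>2 * g x * (\<theta> ^ m / (1 - \<theta>))"
      using gx by (intro mult_left_mono) auto
    also have "\<dots> = (C\<^sup>2 / (1 - \<theta>) * \<theta> ^ m) * g x" by simp
    also have "\<dots> \<le> 1/2 * g x" using m gx by (intro mult_right_mono) auto
    finally have "(\<Sum>j\<in>J. c j) \<le> g x / 2"
      by (simp add: c_def sum_distrib_left mult.commute mult.left_commute)
    then have "g x \<le> 2 * (C * E * avg k g x)" using main by linarith
    then show ?thesis using C_ge E by (simp add: field_simps)
  qed
  then show thesis using that[of "1 / (2 * C * E)"] C_ge E by simp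
qed


section \<open>The greedy recursion and the resulting weights\<close>

primrec remainder :: "real \<Rightarrow> ('a \<Rightarrow> real) \<Rightarrow> nat \<Rightarrow> 'a \<Rightarrow> real" where
  "remainder c F 0 = F"
| "remainder c F (Suc k) = (\<lambda>x. remainder c F k x - c * avg k (remainder c F k) x)"

text \<open>For small \<open>c\<close> a step removes at most the fraction \<open>1 / m\<close> of
  the remainder, which keeps it positive and log-Lipschitz at the next scale. By
  \<open>avg_lower\<close> it removes at least the fraction \<open>c * q\<close>, whence geometric
  decay.\<close>

lemma greedy_decomposition:
  assumes F: "log_lipschitz_on 1 X F"
  obtains c r S where "0 < c" "0 \<le> r" "r < 1"
    "\<And>k. log_lipschitz_on (2 ^ k) X (S k)"
    "\<And>k x. x \<in> X \<Longrightarrow> S k x \<le> r ^ k * F x"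
    "\<And>x. x \<in> X \<Longrightarrow> (\<lambda>k. c * avg k (S k) x) sums F x"
proof -
  obtain q where q: "0 < q"
    "\<And>k g x. log_lipschitz_on (2 ^ k) X g \<Longrightarrow> x \<in> X \<Longrightarrow> q * g x \<le> avg k g x"
    using avg_lower by metis
  \<comment> \<open>Two demands on \<open>m\<close>: \<open>m \<ge> L * C + 2\<close> for
    \<open>log_lipschitz_on_diff\<close>, and \<open>1 - 1 / m > \<theta>\<close> for
    \<open>avg_upper\<close>. Only then can \<open>c\<close> be fixed, since the constant
    \<open>U\<close> of \<open>avg_upper\<close> depends on
    \<open>\<tau> = 1 - 1 / m\<close>.\<close>
  obtain m :: nat where m: "max (L * C + 2) (1 / (1 - \<theta>)) < real m"
    using reals_Archimedean2 by blast
  have m2: "2 \<le> m" and mb: "L * C + 2 \<le> real m" using m L_nonneg C_ge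
    by (auto simp: max_def intro: order_trans[of 2] split: if_splits)
       (use m mult_nonneg_nonneg[OF L_nonneg, of C] C_ge in linarith)+
  define \<tau> where "\<tau> = 1 - 1 / real m"
  have "1 / (1 - \<theta>) < real m" using m by simp
  then have "1 / real m < 1 - \<theta>" using theta m2 by (simp add: field_simps)
  then have tau: "0 < \<tau>" "\<theta> / \<tau> < 1" "\<tau> < 1" using theta m2 by (auto simp: \<tau>_def)
  define U where "U = exp 2 * C / (1 - \<theta> / \<tau>)"
  have U: "0 < U" using tau C_ge by (auto simp: U_def)
  define c where "c = 1 / (real m * U)"
  have c: "0 < c" using U m2 by (simp add: c_def)
  define S where "S = remainder c F"
  have S_Suc: "S (Suc k) x = S k x - c * avg k (S k) x" for k x by (simp add: S_def)
  \<comment> \<open>The upper bound at step \<open>k\<close> uses the remainders of all earlier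
    scales, so the invariant carries the whole history.\<close>
  have inv: "(\<forall>j\<le>k. log_lipschitz_on (2 ^ j) X (S j)) \<and>
      (\<forall>j<k. \<forall>y\<in>X. S (Suc j) y \<le> S j y \<and> \<tau> * S j y \<le> S (Suc j) y)" for k
  proof (induction k)
    case 0
    then show ?case using F by (simp add: S_def)
  next
    case (Suc k)
    then have lip: "\<And>j. j \<le> k \<Longrightarrow> log_lipschitz_on (2 ^ j) X (S j)"
      and dec: "\<And>j y. j < k \<Longrightarrow> y \<in> X \<Longrightarrow> S (Suc j) y \<le> S j y"
      and low: "\<And>j y. j < k \<Longrightarrow> y \<in> X \<Longrightarrow> \<tau> * S j y \<le> S (Suc j) y" by auto
    have lk: "log_lipschitz_on (2 ^ k) X (S k)" using lip by simp
    have up: "c * avg k (S k) x \<le> S k x / m" if "x \<in> X" for x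
    proof -
      have "avg k (S k) x \<le> U * S k x"
        unfolding U_def by (rule avg_upper[OF lip dec low tau(1,2) that])
      then have "c * avg k (S k) x \<le> c * (U * S k x)" using c by (intro mult_left_mono) auto
      then show ?thesis using U by (simp add: c_def)
    qed
    have nn: "0 < c * avg k (S k) x" if "x \<in> X" for x
    proof -
      have "0 < q * S k x" using q(1) log_lipschitz_on_pos[OF lk that] by simp
      then have "0 < avg k (S k) x" using q(2)[OF lk that] by linarith
      then show ?thesis using c by simp
    qed
    have "log_lipschitz_on (2 * 2 ^ k) X (\<lambda>x. S k x - c * avg k (S k) x)"
    proof (rule log_lipschitz_on_diff[OF lk])
      show "0 \<le> c * avg k (S k) x" "c * avg k (S k) x \<le> S k x / m" if "x \<in> X" for x
        using nn[OF that] up[OF that] by auto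
      show "c * avg k (S k) x \<le> c * avg k (S k) y * exp (L * C * 2 ^ k * dist x y)"
        if "x \<in> X" "y \<in> X" for x y
        using avg_le_exp[OF lk _ that, of k] c by (simp add: mult.assoc)
    qed (use m2 mb in auto)
    then have new: "log_lipschitz_on (2 ^ Suc k) X (S (Suc k))" by (simp add: S_def)
    have "S (Suc k) y \<le> S k y \<and> \<tau> * S k y \<le> S (Suc k) y" if "y \<in> X" for y
      using up[OF that] nn[OF that] unfolding S_Suc \<tau>_def by (simp add: algebra_simps)
    with Suc new show ?case by (auto simp: le_Suc_eq less_Suc_eq)
  qed
  have lip: "log_lipschitz_on (2 ^ k) X (S k)" for k using inv[of k] by blast
  define r where "r = max 0 (1 - c * q)"
  have r: "0 \<le> r" "r < 1" using c q by (auto simp: r_def)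
  have dec: "S k x \<le> r ^ k * F x" if "x \<in> X" for k x
  proof (induction k)
    case (Suc k)
    have "c * (q * S k x) \<le> c * avg k (S k) x" using q(2)[OF lip that] c by (intro mult_left_mono) auto
    then have "S (Suc k) x \<le> (1 - c * q) * S k x" unfolding S_Suc by (simp add: algebra_simps)
    also have "\<dots> \<le> r * S k x"
      using log_lipschitz_on_pos[OF lip that] by (intro mult_right_mono) (auto simp: r_def less_imp_le)
    also have "\<dots> \<le> r * (r ^ k * F x)" using Suc r by (intro mult_left_mono) auto
    finally show ?case by simp
  qed (simp add: S_def)
  have "(\<lambda>k. c * avg k (S k) x) sums F x" if x: "x \<in> X" for x
  proof -
    have "(\<lambda>k. r ^ k * F x) \<longlonglongrightarrow> 0 * F x"
      using r by (intro tendsto_mult LIMSEQ_power_zero tendsto_const) auto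
    then have "(\<lambda>k. S k x) \<longlonglongrightarrow> 0"
      using dec[OF x] less_imp_le[OF log_lipschitz_on_pos[OF lip x]]
      by (intro tendsto_sandwich[of "\<lambda>_. 0" "\<lambda>k. S k x" sequentially "\<lambda>k. r ^ k * F x"]) auto
    then have "(\<lambda>k. S k x - S (Suc k) x) sums (S 0 x - 0)" by (rule telescope_sums')
    then show ?thesis by (simp add: S_Suc) (simp add: S_def)
  qed
  then show thesis using that[OF c r lip dec] by blast
qed

text \<open>Splits 1 into \<open>h + F\<close>. The part \<open>h\<close> combines all
  \<open>f i\<close> with positive weights \<open>w\<close>, which makes every \<open>p i\<close>
  positive; the rest \<open>F\<close> goes to the greedy scheme, whose averages are regrouped by the
  value of \<open>\<sigma> k\<close>.\<close>

theorem kernel_decomposition: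
  obtains p \<epsilon> where "\<And>i. i \<in> I \<Longrightarrow> 0 < p i"
    "\<And>x. x \<in> X \<Longrightarrow> (\<integral>\<^sup>+i. p i * ennreal (f i x) \<partial>count_space I) = 1"
    "0 < \<epsilon>" "(\<integral>\<^sup>+i. p i * ennreal (a i powr \<epsilon>) \<partial>count_space I) < \<infinity>"
proof -
  \<comment> \<open>Dominates at once the supremum of \<open>f i\<close>, its Lipschitz constant on
    \<open>X\<close>, and the size \<open>a i\<close>.\<close>
  define b where "b i = exp (2 * L * a i) * (1 + L * a i) + a i" for i
  have b: "exp (2 * L * a i) \<le> b i" "exp (2 * L * a i) * (L * a i) \<le> b i" "a i \<le> b i" "0 \<le> b i"
    if "i \<in> I" for i
    using a_ge[OF that] L_nonneg unfolding b_def by (auto simp: algebra_simps)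
  obtain w where w: "\<And>i. i \<in> I \<Longrightarrow> 0 < w i"
    "(\<integral>\<^sup>+i. ennreal (w i * b i) \<partial>count_space I) \<le> ennreal (1/2)"
    using ex_pos_weights[OF countable_I, of b] b(4) by metis
  have wb0: "0 \<le> w i * b i" if "i \<in> I" for i using w(1) b(4) that by (simp add: less_imp_le)
  have wb: "integrable (count_space I) (\<lambda>i. w i * b i)"
    using wb0 le_less_trans[OF w(2) ennreal_less_top]
    by (intro integrableI_nonneg AE_I2) (auto simp: less_top)
  have "ennreal (\<integral>i. w i * b i \<partial>count_space I) \<le> ennreal (1/2)"
    using w(2) nn_integral_eq_integral[OF wb] wb0 by (simp add: AE_count_space)
  then have wb_le: "(\<integral>i. w i * b i \<partial>count_space I) \<le> 1/2" by (subst (asm) ennreal_le_iff) auto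
  have int: "integrable (count_space I) (\<lambda>i. w i * f i x)" if "x \<in> X" for x
  proof (rule Bochner_Integration.integrable_bound[OF wb])
    show "AE i in count_space I. norm (w i * f i x) \<le> norm (w i * b i)"
      unfolding AE_count_space
    proof
      fix i assume i: "i \<in> I"
      have "f i x \<le> b i" using f_le[OF i that] b(1)[OF i] by simp
      then have "w i * f i x \<le> w i * b i" using w(1)[OF i] by simp
      then show "norm (w i * f i x) \<le> norm (w i * b i)"
        using w(1)[OF i] f_pos[OF i that] wb0[OF i] by simp
    qed
  qed simp
  define h where "h x = (\<integral>i. w i * f i x \<partial>count_space I)" for x
  have h0: "0 \<le> h x" if "x \<in> X" for x
    unfolding h_def using w(1) f_pos[OF _ that] by (intro Bochner_Integration.integral_nonneg) (auto simp: less_imp_le)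
  have h_le: "h x \<le> 1/2" if "x \<in> X" for x
  proof -
    have "h x \<le> (\<integral>i. w i * b i \<partial>count_space I)"
      unfolding h_def using w(1) f_le[OF _ that] b(1)
      by (intro integral_mono int that wb mult_left_mono) (auto simp: less_imp_le intro: order_trans)
    then show ?thesis using wb_le by simp
  qed
  have h_lip: "h y - h x \<le> 1/2 * dist x y" if x: "x \<in> X" and y: "y \<in> X" for x y
  proof -
    have "h y - h x = (\<integral>i. w i * f i y - w i * f i x \<partial>count_space I)"
      unfolding h_def using int x y by simp
    also have "\<dots> \<le> (\<integral>i. w i * b i * dist x y \<partial>count_space I)"
    proof (rule integral_mono)
      show "integrable (count_space I) (\<lambda>i. w i * f i y - w i * f i x)" using int x y by simp
      show "integrable (count_space I) (\<lambda>i. w i * b i * dist x y)" using wb by simp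
      fix i assume "i \<in> space (count_space I)"
      then have i: "i \<in> I" by simp
      define d where "d = L * a i * dist x y"
      have d: "0 \<le> d" using L_nonneg a_ge[OF i] by (simp add: d_def)
      have "f i y \<le> f i x * exp d"
        using log_lipschitz_onD[OF f_lip[OF i] y x] by (simp add: d_def dist_commute)
      then have "f i y * exp (- d) \<le> f i x" by (simp add: exp_minus field_simps)
      \<comment> \<open>The inequality \<open>1 - d \<le> exp (- d)\<close> turns the multiplicative
        estimate into an additive one.\<close>
      moreover have "f i y * (1 + - d) \<le> f i y * exp (- d)"
        using f_pos[OF i y] exp_ge_add_one_self[of "- d"] by (intro mult_left_mono) auto
      ultimately have "f i y - f i x \<le> f i y * d" by (simp add: algebra_simps)
      also have "\<dots> \<le> exp (2 * L * a i) * d" using f_le[OF i y] d by (intro mult_right_mono)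
      also have "\<dots> = exp (2 * L * a i) * (L * a i) * dist x y" by (simp add: d_def)
      also have "\<dots> \<le> b i * dist x y" using b(2)[OF i] by (intro mult_right_mono) auto
      finally have "w i * (f i y - f i x) \<le> w i * (b i * dist x y)"
        using w(1)[OF i] by (intro mult_left_mono) auto
      then show "w i * f i y - w i * f i x \<le> w i * b i * dist x y" by (simp add: algebra_simps)
    qed
    also have "\<dots> = (\<integral>i. w i * b i \<partial>count_space I) * dist x y" by simp
    also have "\<dots> \<le> 1/2 * dist x y" using wb_le by (intro mult_right_mono) auto
    finally show ?thesis .
  qed
  \<comment> \<open>As \<open>h\<close> is at most 1/2 with Lipschitz constant 1/2, \<open>F\<close>
    is at least 1/2 and has log-Lipschitz constant 1, the one required at scale
    \<open>k = 0\<close>.\<close>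
  define F where "F x = 1 - h x" for x
  have F: "log_lipschitz_on 1 X F"
    unfolding log_lipschitz_on_def
  proof (intro conjI ballI)
    fix x assume "x \<in> X" then show "0 < F x" using h_le[of x] by (simp add: F_def)
  next
    fix x y assume x: "x \<in> X" and y: "y \<in> X"
    have "F x \<le> F y + 1/2 * dist x y" using h_lip[OF x y] by (simp add: F_def)
    also have "\<dots> \<le> F y + F y * dist x y"
      using h_le[OF y] by (intro add_left_mono mult_right_mono) (auto simp: F_def)
    also have "\<dots> = F y * (1 + dist x y)" by (simp add: algebra_simps)
    also have "\<dots> \<le> F y * exp (1 * dist x y)"
      using h_le[OF y] exp_ge_add_one_self[of "dist x y"] by (intro mult_left_mono) (auto simp: F_def)
    finally show "F x \<le> F y * exp (1 * dist x y)" .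
  qed
  have F1: "F x \<le> 1" if "x \<in> X" for x using h0[OF that] by (simp add: F_def)
  obtain c r S where c: "0 < c" and r: "0 \<le> r" "r < 1"
    and S_lip: "\<And>k. log_lipschitz_on (2 ^ k) X (S k)"
    and S_le: "\<And>k x. x \<in> X \<Longrightarrow> S k x \<le> r ^ k * F x"
    and S_sums: "\<And>x. x \<in> X \<Longrightarrow> (\<lambda>k. c * avg k (S k) x) sums F x"
    by (rule greedy_decomposition[OF F]) blast
  have S_pos: "0 < S k x" if "x \<in> X" for k x by (rule log_lipschitz_on_pos[OF S_lip that])
  have [measurable]: "S k \<in> borel_measurable M" for k by (rule log_lipschitz_measurable[OF S_lip])
  note [measurable] = sigma_meas
  define p where "p i = ennreal (w i) +
      (\<Sum>k. \<integral>\<^sup>+y. ennreal (c * S k y) * indicator {i} (\<sigma> k y) \<partial>M)" for i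
  \<comment> \<open>Stated for arbitrary \<open>\<phi>\<close> to be used twice:
    \<open>f i x\<close> gives the total 1, \<open>a i powr e\<close> the moment.\<close>
  have p_int: "(\<integral>\<^sup>+i. p i * \<phi> i \<partial>count_space I) =
      (\<integral>\<^sup>+i. ennreal (w i) * \<phi> i \<partial>count_space I) +
      (\<Sum>k. \<integral>\<^sup>+y. ennreal (c * S k y) * \<phi> (\<sigma> k y) \<partial>M)" for \<phi> :: "'i \<Rightarrow> ennreal"
  proof -
    have 1: "(\<integral>\<^sup>+i. (\<integral>\<^sup>+y. ennreal (c * S k y) * indicator {i} (\<sigma> k y) \<partial>M) * \<phi> i \<partial>count_space I) =
        (\<integral>\<^sup>+y. ennreal (c * S k y) * \<phi> (\<sigma> k y) \<partial>M)" for k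
    proof -
      have [measurable]: "(\<lambda>y. indicator {i} (\<sigma> k y) :: ennreal) \<in> borel_measurable M" for i
        by (rule measurable_compose[OF sigma_meas]) simp
      have "(\<integral>\<^sup>+i. (\<integral>\<^sup>+y. ennreal (c * S k y) * indicator {i} (\<sigma> k y) \<partial>M) * \<phi> i \<partial>count_space I) =
          (\<integral>\<^sup>+i. \<integral>\<^sup>+y. ennreal (c * S k y) * indicator {i} (\<sigma> k y) * \<phi> i \<partial>M \<partial>count_space I)"
        by (intro nn_integral_cong nn_integral_multc[symmetric]) measurable
      also have "\<dots> = (\<integral>\<^sup>+y. \<integral>\<^sup>+i. ennreal (c * S k y) * indicator {i} (\<sigma> k y) * \<phi> i \<partial>count_space I \<partial>M)"
        by (rule nn_integral_count_space_nn_integral[symmetric, OF countable_I]) measurable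
      also have "\<dots> = (\<integral>\<^sup>+y. ennreal (c * S k y) * \<phi> (\<sigma> k y) \<partial>M)"
      proof (rule nn_integral_cong)
        fix y assume "y \<in> space M"
        then have "\<sigma> k y \<in> I" by (simp add: space_M sigma_in)
        then have "(\<integral>\<^sup>+i. ennreal (c * S k y) * indicator {i} (\<sigma> k y) * \<phi> i \<partial>count_space I) =
            (\<Sum>i\<in>{\<sigma> k y}. ennreal (c * S k y) * indicator {i} (\<sigma> k y) * \<phi> i)"
          by (intro nn_integral_count_space') (auto split: split_indicator)
        then show "(\<integral>\<^sup>+i. ennreal (c * S k y) * indicator {i} (\<sigma> k y) * \<phi> i \<partial>count_space I) =
            ennreal (c * S k y) * \<phi> (\<sigma> k y)" by simp
      qed
      finally show ?thesis .
    qed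
    have "(\<integral>\<^sup>+i. p i * \<phi> i \<partial>count_space I) = (\<integral>\<^sup>+i. ennreal (w i) * \<phi> i +
        (\<Sum>k. (\<integral>\<^sup>+y. ennreal (c * S k y) * indicator {i} (\<sigma> k y) \<partial>M) * \<phi> i) \<partial>count_space I)"
      by (intro nn_integral_cong) (simp add: p_def distrib_right ennreal_suminf_multc)
    also have "\<dots> = (\<integral>\<^sup>+i. ennreal (w i) * \<phi> i \<partial>count_space I) +
        (\<Sum>k. \<integral>\<^sup>+i. (\<integral>\<^sup>+y. ennreal (c * S k y) * indicator {i} (\<sigma> k y) \<partial>M) * \<phi> i \<partial>count_space I)"
      by (subst nn_integral_add, simp, simp, subst nn_integral_suminf) simp_all
    finally show ?thesis by (simp add: 1)
  qed
  have p1: "(\<integral>\<^sup>+i. p i * ennreal (f i x) \<partial>count_space I) = 1" if x: "x \<in> X" for x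
  proof -
    have "(\<integral>\<^sup>+i. ennreal (w i) * ennreal (f i x) \<partial>count_space I) = ennreal (h x)"
      unfolding h_def using w(1) f_pos[OF _ x]
      by (subst nn_integral_eq_integral[OF int[OF x], symmetric])
        (auto simp: AE_count_space less_imp_le ennreal_mult intro!: nn_integral_cong)
    moreover have "(\<integral>\<^sup>+y. ennreal (c * S k y) * ennreal (f (\<sigma> k y) x) \<partial>M) = ennreal (c * avg k (S k) x)" for k
    proof -
      have i: "integrable M (\<lambda>y. c * (S k y * f (\<sigma> k y) x))"
        by (intro integrable_mult_right avg_integrable[OF S_lip] x) auto
      have "(\<integral>\<^sup>+y. ennreal (c * S k y) * ennreal (f (\<sigma> k y) x) \<partial>M) =
          (\<integral>\<^sup>+y. ennreal (c * (S k y * f (\<sigma> k y) x)) \<partial>M)"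
        using c S_pos kernel_pos[OF x]
        by (intro nn_integral_cong) (auto simp: space_M ennreal_mult less_imp_le mult.assoc)
      also have "\<dots> = ennreal (\<integral>y. c * (S k y * f (\<sigma> k y) x) \<partial>M)"
        using c S_pos kernel_pos[OF x]
        by (intro nn_integral_eq_integral[OF i] AE_I2) (auto simp: space_M less_imp_le)
      finally show ?thesis by (simp add: avg_def)
    qed
    moreover have "(\<Sum>k. ennreal (c * avg k (S k) x)) = ennreal (F x)"
    proof (rule suminf_ennreal_eq[OF _ S_sums[OF x]])
      show "0 \<le> c * avg k (S k) x" for k
        unfolding avg_def using c S_pos kernel_pos[OF x]
        by (intro mult_nonneg_nonneg Bochner_Integration.integral_nonneg) (auto simp: space_M less_imp_le)
    qed
    ultimately have "(\<integral>\<^sup>+i. p i * ennreal (f i x) \<partial>count_space I) = ennreal (h x) + ennreal (F x)"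
      unfolding p_int by simp
    also have "\<dots> = ennreal (h x + F x)" using h0[OF x] h_le[OF x] by (simp add: F_def ennreal_plus[symmetric] del: ennreal_plus)
    finally show ?thesis by (simp add: F_def)
  qed
  \<comment> \<open>Step \<open>k\<close> puts mass at most \<open>c * r ^ k\<close> on elements of
    size at most \<open>C * 2 ^ k\<close>, so the moment is dominated by a geometric series of ratio
    \<open>2 powr e * r\<close>. The bound \<open>e < 1\<close> serves the weights \<open>w\<close>,
    where \<open>a i powr e \<le> a i\<close>.\<close>
  have "((\<lambda>e. 2 powr e * r) \<longlongrightarrow> 2 powr 0 * r) (at_right 0)"
    by (intro tendsto_intros) auto
  then have "\<forall>\<^sub>F e in at_right 0. 2 powr e * r < 1" by (rule order_tendstoD) (use r in simp)
  moreover have "\<forall>\<^sub>F e in at_right (0::real). 0 < e \<and> e < 1"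
    by (rule eventually_at_rightI[of 0 1]) auto
  ultimately have "\<forall>\<^sub>F e in at_right 0. 2 powr e * r < 1 \<and> 0 < e \<and> e < 1" by (rule eventually_conj)
  then obtain e :: real where e: "2 powr e * r < 1" "0 < e" "e < 1"
    using eventually_happens'[OF trivial_limit_at_right_real] by blast
  have "(\<integral>\<^sup>+i. ennreal (w i) * ennreal (a i powr e) \<partial>count_space I) \<le> (\<integral>\<^sup>+i. ennreal (w i * b i) \<partial>count_space I)"
  proof (intro nn_integral_mono)
    fix i assume "i \<in> space (count_space I)"
    then have i: "i \<in> I" by simp
    have "a i powr e \<le> a i powr 1" using a_ge[OF i] e by (intro powr_mono) auto
    also have "\<dots> \<le> b i" using a_ge[OF i] b(3)[OF i] by simp
    finally show "ennreal (w i) * ennreal (a i powr e) \<le> ennreal (w i * b i)"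
      using w(1)[OF i] by (subst ennreal_mult[symmetric]) (auto intro!: ennreal_leI mult_left_mono)
  qed
  also have "\<dots> < \<infinity>" using le_less_trans[OF w(2) ennreal_less_top] by (simp add: less_top)
  finally have fin1: "(\<integral>\<^sup>+i. ennreal (w i) * ennreal (a i powr e) \<partial>count_space I) < \<infinity>" .
  have "(\<Sum>k. \<integral>\<^sup>+y. ennreal (c * S k y) * ennreal (a (\<sigma> k y) powr e) \<partial>M)
      \<le> (\<Sum>k. ennreal (c * C powr e * (2 powr e * r) ^ k))"
  proof (intro suminf_le summableI)
    fix k
    have "(\<integral>\<^sup>+y. ennreal (c * S k y) * ennreal (a (\<sigma> k y) powr e) \<partial>M)
        \<le> (\<integral>\<^sup>+y. ennreal (c * C powr e * (2 powr e * r) ^ k) \<partial>M)"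
    proof (rule nn_integral_mono)
      fix y assume "y \<in> space M"
      then have y: "y \<in> X" by (simp add: space_M)
      have "S k y \<le> r ^ k * F y" by (rule S_le[OF y])
      also have "\<dots> \<le> r ^ k * 1" using r F1[OF y] by (intro mult_left_mono) auto
      finally have 1: "S k y \<le> r ^ k" by simp
      have "a (\<sigma> k y) powr e \<le> (C * 2 ^ k) powr e"
        using sigma_size[OF y, of k] a_ge[OF sigma_in[OF y, of k]] e by (intro powr_mono2) auto
      also have "\<dots> = C powr e * (2 powr e) ^ k"
        using C_ge by (simp add: powr_mult powr_power mult.commute powr_powr flip: powr_realpow)
      finally have "c * S k y * a (\<sigma> k y) powr e \<le> c * r ^ k * (C powr e * (2 powr e) ^ k)"
        using c r 1 S_pos[OF y, of k] by (intro mult_mono) auto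
      also have "\<dots> = c * C powr e * (2 powr e * r) ^ k" by (simp add: power_mult_distrib)
      finally show "ennreal (c * S k y) * ennreal (a (\<sigma> k y) powr e)
          \<le> ennreal (c * C powr e * (2 powr e * r) ^ k)"
        using c S_pos[OF y, of k] by (subst ennreal_mult[symmetric]) (auto intro!: ennreal_leI)
    qed
    then show "(\<integral>\<^sup>+y. ennreal (c * S k y) * ennreal (a (\<sigma> k y) powr e) \<partial>M)
        \<le> ennreal (c * C powr e * (2 powr e * r) ^ k)" by (simp add: emeasure_space_1)
  qed
  also have "\<dots> = ennreal (c * C powr e * (1 / (1 - 2 powr e * r)))"
    using c r e by (intro suminf_ennreal_eq sums_mult geometric_sums) auto
  also have "\<dots> < \<infinity>" by simp
  finally have fin2: "(\<Sum>k. \<integral>\<^sup>+y. ennreal (c * S k y) * ennreal (a (\<sigma> k y) powr e) \<partial>M) < \<infinity>" .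
  have "0 < p i" if "i \<in> I" for i unfolding p_def using w(1)[OF that] by (simp add: add_pos_nonneg)
  moreover have "(\<integral>\<^sup>+i. p i * ennreal (a i powr e) \<partial>count_space I) < \<infinity>"
    unfolding p_int using fin1 fin2 by (simp add: ennreal_add_less_top infinity_ennreal_def)
  ultimately show thesis using that p1 e(2) by blast
qed

end

section \<open>The conformal factor\<close>

text \<open>On the group this is the hyperbolic cosine of the distance from the origin to
  \<open>hyp_act A 0\<close>.\<close>

definition boost :: "real ^ ('n::finite) option ^ 'n option \<Rightarrow> real" where
  "boost A = A $ None $ None"

text \<open>For \<open>x\<close> on the sphere this is the exponential of the Busemann function
  comparing the distances of \<open>x\<close> from \<open>hyp_act A 0\<close> and from the
  origin.\<close>

definition conf_factor :: "real ^ ('n::finite) option ^ 'n option \<Rightarrow> real ^ 'n \<Rightarrow> real" where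
  "conf_factor A x = boost A * (1 - hyp_act A 0 \<bullet> x)"

lemma sum_UNIV_option: "(\<Sum>i\<in>UNIV. f i) = f None + (\<Sum>i\<in>UNIV. f (Some i))"
  for f :: "'n::finite option \<Rightarrow> 'a::comm_monoid_add"
  by (simp add: UNIV_option_conv sum.reindex)

lemma matrix_lift_mink:
  "(A *v lift_mink x) $ j = A $ j $ None + (\<chi> i. A $ j $ Some i) \<bullet> x"
  by (simp add: matrix_vector_mult_def sum_UNIV_option lift_mink_def inner_vec_def)

lemma matrix_lift_mink_0: "(A *v lift_mink 0) $ None = boost A"
  by (simp add: matrix_lift_mink boost_def)

lemma boost_pos: "A \<in> carrier SO0_mink \<Longrightarrow> 0 < boost A"
  using SO0_mink_time_pos[of A 0] by (simp add: matrix_lift_mink_0)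

lemma hyp_act_0_inner:
  assumes "A \<in> carrier SO0_mink"
  shows "hyp_act A 0 \<bullet> hyp_act A 0 = 1 - 1 / (boost A)\<^sup>2"
  using mink_form_hyp_act[OF assms, of 0 0] by (simp add: matrix_lift_mink_0 power2_eq_square)

lemma boost_ge_1: assumes "A \<in> carrier SO0_mink" shows "1 \<le> boost A"
proof -
  have "1 / (boost A)\<^sup>2 \<le> 1" using hyp_act_0_inner[OF assms] inner_ge_zero[of "hyp_act A 0"] by linarith
  then have "1 \<le> (boost A)\<^sup>2" using boost_pos[OF assms] by (simp add: divide_le_eq)
  then show ?thesis using boost_pos[OF assms] power2_le_imp_le[of 1 "boost A"] by simp
qed

text \<open>At the boundary point opposite to the row the time coordinate is \<open>boost A\<close>
  minus the norm of the row, and it is positive.\<close>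

lemma norm_first_row:
  assumes "A \<in> carrier SO0_mink" shows "norm (\<chi> i. A $ None $ Some i) < boost A"
proof (cases "(\<chi> i. A $ None $ Some i) = 0")
  case True
  then show ?thesis using boost_pos[OF assms] by simp
next
  case False
  define r where "r = (\<chi> i. A $ None $ Some i)"
  have r: "r \<noteq> 0" using False by (simp add: r_def)
  have "0 < (A *v lift_mink (- (1 / norm r) *\<^sub>R r)) $ None"
    using r by (intro SO0_mink_time_pos[OF assms]) simp
  then have "0 < boost A - (1 / norm r) * (r \<bullet> r)" by (simp add: matrix_lift_mink boost_def flip: r_def)
  also have "(1 / norm r) * (r \<bullet> r) = norm r" using r by (simp add: power2_norm_eq_inner[symmetric] power2_eq_square)
  finally show ?thesis by (simp add: r_def)
qed

lemma time_coordinate_bounds: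
  assumes "A \<in> carrier SO0_mink" "norm y \<le> r" "r \<le> 1"
  shows "boost A * (1 - r) \<le> (A *v lift_mink y) $ None" "(A *v lift_mink y) $ None \<le> 2 * boost A"
proof -
  define v where "v = (\<chi> i. A $ None $ Some i)"
  have "\<bar>v \<bullet> y\<bar> \<le> norm v * norm y" by (rule Cauchy_Schwarz_ineq2)
  also have "\<dots> \<le> boost A * r"
    using norm_first_row[OF assms(1)] boost_pos[OF assms(1)] assms(2) by (intro mult_mono) (auto simp: v_def)
  finally have "\<bar>v \<bullet> y\<bar> \<le> boost A * r" .
  moreover have "boost A * r \<le> boost A * 1" using boost_pos[OF assms(1)] assms(3) by (intro mult_left_mono) auto
  ultimately show "boost A * (1 - r) \<le> (A *v lift_mink y) $ None" "(A *v lift_mink y) $ None \<le> 2 * boost A"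
    by (auto simp: matrix_lift_mink boost_def algebra_simps simp flip: v_def)
qed

text \<open>With \<open>p = hyp_act A 0\<close> and a unit vector \<open>x\<close>,
  \<open>|x - p|^2 = 2 (1 - p \<bullet> x) - (1 - |p|^2)\<close>, where
  \<open>1 - |p|^2 = 1 / (boost A)^2\<close>. Thus negative powers of the factor peak in the
  direction of \<open>p\<close>, with width of order \<open>1 / boost A\<close>.\<close>

lemma conf_factor_sphere:
  assumes "A \<in> carrier SO0_mink" "norm x = 1"
  shows "conf_factor A x = boost A / 2 * ((dist x (hyp_act A 0))\<^sup>2 + 1 / (boost A)\<^sup>2)"
proof -
  have "x \<bullet> x = 1" using assms(2) by (simp add: norm_eq_1)
  then have "(dist x (hyp_act A 0))\<^sup>2 = 2 * (1 - hyp_act A 0 \<bullet> x) - 1 / (boost A)\<^sup>2"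
    using hyp_act_0_inner[OF assms(1)]
    by (simp add: dist_norm power2_norm_eq_inner inner_diff_left inner_diff_right inner_commute)
  then show ?thesis by (simp add: conf_factor_def)
qed

lemma conf_factor_pos:
  assumes "A \<in> carrier SO0_mink" "norm x = 1" shows "0 < conf_factor A x"
  unfolding conf_factor_sphere[OF assms] using boost_pos[OF assms(1)]
  by (intro mult_pos_pos add_nonneg_pos) auto

text \<open>Up to the factor \<open>boost A / 2\<close>, the square root of the conformal factor is the norm of
  \<open>(x - hyp_act A 0, 1 / boost A)\<close>, which is 1-Lipschitz in \<open>x\<close> and at least \<open>1 / boost A\<close>.\<close>

lemma conf_factor_le_exp:
  fixes x y :: "real ^ 'n::finite"
  assumes A: "A \<in> carrier SO0_mink" and "norm x = 1" "norm y = 1"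
  shows "conf_factor A x \<le> conf_factor A y * exp (2 * boost A * dist x y)"
proof -
  define a where "a = boost A"
  define p where "p = hyp_act A 0"
  have a: "0 < a" using boost_pos[OF A] by (simp add: a_def)
  define N where "N z = norm (z - p, 1 / a)" for z :: "real ^ 'n"
  have N2: "(N z)\<^sup>2 = (dist z p)\<^sup>2 + 1 / a\<^sup>2" for z
    by (simp add: N_def norm_prod_def dist_norm power_divide)
  have N: "1 / a \<le> N y" unfolding N_def using norm_snd_le[of "1 / a" "y - p"] a by simp
  have "N x \<le> N y + norm ((x - p, 1 / a) - (y - p, 1 / a))"
    unfolding N_def by (rule norm_triangle_sub)
  also have "\<dots> = N y + dist x y" by (simp add: norm_prod_def dist_norm)
  also have "\<dots> \<le> N y + (a * N y) * dist x y"
    using N a by (intro add_left_mono mult_left_le[of _ "a * N y", simplified mult.commute] mult_right_mono[of 1 "a * N y", simplified]) (auto simp: field_simps)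
  also have "\<dots> = N y * (1 + a * dist x y)" by (simp add: algebra_simps)
  also have "\<dots> \<le> N y * exp (a * dist x y)"
    using exp_ge_add_one_self by (intro mult_left_mono) (auto simp: N_def)
  finally have "(N x)\<^sup>2 \<le> (N y * exp (a * dist x y))\<^sup>2" by (intro power_mono) (auto simp: N_def)
  also have "\<dots> = (N y)\<^sup>2 * exp (2 * a * dist x y)"
    by (simp add: power_mult_distrib mult.assoc flip: exp_double)
  finally have "a / 2 * (N x)\<^sup>2 \<le> a / 2 * ((N y)\<^sup>2 * exp (2 * a * dist x y))"
    using a by (intro mult_left_mono) auto
  then show ?thesis
    unfolding conf_factor_sphere[OF A assms(2)] conf_factor_sphere[OF A assms(3)]
    by (simp add: N2 a_def p_def mult.assoc)
qed

lemma conf_factor_powr_log_lipschitz: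
  assumes "A \<in> carrier SO0_mink" "X \<subseteq> sphere 0 1" "0 \<le> \<delta>"
  shows "log_lipschitz_on (2 * \<delta> * boost A) X (\<lambda>x. conf_factor A x powr (- \<delta>))"
  unfolding log_lipschitz_on_def
proof (intro conjI ballI)
  fix x assume "x \<in> X"
  then have x: "norm x = 1" using assms(2) by auto
  show "0 < conf_factor A x powr (- \<delta>)" using conf_factor_pos[OF assms(1) x] by simp
  fix y assume "y \<in> X"
  then have y: "norm y = 1" using assms(2) by auto
  have "conf_factor A y \<le> conf_factor A x * exp (2 * boost A * dist x y)"
    using conf_factor_le_exp[OF assms(1) y x] by (simp add: dist_commute)
  then have "conf_factor A y * exp (- (2 * boost A * dist x y)) \<le> conf_factor A x"
    by (simp add: exp_minus field_simps)
  then have "conf_factor A x powr (- \<delta>) \<le> (conf_factor A y * exp (- (2 * boost A * dist x y))) powr (- \<delta>)"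
    using assms(3) conf_factor_pos[OF assms(1) y] by (intro powr_mono2') auto
  also have "\<dots> = conf_factor A y powr (- \<delta>) * exp (2 * \<delta> * boost A * dist x y)"
    using conf_factor_pos[OF assms(1) y] by (simp add: powr_mult exp_powr_real mult.commute mult.left_commute)
  finally show "conf_factor A x powr (- \<delta>) \<le> conf_factor A y powr (- \<delta>) * exp (2 * \<delta> * boost A * dist x y)" .
qed

section \<open>Comparison of conformal factors at dyadic scales\<close>

text \<open>Replacing the centre \<open>hyp_act A 0\<close> by \<open>y\<close> moves it by at most
  \<open>C / s\<close>, which the term \<open>1 / s^2\<close> absorbs. The resulting model is
  symmetric in \<open>x\<close> and \<open>y\<close>.\<close>

lemma conf_factor_bounds:
  fixes s C :: real
  assumes A: "A \<in> carrier SO0_mink" and x: "norm x = 1" and C: "1 \<le> C" "0 < s"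
    and a: "s / C \<le> boost A" "boost A \<le> C * s" and p: "dist (hyp_act A 0) y \<le> C / s"
  shows "conf_factor A x \<le> 10 * C ^ 5 * (s * ((dist x y)\<^sup>2 + 1 / s\<^sup>2))"
    "s * ((dist x y)\<^sup>2 + 1 / s\<^sup>2) \<le> 10 * C ^ 5 * conf_factor A x"
proof -
  define b where "b = boost A"
  define D where "D = dist x y"
  define E where "E = dist x (hyp_act A 0)"
  have b: "0 < b" using boost_pos[OF A] by (simp add: b_def)
  have cf: "conf_factor A x = b / 2 * (E\<^sup>2 + 1 / b\<^sup>2)"
    using conf_factor_sphere[OF A x] by (simp add: b_def E_def)
  have sq: "(u + v)\<^sup>2 \<le> 2 * u\<^sup>2 + 2 * v\<^sup>2" for u v :: real
    using sum_squares_bound[of u v] by (simp add: power2_sum)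
  have C2: "1 \<le> C\<^sup>2" and C4: "C\<^sup>2 \<le> C ^ 4" and C5: "C ^ 3 \<le> C ^ 5" using C by (auto intro: power_increasing)
  have bs: "1 / b\<^sup>2 \<le> C\<^sup>2 / s\<^sup>2" "1 / s\<^sup>2 \<le> C\<^sup>2 / b\<^sup>2"
  proof -
    have "s\<^sup>2 \<le> (C * b)\<^sup>2" using a C b by (intro power_mono) (auto simp: b_def field_simps)
    then show "1 / b\<^sup>2 \<le> C\<^sup>2 / s\<^sup>2" using C b by (simp add: field_simps power_mult_distrib)
    have "b\<^sup>2 \<le> (C * s)\<^sup>2" using a C b by (intro power_mono) (auto simp: b_def)
    then show "1 / s\<^sup>2 \<le> C\<^sup>2 / b\<^sup>2" using C b by (simp add: field_simps power_mult_distrib)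
  qed
  have "E \<le> D + C / s" using p dist_triangle[of x "hyp_act A 0" y] by (simp add: D_def E_def dist_commute)
  then have "E\<^sup>2 \<le> (D + C / s)\<^sup>2" by (intro power_mono) (auto simp: E_def)
  also have "\<dots> \<le> 2 * D\<^sup>2 + 2 * (C\<^sup>2 / s\<^sup>2)" using sq[of D "C / s"] by (simp add: power_divide)
  finally have "E\<^sup>2 + 1 / b\<^sup>2 \<le> 2 * D\<^sup>2 + 3 * (C\<^sup>2 / s\<^sup>2)" using bs by linarith
  also have "\<dots> \<le> 3 * C\<^sup>2 * (D\<^sup>2 + 1 / s\<^sup>2)"
    using mult_right_mono[OF C2, of "D\<^sup>2"] by (simp add: algebra_simps) (use C2 in \<open>smt (verit) zero_le_power2 mult_right_mono\<close>)
  finally have "conf_factor A x \<le> (C * s) / 2 * (3 * C\<^sup>2 * (D\<^sup>2 + 1 / s\<^sup>2))"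
    unfolding cf using a b C by (intro mult_mono) (auto simp: b_def)
  also have "\<dots> = (3 / 2 * C ^ 3) * (s * (D\<^sup>2 + 1 / s\<^sup>2))" by (simp add: power3_eq_cube power2_eq_square)
  also have "\<dots> \<le> (10 * C ^ 5) * (s * (D\<^sup>2 + 1 / s\<^sup>2))"
  proof (rule mult_right_mono)
    show "3 / 2 * C ^ 3 \<le> 10 * C ^ 5" using C5 zero_le_power[of C 5] C by linarith
  qed (use C in auto)
  finally show "conf_factor A x \<le> 10 * C ^ 5 * (s * ((dist x y)\<^sup>2 + 1 / s\<^sup>2))" by (simp add: D_def)
  have "D \<le> E + C / s" using p dist_triangle[of x y "hyp_act A 0"] by (simp add: D_def E_def)
  then have "D\<^sup>2 \<le> (E + C / s)\<^sup>2" by (intro power_mono) (auto simp: D_def)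
  also have "\<dots> \<le> 2 * E\<^sup>2 + 2 * (C\<^sup>2 * (1 / s\<^sup>2))" using sq[of E "C / s"] by (simp add: power_divide)
  finally have "D\<^sup>2 + 1 / s\<^sup>2 \<le> 2 * E\<^sup>2 + 3 * (C\<^sup>2 * (1 / s\<^sup>2))"
    using mult_right_mono[OF C2, of "1 / s\<^sup>2"] by simp
  also have "\<dots> \<le> 2 * E\<^sup>2 + 3 * (C\<^sup>2 * (C\<^sup>2 / b\<^sup>2))"
    using bs C by (intro add_left_mono mult_left_mono) auto
  also have "\<dots> = 2 * E\<^sup>2 + 3 * C ^ 4 * (1 / b\<^sup>2)" by (simp add: power4_eq_xxxx power2_eq_square)
  also have "\<dots> \<le> (5 * C ^ 4) * E\<^sup>2 + (5 * C ^ 4) * (1 / b\<^sup>2)"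
  proof (rule add_mono[OF mult_right_mono mult_right_mono])
    show "2 \<le> 5 * C ^ 4" "3 * C ^ 4 \<le> 5 * C ^ 4" using C2 C4 by linarith+
  qed auto
  finally have "s * (D\<^sup>2 + 1 / s\<^sup>2) \<le> (C * b) * ((5 * C ^ 4) * (E\<^sup>2 + 1 / b\<^sup>2))"
    using a C b by (intro mult_mono) (auto simp: b_def field_simps)
  also have "\<dots> = 10 * C ^ 5 * conf_factor A x" unfolding cf by (simp add: eval_nat_numeral)
  finally show "s * ((dist x y)\<^sup>2 + 1 / s\<^sup>2) \<le> 10 * C ^ 5 * conf_factor A x" by (simp add: D_def)
qed

text \<open>Both factors are replaced by the symmetric model \<open>K\<close>. Once
  \<open>dist x y > 1 / 2 ^ j\<close>, the quadratic term dominates in \<open>K j\<close>, so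
  \<open>2 ^ (k - j) * K j \<le> 2 * K k\<close>. The constant 200 is 2 times 10 times 10.\<close>

lemma conf_factor_kernel:
  fixes C :: real
  assumes A: "A \<in> carrier SO0_mink" "B \<in> carrier SO0_mink" and xy: "norm x = 1" "norm y = 1"
    and C: "1 \<le> C" and \<delta>: "0 \<le> \<delta>"
    and a: "2 ^ k / C \<le> boost A" "boost A \<le> C * 2 ^ k" "dist (hyp_act A 0) y \<le> C / 2 ^ k"
    and b: "2 ^ j / C \<le> boost B" "boost B \<le> C * 2 ^ j" "dist (hyp_act B 0) x \<le> C / 2 ^ j"
    and jk: "j \<le> k" "j = k \<or> 1 / 2 ^ j < dist x y"
  shows "conf_factor A x powr (- \<delta>)
    \<le> (200 * C ^ 10) powr \<delta> * (2 powr (- \<delta>)) ^ (k - j) * conf_factor B y powr (- \<delta>)"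
proof -
  define D where "D = dist x y"
  define K where "K i = 2 ^ i * (D\<^sup>2 + 1 / (2 ^ i)\<^sup>2)" for i :: nat
  have K0: "0 \<le> K i" for i by (simp add: K_def)
  have K: "2 ^ (k - j) * K j \<le> 2 * K k"
  proof (cases "j = k")
    case True
    then show ?thesis using K0[of k] by simp
  next
    case False
    then have "1 / 2 ^ j < D" using jk by (simp add: D_def)
    then have "(1 / 2 ^ j)\<^sup>2 \<le> D\<^sup>2" by (intro power_mono) auto
    then have "K j \<le> 2 ^ j * (2 * D\<^sup>2)" unfolding K_def by (intro mult_left_mono) (auto simp: power_divide)
    then have "2 ^ (k - j) * K j \<le> 2 ^ (k - j) * (2 ^ j * (2 * D\<^sup>2))" by (intro mult_left_mono) auto
    also have "\<dots> = (2 ^ (k - j) * 2 ^ j) * (2 * D\<^sup>2)" by (simp only: mult.assoc)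
    also have "(2 ^ (k - j) * 2 ^ j :: real) = 2 ^ k" using jk(1) by (simp flip: power_add)
    also have "2 ^ k * (2 * D\<^sup>2) \<le> 2 * K k" unfolding K_def by (simp add: algebra_simps)
    finally show ?thesis .
  qed
  have pos: "0 < conf_factor A x" "0 < conf_factor B y" using conf_factor_pos A xy by blast+
  have "2 ^ (k - j) * conf_factor B y \<le> 2 ^ (k - j) * (10 * C ^ 5 * K j)"
    using conf_factor_bounds(1)[OF A(2) xy(2) C _ b] by (intro mult_left_mono) (auto simp: K_def D_def dist_commute)
  also have "\<dots> = 10 * C ^ 5 * (2 ^ (k - j) * K j)" by simp
  also have "\<dots> \<le> 10 * C ^ 5 * (2 * K k)" using K C by (intro mult_left_mono) auto
  also have "\<dots> = 20 * C ^ 5 * K k" by simp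
  also have "\<dots> \<le> 20 * C ^ 5 * (10 * C ^ 5 * conf_factor A x)"
    using conf_factor_bounds(2)[OF A(1) xy(1) C _ a] C by (intro mult_left_mono) (auto simp: K_def D_def)
  also have "\<dots> = 200 * C ^ 10 * conf_factor A x" by (simp flip: power_add)
  finally have "2 ^ (k - j) * conf_factor B y \<le> 200 * C ^ 10 * conf_factor A x" .
  then have "2 ^ (k - j) * conf_factor B y / (200 * C ^ 10) \<le> conf_factor A x"
    using C by (simp add: field_simps)
  then have "conf_factor A x powr (- \<delta>) \<le> (2 ^ (k - j) * conf_factor B y / (200 * C ^ 10)) powr (- \<delta>)"
    using pos C \<delta> by (intro powr_mono2') auto
  also have "\<dots> = (2 ^ (k - j)) powr (- \<delta>) * conf_factor B y powr (- \<delta>) * (200 * C ^ 10) powr \<delta>"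
    using pos C by (simp add: powr_divide powr_mult powr_minus divide_simps)
  also have "(2 ^ (k - j)) powr (- \<delta>) = (2 powr (- \<delta>)) ^ (k - j)"
    by (simp add: powr_powr mult.commute flip: powr_realpow)
  finally show ?thesis by (simp add: ac_simps)
qed

section \<open>Points near the orbit and on chords\<close>

text \<open>On the ball of radius \<open>r\<close> the time coordinate of \<open>g\<close> lies
  between \<open>(1 - r) * boost g\<close> and \<open>2 * boost g\<close>, and
  \<open>mink_form_hyp_act\<close> expresses inner products of image points through time
  coordinates. So \<open>1 - |g y|^2\<close> is comparable to \<open>1 / boost^2\<close>, and
  \<open>g y\<close> lies within order \<open>1 / boost\<close> of the orbit point.\<close>

lemma near_orbit_point:
  assumes g: "g \<in> carrier SO0_mink" and y: "norm y \<le> r" and r: "r < 1"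
  shows "(1 - r)\<^sup>2 / 4 \<le> (boost g)\<^sup>2 * (1 - hyp_act g y \<bullet> hyp_act g y)"
    "(boost g)\<^sup>2 * (1 - hyp_act g y \<bullet> hyp_act g y) \<le> 4 / (1 - r)\<^sup>2"
    "boost g * dist (hyp_act g y) (hyp_act g 0) \<le> 4 / (1 - r)\<^sup>2"
proof -
  define a where "a = boost g"
  define b where "b = (g *v lift_mink y) $ None"
  have a: "0 < a" using boost_pos[OF g] by (simp add: a_def)
  have r0: "0 \<le> r" using y norm_ge_zero[of y] by linarith
  have b: "a * (1 - r) \<le> b" "b \<le> 2 * a"
    using time_coordinate_bounds[OF g y] r by (auto simp: a_def b_def)
  have ar: "0 < a * (1 - r)" using a r by simp
  then have b0: "0 < b" using b by linarith
  have yc: "y \<in> cball 0 1" using y r by simp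
  have q: "1 - hyp_act g y \<bullet> hyp_act g y = (1 - y \<bullet> y) / (b * b)"
    using mink_form_hyp_act[OF g yc yc] by (simp add: b_def)
  have pq: "1 - hyp_act g 0 \<bullet> hyp_act g y = 1 / (a * b)"
    using mink_form_hyp_act[OF g _ yc, of 0] by (simp add: b_def a_def matrix_lift_mink_0)
  have "y \<bullet> y \<le> r\<^sup>2" using y by (simp add: power2_norm_eq_inner[symmetric] power_mono)
  moreover have "r\<^sup>2 \<le> r" using r r0 by (simp add: power2_eq_square mult_left_le)
  ultimately have yy: "1 - r \<le> 1 - y \<bullet> y" "1 - y \<bullet> y \<le> 1" by (auto simp del: inner_commute)
  have r1: "(1 - r)\<^sup>2 \<le> 1 - r" using r r0 by (simp add: power2_eq_square mult_left_le)
  have "(1 - r)\<^sup>2 * b\<^sup>2 \<le> (1 - y \<bullet> y) * (2 * a)\<^sup>2"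
    using r1 yy b b0 r by (intro mult_mono power_mono) auto
  then have "(1 - r)\<^sup>2 / 4 \<le> a\<^sup>2 * ((1 - y \<bullet> y) / (b * b))"
    using b0 by (simp add: field_simps power2_eq_square)
  then show "(1 - r)\<^sup>2 / 4 \<le> (boost g)\<^sup>2 * (1 - hyp_act g y \<bullet> hyp_act g y)"
    by (simp add: q a_def)
  have "a\<^sup>2 * (1 - r)\<^sup>2 \<le> b\<^sup>2" using power_mono[OF b(1), of 2] ar by (simp add: power_mult_distrib)
  then have "a\<^sup>2 / b\<^sup>2 \<le> 1 / (1 - r)\<^sup>2" using b0 r by (simp add: field_simps)
  moreover have "a\<^sup>2 * ((1 - y \<bullet> y) / b\<^sup>2) \<le> a\<^sup>2 * (1 / b\<^sup>2)"
    using yy by (intro mult_left_mono divide_right_mono) auto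
  moreover have "1 / (1 - r)\<^sup>2 \<le> 4 / (1 - r)\<^sup>2" by (intro divide_right_mono) auto
  ultimately show "(boost g)\<^sup>2 * (1 - hyp_act g y \<bullet> hyp_act g y) \<le> 4 / (1 - r)\<^sup>2"
    unfolding q a_def power2_eq_square by simp
  define d where "d = dist (hyp_act g y) (hyp_act g 0)"
  have q0: "0 \<le> 1 - hyp_act g y \<bullet> hyp_act g y" unfolding q using yy r b0 by simp
  have "d\<^sup>2 = 2 * (1 - hyp_act g 0 \<bullet> hyp_act g y) - (1 - hyp_act g y \<bullet> hyp_act g y) - 1 / a\<^sup>2"
    using hyp_act_0_inner[OF g]
    by (simp add: d_def a_def dist_norm power2_norm_eq_inner inner_diff_left inner_diff_right inner_commute)
  also have "\<dots> \<le> 2 * (1 - hyp_act g 0 \<bullet> hyp_act g y)"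
    using q0 zero_le_divide_1_iff[of "a\<^sup>2"] zero_le_power2[of a] by linarith
  also have "\<dots> = 2 / (a * b)" by (simp add: pq)
  finally have "a\<^sup>2 * d\<^sup>2 \<le> a\<^sup>2 * (2 / (a * b))" by (intro mult_left_mono) auto
  also have "\<dots> = 2 * (a / b)" using a by (simp add: power2_eq_square)
  also have "\<dots> \<le> 2 * (1 / (1 - r))" using b b0 r by (simp add: field_simps)
  also have "\<dots> \<le> (4 / (1 - r)\<^sup>2)\<^sup>2"
  proof -
    define t where "t = 1 / (1 - r)"
    have t: "1 \<le> t" using r r0 by (simp add: t_def field_simps)
    have "t ^ 1 \<le> t ^ 4" using t by (intro power_increasing) auto
    then have "2 * t \<le> 16 * t ^ 4" using t by simp
    also have "\<dots> = (4 * t\<^sup>2)\<^sup>2" by (simp add: power_mult_distrib flip: power_mult)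
    finally show ?thesis by (simp add: t_def power_divide)
  qed
  finally have "(a * d)\<^sup>2 \<le> (4 / (1 - r)\<^sup>2)\<^sup>2" by (simp add: power_mult_distrib)
  then show "boost g * dist (hyp_act g y) (hyp_act g 0) \<le> 4 / (1 - r)\<^sup>2"
    unfolding a_def d_def by (rule power2_le_imp_le) simp
qed

text \<open>Along the chord, \<open>1 - |x|^2\<close> is \<open>u\<close> times a bracket that is
  bounded above and away from 0 uniformly in the endpoint \<open>\<xi>\<close>.\<close>

lemma segment_to_sphere_bounds:
  fixes z \<xi> :: "real ^ 'n::finite"
  assumes z: "norm z < 1" and \<xi>: "norm \<xi> = 1" and u: "0 \<le> u" "u \<le> 1"
  defines "x \<equiv> u *\<^sub>R z + (1 - u) *\<^sub>R \<xi>"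
  shows "(1 - norm z) * u \<le> 1 - x \<bullet> x" "1 - x \<bullet> x \<le> 4 * u"
proof -
  define \<rho> where "\<rho> = norm z"
  have \<rho>: "0 \<le> \<rho>" "\<rho> < 1" "z \<bullet> z = \<rho>\<^sup>2" using z by (auto simp: \<rho>_def power2_norm_eq_inner)
  have zx: "\<bar>z \<bullet> \<xi>\<bar> \<le> \<rho>" using Cauchy_Schwarz_ineq2[of z \<xi>] \<xi> by (simp add: \<rho>_def)
  have xx: "\<xi> \<bullet> \<xi> = 1" using \<xi> by (simp add: norm_eq_1)
  have eq: "1 - x \<bullet> x = u * ((2 - u) - u * \<rho>\<^sup>2 - 2 * (1 - u) * (z \<bullet> \<xi>))"
    unfolding x_def by (simp add: inner_add_left inner_add_right inner_commute xx \<rho>(3) algebra_simps power2_eq_square)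
  have "(1 - u) * (z \<bullet> \<xi>) \<le> (1 - u) * \<rho>" using zx u by (intro mult_left_mono) auto
  then have "2 * (1 - \<rho>) - u * (1 - \<rho>)\<^sup>2 \<le> (2 - u) - u * \<rho>\<^sup>2 - 2 * (1 - u) * (z \<bullet> \<xi>)"
    by (simp add: power2_eq_square algebra_simps)
  moreover have "u * (1 - \<rho>)\<^sup>2 \<le> 1 * (1 - \<rho>)"
    using u \<rho> by (intro mult_mono) (auto simp: power2_eq_square mult_left_le)
  ultimately have "1 - \<rho> \<le> (2 - u) - u * \<rho>\<^sup>2 - 2 * (1 - u) * (z \<bullet> \<xi>)" using \<rho> by simp
  then have "u * (1 - \<rho>) \<le> 1 - x \<bullet> x" unfolding eq using u by (intro mult_left_mono)
  then show "(1 - norm z) * u \<le> 1 - x \<bullet> x" by (simp add: \<rho>_def mult.commute)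
  have "(1 - u) * - (z \<bullet> \<xi>) \<le> (1 - u) * 1" using zx u \<rho> by (intro mult_left_mono) auto
  then have "- (2 * (1 - u) * (z \<bullet> \<xi>)) \<le> 2" using u by (simp add: algebra_simps)
  moreover have "0 \<le> u * \<rho>\<^sup>2" using u by simp
  ultimately have "(2 - u) - u * \<rho>\<^sup>2 - 2 * (1 - u) * (z \<bullet> \<xi>) \<le> 4" using u by linarith
  then have "1 - x \<bullet> x \<le> u * 4" unfolding eq using u by (intro mult_left_mono)
  then show "1 - x \<bullet> x \<le> 4 * u" by simp
qed

section \<open>Discreteness and cocompactness\<close>

lemma continuous_on_hyp_act:
  fixes A :: "real ^ ('n::finite) option ^ 'n option"
  assumes "A \<in> carrier SO0_mink"
  shows "continuous_on (cball 0 1) (hyp_act A)"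
  unfolding hyp_act_def matrix_lift_mink
proof (intro continuous_intros)
  show "\<forall>x\<in>cball 0 1. A $ None $ None + (\<chi> i. A $ None $ Some i) \<bullet> x \<noteq> 0"
    using SO0_mink_time_pos[OF assms] by (metis matrix_lift_mink order_less_irrefl)
qed

lemma borel_measurable_hyp_act: "hyp_act A \<in> borel_measurable borel"
proof (subst borel_measurable_euclidean_space, intro ballI)
  fix e :: "real ^ 'a" assume "e \<in> Basis"
  then obtain i where i: "e = axis i 1" by (auto simp: Basis_vec_def)
  show "(\<lambda>x. hyp_act A x \<bullet> e) \<in> borel_measurable borel"
    unfolding i inner_axis hyp_act_def vec_lambda_beta inner_real_def mult_1_right matrix_lift_mink
    by measurable
qed

lemma SO0_mink_simps:
  "mult SO0_mink A B = A ** B" "one SO0_mink = mat 1"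
  by (simp_all add: SO0_mink_def)

lemma hyp_act_inv:
  assumes "A \<in> carrier SO0_mink" "x \<in> cball 0 1"
  shows "hyp_act (inv\<^bsub>SO0_mink\<^esub> A) (hyp_act A x) = x" "hyp_act A (hyp_act (inv\<^bsub>SO0_mink\<^esub> A) x) = x"
proof -
  interpret G: group "SO0_mink" by (rule group_SO0_mink)
  have 1: "hyp_act (mat 1) x = x" by (simp add: hyp_act_def vec_eq_iff lift_mink_def)
  show "hyp_act (inv\<^bsub>SO0_mink\<^esub> A) (hyp_act A x) = x"
    using hyp_act_mult[of "inv\<^bsub>SO0_mink\<^esub> A" A x] G.l_inv[of A] assms 1
    by (simp add: SO0_mink_simps)
  show "hyp_act A (hyp_act (inv\<^bsub>SO0_mink\<^esub> A) x) = x"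
    using hyp_act_mult[of A "inv\<^bsub>SO0_mink\<^esub> A" x] G.r_inv[of A] assms 1
    by (simp add: SO0_mink_simps)
qed

text \<open>The inverse is the adjoint for the form: transpose, then conjugate by the diagonal
  matrix of signs \<open>\<epsilon>\<close>. Hence inverses converge entrywise along a sequence
  whose limit is not yet known to lie in the group.\<close>

lemma SO_mink_inverse_entries:
  fixes A B :: "real ^ ('n::finite) option ^ 'n option"
  assumes A: "A \<in> SO_mink" and AB: "A ** B = mat 1"
  defines "\<epsilon> \<equiv> \<lambda>i :: 'n option. case i of None \<Rightarrow> 1 | Some _ \<Rightarrow> - 1"
  shows "B $ i $ j = \<epsilon> i * \<epsilon> j * A $ j $ i"
proof -
  have form: "mink_form u (axis i 1) = \<epsilon> i * u $ i" for u :: "real ^ 'n option" and i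
    by (cases i) (simp_all add: mink_form_def \<epsilon>_def axis_def if_distrib if_distribR cong: if_cong)
  have form': "mink_form (axis i 1) u = \<epsilon> i * u $ i" for u :: "real ^ 'n option" and i
    by (cases i) (simp_all add: mink_form_def \<epsilon>_def axis_def if_distrib if_distribR cong: if_cong)
  have col: "(M *v axis j 1) $ i = M $ i $ j" for M :: "real ^ 'n option ^ 'n option" and i j
    by (simp add: matrix_vector_mult_def axis_def if_distrib if_distribR cong: if_cong)
  have "mink_form (axis i 1) (B *v axis j 1) = mink_form (A *v axis i 1) (A *v (B *v axis j 1))"
    using A by (simp add: SO_mink_def)
  also have "A *v (B *v axis j 1) = axis j 1" by (simp add: matrix_vector_mul_assoc AB)
  finally have "\<epsilon> i * B $ i $ j = \<epsilon> j * A $ j $ i" by (simp add: form form' col)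
  moreover have "\<epsilon> i * \<epsilon> i = 1" by (cases i) (simp_all add: \<epsilon>_def)
  ultimately show ?thesis by (metis mult.assoc mult_1)
qed

text \<open>For a convergent sequence \<open>g k\<close> in \<Gamma>, the inverse of
  \<open>g k\<close> times \<open>g (k + 1)\<close> tends to the identity. By discreteness it equals
  the identity eventually, so the sequence is eventually constant.\<close>

lemma discrete_subgroup_closed:
  fixes \<Gamma> :: "(real ^ ('n::finite) option ^ 'n option) set"
  assumes sub: "subgroup \<Gamma> SO0_mink" and disc: "topological_space_class.discrete \<Gamma>"
  shows "closed \<Gamma>"
  unfolding closed_sequential_limits
proof (intro allI impI, elim conjE)
  fix g :: "nat \<Rightarrow> real ^ 'n option ^ 'n option" and A
  assume g: "\<forall>k. g k \<in> \<Gamma>" and lim: "g \<longlonglongrightarrow> A"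
  interpret G: group "SO0_mink :: (real ^ 'n option ^ 'n option) monoid" by (rule group_SO0_mink)
  define h where "h k = inv\<^bsub>SO0_mink\<^esub> (g k)" for k
  have gG: "g k \<in> carrier SO0_mink" for k using g sub subgroup.subset by blast
  have h: "h k \<in> \<Gamma>" for k using g sub by (simp add: h_def subgroup.m_inv_closed)
  have gh: "g k ** h k = mat 1" "h k ** g k = mat 1" for k
    using G.r_inv[OF gG[of k]] G.l_inv[OF gG[of k]] by (simp_all add: h_def SO0_mink_simps)
  define \<epsilon> :: "'n option \<Rightarrow> real" where "\<epsilon> = (\<lambda>i. case i of None \<Rightarrow> 1 | Some _ \<Rightarrow> - 1)"
  have hij: "h k $ i $ j = \<epsilon> i * \<epsilon> j * g k $ j $ i" for k i j
    unfolding \<epsilon>_def using gG SO0_mink_subset by (intro SO_mink_inverse_entries gh) blast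
  define B where "B = (\<chi> i j. \<epsilon> i * \<epsilon> j * A $ j $ i)"
  have gij: "(\<lambda>k. g k $ i $ j) \<longlonglongrightarrow> A $ i $ j" for i j by (intro tendsto_vec_nth lim)
  have gijm: "(\<lambda>k. g (k + m) $ i $ j) \<longlonglongrightarrow> A $ i $ j" for i j m
    by (rule LIMSEQ_ignore_initial_segment[OF gij])
  have mulij: "(\<lambda>k. (h k ** g (k + m)) $ i $ j) \<longlonglongrightarrow> (B ** A) $ i $ j" for i j m
    unfolding matrix_matrix_mult_def vec_lambda_beta hij B_def
    by (intro tendsto_sum tendsto_mult tendsto_const gij gijm)
  have mul: "(\<lambda>k. h k ** g (k + m)) \<longlonglongrightarrow> B ** A" for m
    by (intro vec_tendstoI mulij)
  \<comment> \<open>For \<open>m = 0\<close> the products are constantly the identity, which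
    identifies their limit for every \<open>m\<close>.\<close>
  have BA: "B ** A = mat 1"
    using LIMSEQ_unique[OF mul[of 0], of "mat 1"] by (simp add: gh)
  have one: "mat 1 \<in> \<Gamma>" using sub subgroup.one_closed by (fastforce simp: SO0_mink_simps)
  then obtain T where T: "open T" "T \<inter> \<Gamma> = {mat 1}"
    using disc discreteD isolated_inE by metis
  have "\<forall>\<^sub>F k in sequentially. h k ** g (k + 1) \<in> T"
    using mul[of 1] T(1) BA T(2) by (intro topological_tendstoD[OF mul]) auto
  moreover have "h k ** g (k + 1) \<in> \<Gamma>" for k
    using subgroup.m_closed[OF sub h, of "g (k + 1)" k] g by (simp add: SO0_mink_simps)
  ultimately have "\<forall>\<^sub>F k in sequentially. h k ** g (k + 1) = mat 1"
    using T(2) by (auto elim!: eventually_mono)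
  then obtain N where N: "\<And>k. N \<le> k \<Longrightarrow> h k ** g (k + 1) = mat 1"
    by (auto simp: eventually_sequentially)
  have step: "g (k + 1) = g k" if "N \<le> k" for k
  proof -
    have "g k ** (h k ** g (k + 1)) = g k" by (subst N[OF that]) simp
    then show ?thesis by (simp add: matrix_mul_assoc gh)
  qed
  have "g (N + m) = g N" for m by (induction m) (use step in auto)
  then have "(\<lambda>m. g (m + N)) = (\<lambda>m. g N)" by (simp add: add.commute)
  then have "(\<lambda>m. g N) \<longlonglongrightarrow> A" using LIMSEQ_ignore_initial_segment[OF lim, of N] by simp
  then have "A = g N" by (simp add: LIMSEQ_const_iff)
  then show "A \<in> \<Gamma>" using g by simp
qed

lemma closed_discrete_countable:
  fixes S :: "'a::euclidean_space set"
  assumes "closed S" "topological_space_class.discrete S"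
  shows "countable S"
proof -
  have "finite (cball 0 (real n) \<inter> S)" for n
    using discrete_subset[OF assms(2), of "cball 0 (real n) \<inter> S"] assms(1)
    by (subst discrete_compact_finite_iff[symmetric]) auto
  moreover have "S = (\<Union>n. cball 0 (real n) \<inter> S)" by (auto intro: real_arch_simple)
  ultimately show ?thesis by (metis countable_UN countable_finite countableI_type)
qed

lemma closed_limit_set: "closed (limit_set \<Gamma>)"
proof -
  have "limit_set \<Gamma> = sphere 0 1 \<inter> {x. x islimpt (\<lambda>\<gamma>. hyp_act \<gamma> 0) ` \<Gamma>}"
    by (auto simp: limit_set_def)
  then show ?thesis by (simp add: closed_Int closed_limpts)
qed

lemma limit_set_subset: "limit_set \<Gamma> \<subseteq> sphere 0 1"
  by (auto simp: limit_set_def)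

section \<open>Cocompactness and shadowing of limit points\<close>

text \<open>The orbits that meet the ball of radius \<open>1 - 1 / (n + 1)\<close> form an open set
  in the quotient. These sets increase with \<open>n\<close> and cover it, so by compactness a
  single \<open>n\<close> suffices.\<close>

lemma cocompact_bounded_orbits:
  fixes \<Gamma> :: "(real ^ ('n::finite) option ^ 'n option) set"
  assumes sub: "subgroup \<Gamma> SO0_mink"
    and Q: "quotient_map (top_of_set H) Q (\<lambda>x. (\<lambda>\<gamma>. hyp_act \<gamma> x) ` \<Gamma>)" "compact_space Q"
    and H: "H \<subseteq> ball 0 1"
  obtains r where "0 \<le> r" "r < 1" "\<And>x. x \<in> H \<Longrightarrow> \<exists>\<gamma>\<in>\<Gamma>. norm (hyp_act \<gamma> x) < r"
proof -
  define orb where "orb x = (\<lambda>\<gamma>. hyp_act \<gamma> x) ` \<Gamma>" for x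
  define V where "V n = {orb x |x. x \<in> H \<and> (\<exists>\<gamma>\<in>\<Gamma>. norm (hyp_act \<gamma> x) < 1 - 1 / real (Suc n))}" for n
  have \<Gamma>: "\<gamma> \<in> carrier SO0_mink" if "\<gamma> \<in> \<Gamma>" for \<gamma> using that sub subgroup.subset by blast
  have top: "orb ` H = topspace Q" using Q(1) by (simp add: quotient_map_def orb_def)
  have V_sub: "V n \<subseteq> topspace Q" for n unfolding top[symmetric] V_def by auto
  \<comment> \<open>Points with equal orbits share every orbit point, in particular one of small
    norm. So the preimage is a union of sets given by single elements of \<Gamma>, each of them
    open.\<close>
  have pre: "{x \<in> H. orb x \<in> V n} = H \<inter> (\<Union>\<gamma>\<in>\<Gamma>. {x \<in> H. norm (hyp_act \<gamma> x) < 1 - 1 / real (Suc n)})" for n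
  proof safe
    fix x assume x: "x \<in> H" and "orb x \<in> V n"
    then obtain x' \<gamma> where x': "orb x = orb x'" "\<gamma> \<in> \<Gamma>" "norm (hyp_act \<gamma> x') < 1 - 1 / real (Suc n)"
      by (auto simp: V_def)
    then have "hyp_act \<gamma> x' \<in> orb x" by (auto simp: orb_def)
    then obtain \<gamma>' where "\<gamma>' \<in> \<Gamma>" "hyp_act \<gamma> x' = hyp_act \<gamma>' x" by (auto simp: orb_def)
    then show "x \<in> (\<Union>\<gamma>\<in>\<Gamma>. {x \<in> H. norm (hyp_act \<gamma> x) < 1 - 1 / real (Suc n)})" using x x' by auto
  qed (auto simp: V_def)
  have op: "openin (top_of_set H) {x \<in> H. norm (hyp_act \<gamma> x) < 1 - 1 / real (Suc n)}" if "\<gamma> \<in> \<Gamma>" for \<gamma> n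
  proof -
    have "continuous_on H (\<lambda>x. norm (hyp_act \<gamma> x))"
      using H by (intro continuous_on_norm continuous_on_subset[OF continuous_on_hyp_act[OF \<Gamma>[OF that]]]) auto
    then have "openin (top_of_set H) (H \<inter> (\<lambda>x. norm (hyp_act \<gamma> x)) -` {..<1 - 1 / real (Suc n)})"
      by (rule continuous_openin_preimage_gen) simp
    also have "H \<inter> (\<lambda>x. norm (hyp_act \<gamma> x)) -` {..<1 - 1 / real (Suc n)} = {x \<in> H. norm (hyp_act \<gamma> x) < 1 - 1 / real (Suc n)}"
      by auto
    finally show ?thesis .
  qed
  have "openin (top_of_set H) {x \<in> H. orb x \<in> V n}" for n
  proof -
    have "{x \<in> H. orb x \<in> V n} = (\<Union>\<gamma>\<in>\<Gamma>. {x \<in> H. norm (hyp_act \<gamma> x) < 1 - 1 / real (Suc n)})"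
      unfolding pre by auto
    then show ?thesis using op by auto
  qed
  have V_open: "openin Q (V n)" for n
  proof -
    have "\<forall>U\<subseteq>topspace Q. openin (top_of_set H) {x \<in> H. orb x \<in> U} = openin Q U"
      using Q(1) by (simp add: quotient_map_def orb_def)
    then show ?thesis using \<open>\<And>n. openin (top_of_set H) {x \<in> H. orb x \<in> V n}\<close> V_sub[of n] by blast
  qed
  have cover: "topspace Q \<subseteq> \<Union> (range V)"
  proof
    fix q assume "q \<in> topspace Q"
    then obtain x where x: "x \<in> H" "q = orb x" using top by auto
    have one: "mat 1 \<in> \<Gamma>" using sub subgroup.one_closed by (fastforce simp: SO0_mink_simps)
    have "norm (hyp_act (mat 1) x) < 1" using H x hyp_act_ball[OF \<Gamma>[OF one], of x] by auto
    then obtain n where "1 / real (Suc n) < 1 - norm (hyp_act (mat 1) x)"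
      using reals_Archimedean[of "1 - norm (hyp_act (mat 1) x)"] by (auto simp: inverse_eq_divide)
    then have "norm (hyp_act (mat 1) x) < 1 - 1 / real (Suc n)" by simp
    then have "q \<in> V n" unfolding V_def using x one by auto
    then show "q \<in> \<Union> (range V)" by blast
  qed
  obtain F where F: "finite F" "F \<subseteq> range V" "topspace Q \<subseteq> \<Union> F"
    using Q(2) V_open cover unfolding compact_space_alt by (metis (no_types, lifting) image_iff)
  then obtain N where N: "finite N" "F = V ` N" by (meson finite_subset_image)
  define n where "n = Max (insert 0 N)"
  define r where "r = 1 - 1 / real (Suc n)"
  have "\<exists>\<gamma>\<in>\<Gamma>. norm (hyp_act \<gamma> x) < r" if "x \<in> H" for x
  proof -
    have "orb x \<in> topspace Q" using top that by auto
    then obtain m where m: "m \<in> N" "orb x \<in> V m" using F N by auto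
    then have "m \<le> n" using N by (simp add: n_def)
    then have "1 / real (Suc n) \<le> 1 / real (Suc m)" by (intro frac_le) auto
    then have mr: "1 - 1 / real (Suc m) \<le> r" unfolding r_def by linarith
    have "x \<in> {x \<in> H. orb x \<in> V m}" using m that by simp
    then obtain \<gamma> where "\<gamma> \<in> \<Gamma>" "norm (hyp_act \<gamma> x) < 1 - 1 / real (Suc m)"
      unfolding pre by auto
    then show ?thesis using mr by (meson less_le_trans)
  qed
  moreover have "0 \<le> r" "r < 1" by (simp_all add: r_def)
  ultimately show thesis using that by blast
qed

text \<open>A hull point on the chord from a fixed \<open>z\<close> to \<open>\<xi>\<close> can be
  moved into a fixed ball by an element of \<Gamma>; the inverse then carries the origin close to
  that point. Two distinct limit points provide a hull point \<open>z\<close> inside the open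
  ball.\<close>

lemma limit_set_shadowing:
  fixes \<Gamma> :: "(real ^ ('n::finite) option ^ 'n option) set"
  assumes cc: "convex_cocompact \<Gamma>"
    and two: "\<xi>\<^sub>1 \<in> limit_set \<Gamma>" "\<xi>\<^sub>2 \<in> limit_set \<Gamma>" "\<xi>\<^sub>1 \<noteq> \<xi>\<^sub>2"
  obtains C where "1 \<le> C" "\<And>\<xi> k. \<xi> \<in> limit_set \<Gamma> \<Longrightarrow>
    \<exists>\<gamma>\<in>\<Gamma>. 2 ^ k / C \<le> boost \<gamma> \<and> boost \<gamma> \<le> C * 2 ^ k \<and> dist (hyp_act \<gamma> 0) \<xi> \<le> C / 2 ^ k"
proof -
  define H where "H = convex hull (limit_set \<Gamma>) \<inter> ball 0 1"
  have sub: "subgroup \<Gamma> SO0_mink" using cc by (simp add: convex_cocompact_def)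
  have \<Gamma>: "\<gamma> \<in> carrier SO0_mink" if "\<gamma> \<in> \<Gamma>" for \<gamma> using that sub subgroup.subset by blast
  obtain Q where Q: "quotient_map (top_of_set H) Q (\<lambda>x. (\<lambda>\<gamma>. hyp_act \<gamma> x) ` \<Gamma>)" "compact_space Q"
    using cc by (auto simp: convex_cocompact_def H_def)
  obtain r where r: "0 \<le> r" "r < 1" "\<And>x. x \<in> H \<Longrightarrow> \<exists>\<gamma>\<in>\<Gamma>. norm (hyp_act \<gamma> x) < r"
    by (rule cocompact_bounded_orbits[OF sub Q]) (auto simp: H_def)
  define K where "K = 4 / (1 - r)\<^sup>2"
  have K: "4 \<le> K"
  proof -
    have "(1 - r)\<^sup>2 \<le> 1" using r by (intro power_le_one) auto
    then show ?thesis using r by (simp add: K_def field_simps)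
  qed
  \<comment> \<open>By the parallelogram law the midpoint of two distinct unit vectors has norm less
    than 1.\<close>
  define z where "z = midpoint \<xi>\<^sub>1 \<xi>\<^sub>2"
  have n1: "norm \<xi>\<^sub>1 = 1" "norm \<xi>\<^sub>2 = 1" using two limit_set_subset[of \<Gamma>] by auto
  have zn: "norm z < 1"
  proof -
    define A where "A = (norm (\<xi>\<^sub>1 + \<xi>\<^sub>2))\<^sup>2"
    define B where "B = (norm (\<xi>\<^sub>1 - \<xi>\<^sub>2))\<^sup>2"
    have "A + B = 2 * (norm \<xi>\<^sub>1)\<^sup>2 + 2 * (norm \<xi>\<^sub>2)\<^sup>2"
      unfolding A_def B_def power2_norm_eq_inner
      by (simp add: inner_add_left inner_add_right inner_diff_left inner_diff_right)
    then have "A + B = 4" by (simp add: n1)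
    moreover have "0 < B" using two by (simp add: B_def)
    ultimately have "A < 2\<^sup>2" by simp
    then have "(norm (\<xi>\<^sub>1 + \<xi>\<^sub>2))\<^sup>2 < 2\<^sup>2" by (simp only: A_def)
    then have "norm (\<xi>\<^sub>1 + \<xi>\<^sub>2) < 2" by (rule power2_less_imp_less) simp
    moreover have "norm z = norm (\<xi>\<^sub>1 + \<xi>\<^sub>2) / 2" by (simp add: z_def midpoint_def del: scaleR_add_right)
    ultimately show ?thesis by linarith
  qed
  have zh: "z \<in> convex hull (limit_set \<Gamma>)"
  proof -
    have "(1/2) *\<^sub>R \<xi>\<^sub>1 + (1/2) *\<^sub>R \<xi>\<^sub>2 \<in> convex hull (limit_set \<Gamma>)"
      by (rule convexD[OF convex_convex_hull]) (use two hull_inc in auto)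
    then show ?thesis by (simp add: z_def midpoint_def scaleR_add_right inverse_eq_divide)
  qed
  define C\<^sub>0 where "C\<^sub>0 = 4 * K / (1 - norm z)"
  have C0: "4 * K \<le> C\<^sub>0" "K / (1 - norm z) \<le> C\<^sub>0" "1 \<le> C\<^sub>0"
  proof -
    have "4 * K * (1 - norm z) \<le> 4 * K * 1" using K by (intro mult_left_mono) auto
    then show "4 * K \<le> C\<^sub>0" using zn by (simp add: C\<^sub>0_def field_simps)
    then show "1 \<le> C\<^sub>0" using K by simp
    show "K / (1 - norm z) \<le> C\<^sub>0" using K zn unfolding C\<^sub>0_def by (intro divide_right_mono) auto
  qed
  define C where "C = K * C\<^sub>0 + 2"
  have C: "C\<^sub>0 \<le> C" 
  proof -
    have "1 * C\<^sub>0 \<le> K * C\<^sub>0" using C0 K by (intro mult_right_mono) auto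
    then show ?thesis by (simp add: C_def)
  qed
  have "\<exists>\<gamma>\<in>\<Gamma>. 2 ^ k / C \<le> boost \<gamma> \<and> boost \<gamma> \<le> C * 2 ^ k \<and> dist (hyp_act \<gamma> 0) \<xi> \<le> C / 2 ^ k"
    if \<xi>: "\<xi> \<in> limit_set \<Gamma>" for \<xi> k
  proof -
    have n\<xi>: "norm \<xi> = 1" using \<xi> limit_set_subset[of \<Gamma>] by auto
    define t where "t = (2 :: real) ^ k"
    have t: "1 \<le> t" by (simp add: t_def)
    \<comment> \<open>Points with \<open>1 - x \<bullet> x\<close> of order \<open>u\<close> belong
      to elements with \<open>boost\<close> of order \<open>1 / sqrt u\<close>, so this
      \<open>u\<close> aims at \<open>boost\<close> of order \<open>t = 2 ^ k\<close>.\<close>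
    define u where "u = 1 / t\<^sup>2"
    have u: "0 < u" "u \<le> 1" using t by (simp_all add: u_def)
    define x where "x = u *\<^sub>R z + (1 - u) *\<^sub>R \<xi>"
    have xq: "(1 - norm z) * u \<le> 1 - x \<bullet> x" "1 - x \<bullet> x \<le> 4 * u"
      using segment_to_sphere_bounds[OF zn n\<xi>, of u] u by (auto simp: x_def)
    have "0 < (1 - norm z) * u" using zn u by simp
    then have "x \<bullet> x < 1" using xq by linarith
    then have xb: "x \<in> ball 0 1" by (simp add: norm_eq_sqrt_inner)
    have "x \<in> convex hull (limit_set \<Gamma>)"
      unfolding x_def using zh hull_inc[OF \<xi>] u by (intro convexD convex_convex_hull) auto
    then have "x \<in> H" using xb by (simp add: H_def)
    then obtain \<gamma> where \<gamma>: "\<gamma> \<in> \<Gamma>" "norm (hyp_act \<gamma> x) < r" using r(3) by blast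
    define g where "g = inv\<^bsub>SO0_mink\<^esub> \<gamma>"
    have g: "g \<in> \<Gamma>" using sub \<gamma> by (simp add: g_def subgroup.m_inv_closed)
    have gx: "hyp_act g (hyp_act \<gamma> x) = x" using hyp_act_inv(1)[OF \<Gamma>[OF \<gamma>(1)], of x] xb by (simp add: g_def)
    define a where "a = boost g"
    have a: "1 \<le> a" using boost_ge_1[OF \<Gamma>[OF g]] by (simp add: a_def)
    note near = near_orbit_point[OF \<Gamma>[OF g] less_imp_le[OF \<gamma>(2)] r(2), unfolded gx, folded a_def K_def]
    have "1 / K \<le> a\<^sup>2 * (1 - x \<bullet> x)" using near(1) by (simp add: K_def)
    also have "\<dots> \<le> a\<^sup>2 * (4 * u)" using xq by (intro mult_left_mono) auto
    finally have "t\<^sup>2 \<le> 4 * K * a\<^sup>2" using K t by (simp add: u_def field_simps)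
    also have "\<dots> \<le> C\<^sub>0\<^sup>2 * a\<^sup>2"
      using C0 mult_mono[of 1 C\<^sub>0 "4 * K" C\<^sub>0] K by (intro mult_right_mono) (auto simp: power2_eq_square)
    finally have "t\<^sup>2 \<le> (C\<^sub>0 * a)\<^sup>2" by (simp add: power_mult_distrib)
    then have ta: "t \<le> C\<^sub>0 * a" using C0 a by (rule_tac power2_le_imp_le) auto
    have "a\<^sup>2 * ((1 - norm z) * u) \<le> a\<^sup>2 * (1 - x \<bullet> x)" using xq by (intro mult_left_mono) auto
    also have "\<dots> \<le> K" by (rule near(2))
    finally have "a\<^sup>2 \<le> K / (1 - norm z) * t\<^sup>2" using zn t by (simp add: u_def field_simps)
    also have "\<dots> \<le> C\<^sub>0\<^sup>2 * t\<^sup>2"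
      using C0 mult_mono[of 1 C\<^sub>0 "K / (1 - norm z)" C\<^sub>0] K zn by (intro mult_right_mono) (auto simp: power2_eq_square)
    finally have "a\<^sup>2 \<le> (C\<^sub>0 * t)\<^sup>2" by (simp add: power_mult_distrib)
    then have at: "a \<le> C\<^sub>0 * t" using C0 t by (rule_tac power2_le_imp_le) auto
    have "x - \<xi> = u *\<^sub>R (z - \<xi>)" by (simp add: x_def algebra_simps)
    then have "dist x \<xi> = u * norm (z - \<xi>)" using u by (simp add: dist_norm)
    also have "\<dots> \<le> u * 2" using norm_triangle_ineq4[of z \<xi>] zn n\<xi> u by (intro mult_left_mono) auto
    also have "\<dots> \<le> 2 / t" using t by (simp add: u_def field_simps power2_eq_square)
    finally have d1: "dist x \<xi> \<le> 2 / t" .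
    have "dist x (hyp_act g 0) \<le> K / a" using near(3) a by (simp add: field_simps)
    also have "\<dots> \<le> K * C\<^sub>0 / t" using ta K a t by (simp add: field_simps mult_left_mono)
    finally have "dist (hyp_act g 0) \<xi> \<le> K * C\<^sub>0 / t + 2 / t"
      using d1 dist_triangle[of "hyp_act g 0" \<xi> x] by (simp add: dist_commute)
    then have d: "dist (hyp_act g 0) \<xi> \<le> C / t" by (simp add: C_def add_divide_distrib)
    have "C\<^sub>0 * a \<le> C * a" "C\<^sub>0 * t \<le> C * t" using C a t by (auto intro: mult_right_mono)
    then have "t \<le> C * a" "a \<le> C * t" using ta at by linarith+
    then have "t / C \<le> a" "a \<le> C * t" using C C0 by (simp_all add: field_simps)
    then show ?thesis using d g by (auto simp: a_def t_def)
  qed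
  moreover have "1 \<le> C" using C C0 by linarith
  ultimately show thesis using that by blast
qed

text \<open>Takes the first element, in an enumeration of \<open>I\<close>, that satisfies the
  condition; closedness makes each condition measurable, and with it the least index.\<close>

lemma countable_measurable_selection:
  fixes P :: "'i \<Rightarrow> 'a::topological_space \<Rightarrow> bool"
  assumes "countable I" and ex: "\<And>x. x \<in> X \<Longrightarrow> \<exists>i\<in>I. P i x"
    and "\<And>i. i \<in> I \<Longrightarrow> closed {x. P i x}"
  obtains \<sigma> where "\<sigma> \<in> measurable (restrict_space borel X) (count_space I)"
    "\<And>x. x \<in> X \<Longrightarrow> P (\<sigma> x) x"
proof (cases "X = {}")
  case True
  then show thesis using that[of "\<lambda>_. undefined"] by (simp add: measurable_def space_restrict_space)
next
  case False
  then have ne: "I \<noteq> {}" using ex by blast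
  define \<sigma> where "\<sigma> x = from_nat_into I (LEAST n. P (from_nat_into I n) x)" for x
  have "Measurable.pred borel (P (from_nat_into I n))" for n
    using assms(3)[OF from_nat_into[OF ne]] unfolding pred_def by simp
  then have "Measurable.pred (restrict_space borel X) (P (from_nat_into I n))" for n
    by (rule measurable_restrict_space1)
  then have "(\<lambda>x. LEAST n. P (from_nat_into I n) x) \<in> measurable (restrict_space borel X) (count_space UNIV)"
    by (rule measurable_Least)
  then have "\<sigma> \<in> measurable (restrict_space borel X) (count_space I)"
    unfolding \<sigma>_def by (rule measurable_compose) (auto simp: from_nat_into[OF ne])
  moreover have "P (\<sigma> x) x" if "x \<in> X" for x
  proof -
    obtain i where "i \<in> I" "P i x" using ex[OF \<open>x \<in> X\<close>] by blast
    then have "P (from_nat_into I (to_nat_on I i)) x" using assms(1) by simp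
    then show ?thesis unfolding \<sigma>_def by (rule LeastI)
  qed
  ultimately show thesis using that by blast
qed

section \<open>Conformality of the weak limit\<close>

text \<open>Closed sets are an intersection-stable generator, and the indicator of a closed set is
  the pointwise limit of truncated linear functions of the distance to it.\<close>

lemma measure_eqI_continuous:
  fixes M N :: "'a::metric_space measure"
  assumes "finite_measure M" "finite_measure N" and sets: "sets M = sets borel" "sets N = sets borel"
    and eq: "\<And>F :: 'a \<Rightarrow> real. continuous_on UNIV F \<Longrightarrow> (\<And>x. 0 \<le> F x) \<Longrightarrow> (\<And>x. F x \<le> 1) \<Longrightarrow>
      integral\<^sup>L M F = integral\<^sup>L N F"
  shows "M = N"
proof -
  interpret M: finite_measure M by fact
  interpret N: finite_measure N by fact
  have closed_eq: "emeasure M C = emeasure N C" if C: "closed C" for C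
  proof (cases "C = {}")
    case False
    define F where "F n x = max 0 (1 - real n * infdist x C)" for n x
    have cont: "continuous_on UNIV (F n)" for n unfolding F_def by (intro continuous_intros)
    have bd: "0 \<le> F n x" "F n x \<le> 1" for n x by (simp_all add: F_def infdist_nonneg)
    have lim: "(\<lambda>n. F n x) \<longlonglongrightarrow> indicator C x" for x
    proof (cases "x \<in> C")
      case True
      then show ?thesis by (simp add: F_def)
    next
      case out: False
      then have pos: "0 < infdist x C"
        using in_closed_iff_infdist_zero[OF C False] infdist_nonneg[of x C] by (simp add: less_le)
      obtain m where m: "1 < real m * infdist x C"
        using reals_Archimedean3[OF pos] by blast
      have "F n x = 0" if "m \<le> n" for n
      proof -
        have "real m * infdist x C \<le> real n * infdist x C" using that pos by (intro mult_right_mono) auto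
        then show ?thesis using m by (simp add: F_def)
      qed
      then show ?thesis using out by (intro tendsto_eventually) (auto simp: eventually_sequentially intro!: exI[of _ m])
    qed
    have conv: "(\<lambda>n. integral\<^sup>L K (F n)) \<longlonglongrightarrow> measure K C" if "finite_measure K" "sets K = sets borel" for K
    proof -
      interpret K: finite_measure K by fact
      have meas: "F n \<in> borel_measurable K" for n
        using borel_measurable_continuous_onI[OF cont] that(2) by (simp cong: measurable_cong_sets)
      have "(\<lambda>n. integral\<^sup>L K (F n)) \<longlonglongrightarrow> integral\<^sup>L K (indicator C)"
      proof (rule integral_dominated_convergence[where w = "\<lambda>_. 1"])
        show "indicator C \<in> borel_measurable K" using C that(2) by (intro borel_measurable_indicator) simp
      qed (use meas lim bd in auto)
      moreover have "integral\<^sup>L K (indicator C) = measure K C"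
        using that(2) sets_eq_imp_space_eq[OF that(2)] by simp
      ultimately show ?thesis by simp
    qed
    have "measure M C = measure N C"
      using conv[OF assms(1,3)] conv[OF assms(2,4)] eq[OF cont bd] by (simp add: LIMSEQ_unique)
    then show ?thesis by (simp add: M.emeasure_eq_measure N.emeasure_eq_measure)
  qed simp
  show ?thesis
  proof (rule measure_eqI_generator_eq[where E = "Collect closed" and \<Omega> = UNIV and A = "\<lambda>_. UNIV"])
    show "Int_stable (Collect closed :: 'a set set)" by (auto simp: Int_stable_def)
    show "sets M = sigma_sets UNIV (Collect closed)" "sets N = sigma_sets UNIV (Collect closed)"
      unfolding sets borel_eq_closed by simp_all
  qed (use closed_eq in \<open>auto simp: M.emeasure_eq_measure\<close>)
qed

text \<open>The bound is uniform over \<open>|u| \<le> B\<close> and vanishes as \<open>s\<close>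
  tends to \<open>t\<close>; it serves to replace varying exponents by their limit.\<close>

lemma abs_exp_diff_le:
  fixes u :: real
  assumes "\<bar>u\<bar> \<le> B"
  shows "\<bar>exp (- s * u) - exp (- t * u)\<bar> \<le> exp (\<bar>t\<bar> * B) * (exp (\<bar>s - t\<bar> * B) - 1)"
proof -
  define v where "v = (t - s) * u"
  have v: "\<bar>v\<bar> \<le> \<bar>s - t\<bar> * B"
    using assms by (auto simp: v_def abs_mult abs_minus_commute intro!: mult_left_mono)
  have e: "\<bar>exp v - 1\<bar> \<le> exp \<bar>v\<bar> - 1"
  proof (cases "0 \<le> v")
    case False
    then have "\<bar>exp v - 1\<bar> = 1 - exp v" "\<bar>v\<bar> = - v" by auto
    then show ?thesis using exp_ge_add_one_self[of v] exp_ge_add_one_self[of "- v"] by linarith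
  qed simp
  also have "\<dots> \<le> exp (\<bar>s - t\<bar> * B) - 1" using v by simp
  finally have e: "\<bar>exp v - 1\<bar> \<le> exp (\<bar>s - t\<bar> * B) - 1" .
  have "- t * u \<le> \<bar>t\<bar> * B"
    using abs_ge_self[of "- t * u"] mult_left_mono[OF assms abs_ge_zero[of t]] by (simp add: abs_mult)
  then have t: "exp (- t * u) \<le> exp (\<bar>t\<bar> * B)" by simp
  have "exp (- s * u) - exp (- t * u) = exp (- t * u) * (exp v - 1)"
    by (simp add: v_def algebra_simps flip: exp_add)
  then have "\<bar>exp (- s * u) - exp (- t * u)\<bar> = exp (- t * u) * \<bar>exp v - 1\<bar>" by (simp add: abs_mult)
  also have "\<dots> \<le> exp (\<bar>t\<bar> * B) * (exp (\<bar>s - t\<bar> * B) - 1)" using t e by (intro mult_mono) auto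
  finally show ?thesis .
qed

text \<open>\<open>busemann_ratio A x\<close> is \<open>exp (d(A 0, x) - d(0, x))\<close> for \<open>x\<close> in the open ball, written in a form
  that extends continuously to the sphere.\<close>

definition busemann_ratio :: "real ^ ('n::finite) option ^ 'n option \<Rightarrow> real ^ 'n \<Rightarrow> real" where
  "busemann_ratio A x =
     (conf_factor A x + sqrt ((conf_factor A x)\<^sup>2 - (1 - x \<bullet> x))) / (1 + norm x)"

text \<open>The second claim is the reversed Cauchy-Schwarz inequality of the form; it makes the
  radicand in \<open>busemann_ratio\<close> nonnegative.\<close>

lemma conf_factor_ge_sqrt:
  assumes A: "A \<in> carrier SO0_mink" and x: "norm x \<le> 1"
  shows "0 < conf_factor A x" "1 - x \<bullet> x \<le> (conf_factor A x)\<^sup>2"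
proof -
  define p where "p = hyp_act A 0"
  define a where "a = boost A"
  have a: "0 < a" using boost_pos[OF A] by (simp add: a_def)
  have p: "norm p < 1" using hyp_act_ball[OF A, of 0] by (simp add: p_def)
  show "0 < conf_factor A x"
    using inner_less_one[OF p x] a by (simp add: conf_factor_def a_def p_def)
  have "0 \<le> 1 - norm p * norm x" using p x mult_mono[of "norm p" 1 "norm x" 1] by simp
  moreover have "1 - norm p * norm x \<le> 1 - p \<bullet> x" using norm_cauchy_schwarz[of p x] by simp
  ultimately have "(1 - norm p * norm x)\<^sup>2 \<le> (1 - p \<bullet> x)\<^sup>2" by (intro power_mono)
  moreover have "(1 - norm p * norm x)\<^sup>2 - (1 - (norm p)\<^sup>2) * (1 - (norm x)\<^sup>2) = (norm p - norm x)\<^sup>2"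
    by (simp add: power2_eq_square algebra_simps)
  ultimately have "(1 - (norm p)\<^sup>2) * (1 - (norm x)\<^sup>2) \<le> (1 - p \<bullet> x)\<^sup>2"
    using zero_le_power2[of "norm p - norm x"] by linarith
  moreover have "1 - (norm p)\<^sup>2 = 1 / a\<^sup>2"
    using hyp_act_0_inner[OF A] by (simp add: p_def a_def power2_norm_eq_inner)
  ultimately have "1 - (norm x)\<^sup>2 \<le> a\<^sup>2 * (1 - p \<bullet> x)\<^sup>2" using a by (simp add: field_simps)
  then show "1 - x \<bullet> x \<le> (conf_factor A x)\<^sup>2"
    by (simp add: conf_factor_def a_def p_def power_mult_distrib power2_norm_eq_inner)
qed

lemma busemann_ratio_pos:
  assumes "A \<in> carrier SO0_mink" "norm x \<le> 1" shows "0 < busemann_ratio A x"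
  unfolding busemann_ratio_def using conf_factor_ge_sqrt[OF assms]
  by (intro divide_pos_pos add_pos_nonneg) auto

lemma busemann_ratio_sphere:
  assumes "A \<in> carrier SO0_mink" "norm x = 1" shows "busemann_ratio A x = conf_factor A x"
proof -
  have "x \<bullet> x = 1" using assms(2) by (simp add: norm_eq_1)
  then show ?thesis
    unfolding busemann_ratio_def assms(2) using conf_factor_pos[OF assms] by simp
qed

lemma continuous_on_busemann_ratio: "continuous_on S (busemann_ratio A)"
proof -
  have "1 + norm x \<noteq> 0" for x :: "real ^ 'a" using norm_ge_zero[of x] by linarith
  then show ?thesis unfolding busemann_ratio_def conf_factor_def by (intro continuous_intros) auto
qed

text \<open>Both distances are \<open>arcosh (c / w)\<close> with the same
  \<open>w = sqrt (1 - x \<bullet> x)\<close>, and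
  \<open>exp (arcosh (c / w)) = (c + sqrt (c^2 - w^2)) / w\<close>. The common \<open>w\<close>,
  which vanishes at the boundary, cancels in the quotient.\<close>

lemma exp_hyp_dist_diff:
  assumes A: "A \<in> carrier SO0_mink" and x: "norm x < 1"
  shows "exp (hyp_dist (hyp_act A 0) x) = exp (hyp_dist 0 x) * busemann_ratio A x"
proof -
  define w where "w = sqrt (1 - x \<bullet> x)"
  have xx: "x \<bullet> x < 1" using inner_less_one[of x x] x by simp
  have w: "0 < w" "w\<^sup>2 = 1 - x \<bullet> x" using xx by (auto simp: w_def)
  have e: "exp (arcosh (c / w)) = (c + sqrt (c\<^sup>2 - w\<^sup>2)) / w" if "0 < c" "w\<^sup>2 \<le> c\<^sup>2" for c
  proof -
    have "w \<le> c" by (rule power2_le_imp_le[OF that(2)]) (use that in simp)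
    then have 1: "1 \<le> c / w" using w by simp
    have "(c / w)\<^sup>2 - 1 = (c\<^sup>2 - w\<^sup>2) / w\<^sup>2" using w(1) by (simp add: power_divide diff_divide_distrib)
    then have "sqrt ((c / w)\<^sup>2 - 1) = sqrt (c\<^sup>2 - w\<^sup>2) / w" using w(1) by (simp add: real_sqrt_divide)
    moreover have "0 < c / w + sqrt ((c / w)\<^sup>2 - 1)" using 1 by (intro add_pos_nonneg) auto
    ultimately show ?thesis using 1 by (simp add: arcosh_real_def add_divide_distrib)
  qed
  have "hyp_dist (hyp_act A 0) x = arcosh (conf_factor A x / w)"
    using boost_pos[OF A] hyp_act_0_inner[OF A]
    by (simp add: hyp_dist_alt conf_factor_def w_def real_sqrt_divide mult.commute)
  then have 1: "exp (hyp_dist (hyp_act A 0) x) = (conf_factor A x + sqrt ((conf_factor A x)\<^sup>2 - w\<^sup>2)) / w"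
    using e[of "conf_factor A x"] conf_factor_ge_sqrt[OF A, of x] x w by simp
  have "hyp_dist 0 x = arcosh (1 / w)" by (simp add: hyp_dist_alt w_def)
  then have 2: "exp (hyp_dist 0 x) = (1 + norm x) / w"
    using e[of 1] w by (simp add: norm_eq_sqrt_inner)
  have "1 + norm x \<noteq> 0" using norm_ge_zero[of x] by linarith
  then show ?thesis unfolding 1 2 busemann_ratio_def w(2) by simp
qed

section \<open>Equivariance of the orbit measures and passage to the limit\<close>

definition orbit_weight ::
  "(real ^ ('n::finite) option ^ 'n option) set \<Rightarrow> real \<Rightarrow> real ^ 'n option ^ 'n option \<Rightarrow> real" where
  "orbit_weight \<Gamma> s \<gamma> = exp (- s * hyp_dist 0 (hyp_act \<gamma> 0)) /
     (\<Sum>\<^sub>\<infinity>\<gamma>\<in>\<Gamma>. exp (- s * hyp_dist 0 (hyp_act \<gamma> 0)))"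

lemma orbit_weight_nonneg: "0 \<le> orbit_weight \<Gamma> s \<gamma>"
  unfolding orbit_weight_def by (intro divide_nonneg_nonneg infsum_nonneg) auto

lemma integral_orbit_measure:
  fixes F :: "real ^ 'n \<Rightarrow> real"
  assumes "F \<in> borel_measurable borel"
  shows "integral\<^sup>L (orbit_measure \<Gamma> s) F =
    (\<integral>\<gamma>. orbit_weight \<Gamma> s \<gamma> * F (hyp_act \<gamma> 0) \<partial>count_space \<Gamma>)"
proof -
  have "integral\<^sup>L (orbit_measure \<Gamma> s) F =
      (\<integral>\<gamma>. F (hyp_act \<gamma> 0) \<partial>point_measure \<Gamma> (\<lambda>\<gamma>. ennreal (orbit_weight \<Gamma> s \<gamma>)))"
    unfolding orbit_measure_def orbit_weight_def[symmetric]
    by (rule integral_distr) (auto simp: assms point_measure_def)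
  also have "\<dots> = (\<integral>\<gamma>. orbit_weight \<Gamma> s \<gamma> *\<^sub>R F (hyp_act \<gamma> 0) \<partial>count_space \<Gamma>)"
    unfolding point_measure_def by (rule integral_density) (auto simp: orbit_weight_nonneg)
  finally show ?thesis by simp
qed

text \<open>Reindexing by left multiplication with the inverse of \<open>g\<close> removes
  \<open>g\<close> from the argument of \<open>h\<close>. In the weight, the distance of an orbit
  point from the origin becomes its distance from \<open>hyp_act g 0\<close>; the difference is the
  logarithm of \<open>busemann_ratio\<close>.\<close>

lemma integral_orbit_measure_shift:
  fixes h :: "real ^ ('n::finite) \<Rightarrow> real"
  assumes sub: "subgroup \<Gamma> SO0_mink" and g: "g \<in> \<Gamma>"
  shows "(\<integral>\<gamma>. orbit_weight \<Gamma> s \<gamma> * h (hyp_act g (hyp_act \<gamma> 0)) \<partial>count_space \<Gamma>) =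
    (\<integral>\<gamma>. orbit_weight \<Gamma> s \<gamma> * (h (hyp_act \<gamma> 0) * exp (- s * ln (busemann_ratio g (hyp_act \<gamma> 0)))) \<partial>count_space \<Gamma>)"
proof -
  interpret G: group "SO0_mink :: (real ^ 'n option ^ 'n option) monoid" by (rule group_SO0_mink)
  interpret S: subgroup \<Gamma> "SO0_mink :: (real ^ 'n option ^ 'n option) monoid" by (rule sub)
  define k where "k = inv\<^bsub>SO0_mink\<^esub> g"
  have k: "k \<in> \<Gamma>" using g by (simp add: k_def)
  have kg: "k ** g = mat 1" "g ** k = mat 1"
    using G.l_inv[of g] G.r_inv[of g] g S.mem_carrier by (simp_all add: k_def SO0_mink_simps)
  have mult: "A ** B \<in> \<Gamma>" if "A \<in> \<Gamma>" "B \<in> \<Gamma>" for A B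
    using S.m_closed[OF that] by (simp add: SO0_mink_simps)
  have bij: "bij_betw (\<lambda>\<gamma>. k ** \<gamma>) \<Gamma> \<Gamma>"
    by (rule bij_betw_byWitness[where f' = "\<lambda>\<gamma>. g ** \<gamma>"]) (auto simp: mult k g kg matrix_mul_assoc)
  have z: "0 \<in> cball (0 :: real ^ 'n) 1" by simp
  have w: "orbit_weight \<Gamma> s (k ** \<gamma>) * h (hyp_act g (hyp_act (k ** \<gamma>) 0)) =
      orbit_weight \<Gamma> s \<gamma> * (h (hyp_act \<gamma> 0) * exp (- s * ln (busemann_ratio g (hyp_act \<gamma> 0))))"
    if \<gamma>: "\<gamma> \<in> \<Gamma>" for \<gamma>
  proof -
    have c: "k \<in> carrier SO0_mink" "g \<in> carrier SO0_mink" "\<gamma> \<in> carrier SO0_mink"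
      using k g \<gamma> S.mem_carrier by auto
    define x where "x = hyp_act \<gamma> 0"
    have x: "norm x < 1" using hyp_act_ball[OF c(3), of 0] by (simp add: x_def)
    have kx: "hyp_act (k ** \<gamma>) 0 = hyp_act k x" using hyp_act_mult[OF c(1,3) z] by (simp add: x_def)
    have gkx: "hyp_act g (hyp_act k x) = x"
      using hyp_act_inv(2)[OF c(2), of x] x by (simp add: k_def)
    have "hyp_dist 0 (hyp_act k x) = hyp_dist (hyp_act g 0) (hyp_act g (hyp_act k x))"
      using hyp_act_ball[OF c(1), of x] x by (intro hyp_dist_hyp_act[symmetric] c) auto
    then have d: "hyp_dist 0 (hyp_act k x) = hyp_dist (hyp_act g 0) x" by (simp add: gkx)
    have r: "0 < busemann_ratio g x" using busemann_ratio_pos[OF c(2)] x by simp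
    have "hyp_dist (hyp_act g 0) x = ln (exp (hyp_dist 0 x) * busemann_ratio g x)"
      by (simp flip: exp_hyp_dist_diff[OF c(2) x])
    also have "\<dots> = hyp_dist 0 x + ln (busemann_ratio g x)" using r by (simp add: ln_mult)
    finally have "exp (- s * hyp_dist 0 (hyp_act k x)) = exp (- s * hyp_dist 0 x) * exp (- s * ln (busemann_ratio g x))"
      by (simp add: d algebra_simps flip: exp_add)
    then show ?thesis unfolding orbit_weight_def kx gkx x_def[symmetric] by simp
  qed
  have "(\<integral>\<gamma>. orbit_weight \<Gamma> s \<gamma> * h (hyp_act g (hyp_act \<gamma> 0)) \<partial>count_space \<Gamma>) =
    (\<integral>\<gamma>. orbit_weight \<Gamma> s (k ** \<gamma>) * h (hyp_act g (hyp_act (k ** \<gamma>) 0)) \<partial>count_space \<Gamma>)"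
    by (rule integral_bij_count_space[OF bij, symmetric])
  also have "\<dots> = (\<integral>\<gamma>. orbit_weight \<Gamma> s \<gamma> * (h (hyp_act \<gamma> 0) * exp (- s * ln (busemann_ratio g (hyp_act \<gamma> 0)))) \<partial>count_space \<Gamma>)"
    by (rule Bochner_Integration.integral_cong) (auto simp: w)
  finally show ?thesis .
qed

text \<open>The identity \<open>integral_orbit_measure_shift\<close> holds for each
  \<open>s k\<close> and passes to the limit. The limit measure lives on the sphere, where
  \<open>busemann_ratio\<close> is \<open>conf_factor\<close>.\<close>

lemma weak_limit_conformal:
  fixes \<Gamma> :: "(real ^ ('n::finite) option ^ 'n option) set" and \<mu> :: "(real ^ 'n) measure"
  assumes sub: "subgroup \<Gamma> SO0_mink" and \<mu>: "prob_space \<mu>" "sets \<mu> = sets borel"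
    and supp: "AE x in \<mu>. norm x = 1"
    and s: "s \<longlonglongrightarrow> \<delta>" and lim: "weakly_converges (\<lambda>k. orbit_measure \<Gamma> (s k)) \<mu>"
    and g: "g \<in> \<Gamma>"
  shows "distr \<mu> borel (hyp_act g) = density \<mu> (\<lambda>x. ennreal (conf_factor g x powr (- \<delta>)))"
proof -
  interpret \<mu>: prob_space \<mu> by (rule \<mu>(1))
  have gG: "g \<in> carrier SO0_mink" using g sub subgroup.subset by blast
  \<comment> \<open>The nearest-point retraction onto the closed ball makes the integrands
    continuous and bounded on the whole space, as weak convergence demands, and it fixes all orbit
    points and the sphere.\<close>
  define \<phi> where "\<phi> = closest_point (cball (0 :: real ^ 'n) 1)"
  have \<phi>_cont: "continuous_on UNIV \<phi>" unfolding \<phi>_def by (rule continuous_on_closest_point) auto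
  have \<phi>_in: "norm (\<phi> x) \<le> 1" for x
    using closest_point_in_set[of "cball (0 :: real ^ 'n) 1" x] by (simp add: \<phi>_def)
  have \<phi>_id: "\<phi> x = x" if "norm x \<le> 1" for x using that by (simp add: \<phi>_def closest_point_self)
  define u where "u x = ln (busemann_ratio g (\<phi> x))" for x
  have lnc: "continuous_on (cball 0 1) (\<lambda>x. ln (busemann_ratio g x))"
    using busemann_ratio_pos[OF gG] by (intro continuous_on_ln continuous_on_busemann_ratio) (auto simp: less_imp_neq[symmetric])
  have u_cont: "continuous_on UNIV u"
    unfolding u_def using \<phi>_in by (intro continuous_on_compose2[OF lnc \<phi>_cont]) auto
  have "bounded ((\<lambda>x. ln (busemann_ratio g x)) ` cball 0 1)"
    by (intro compact_imp_bounded compact_continuous_image lnc) auto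
  then obtain B where "\<forall>x\<in>cball 0 1. \<bar>ln (busemann_ratio g x)\<bar> \<le> B"
    unfolding bounded_iff by auto
  then have B: "\<bar>ln (busemann_ratio g x)\<bar> \<le> B" if "x \<in> cball 0 1" for x using that by blast
  have uB: "\<bar>u x\<bar> \<le> B" for x unfolding u_def using \<phi>_in by (intro B) simp
  have B0: "0 \<le> B" using uB[of 0] by linarith
  have [measurable]: "u \<in> borel_measurable borel" by (rule borel_measurable_continuous_onI[OF u_cont])
  have meas_\<mu>: "F \<in> borel_measurable \<mu>" if "F \<in> borel_measurable borel" for F :: "real ^ 'n \<Rightarrow> real"
    using that \<mu>(2) by (simp cong: measurable_cong_sets)
  have conv: "(\<lambda>k. integral\<^sup>L (orbit_measure \<Gamma> (s k)) F) \<longlonglongrightarrow> integral\<^sup>L \<mu> F"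
    if "continuous_on UNIV F" "\<And>x. \<bar>F x\<bar> \<le> K" for F :: "real ^ 'n \<Rightarrow> real" and K
    using lim that unfolding weakly_converges_def by (auto simp: bounded_iff)
  have expB: "exp (- t * u x) \<le> exp (\<bar>t\<bar> * B)" for t x
    using abs_ge_self[of "- t * u x"] mult_left_mono[OF uB[of x] abs_ge_zero[of t]] by (simp add: abs_mult)
  have main: "(\<integral>x. h (hyp_act g (\<phi> x)) \<partial>\<mu>) = (\<integral>x. h (\<phi> x) * exp (- \<delta> * u x) \<partial>\<mu>)"
    if h: "continuous_on UNIV h" "\<And>x. 0 \<le> h x" "\<And>x. h x \<le> 1" for h :: "real ^ 'n \<Rightarrow> real"
  proof -
    have h\<phi>: "continuous_on UNIV (\<lambda>x. h (\<phi> x))" by (intro continuous_on_compose2[OF h(1) \<phi>_cont]) auto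
    have hg\<phi>: "continuous_on UNIV (\<lambda>x. h (hyp_act g (\<phi> x)))"
    proof (intro continuous_on_compose2[OF h(1)])
      show "continuous_on UNIV (\<lambda>x. hyp_act g (\<phi> x))"
        using \<phi>_in by (intro continuous_on_compose2[OF continuous_on_hyp_act[OF gG] \<phi>_cont]) auto
    qed auto
    have cF: "continuous_on UNIV (\<lambda>x. h (\<phi> x) * exp (- t * u x))" for t
      by (intro continuous_intros h\<phi> u_cont)
    note [measurable] = borel_measurable_continuous_onI[OF cF] borel_measurable_continuous_onI[OF hg\<phi>]
    \<comment> \<open>Exponent and measure are indexed separately: the shift produces
      \<open>I (s k) k\<close>, while weak convergence needs a fixed integrand and applies to
      \<open>I \<delta> k\<close>.\<close>
    define I where "I t k = integral\<^sup>L (orbit_measure \<Gamma> (s k)) (\<lambda>x. h (\<phi> x) * exp (- t * u x))" for t k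
    have shift: "integral\<^sup>L (orbit_measure \<Gamma> (s k)) (\<lambda>x. h (hyp_act g (\<phi> x))) = I (s k) k" for k
    proof -
      have n: "norm (hyp_act \<gamma> 0) < 1" if "\<gamma> \<in> \<Gamma>" for \<gamma>
      proof -
        have "\<gamma> \<in> carrier SO0_mink" using that sub subgroup.subset by blast
        then show ?thesis using hyp_act_ball[of \<gamma> 0] by simp
      qed
      have "integral\<^sup>L (orbit_measure \<Gamma> (s k)) (\<lambda>x. h (hyp_act g (\<phi> x))) =
          (\<integral>\<gamma>. orbit_weight \<Gamma> (s k) \<gamma> * h (hyp_act g (hyp_act \<gamma> 0)) \<partial>count_space \<Gamma>)"
        by (subst integral_orbit_measure[OF borel_measurable_continuous_onI[OF hg\<phi>]])
          (auto simp: \<phi>_id n less_imp_le intro!: Bochner_Integration.integral_cong)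
      also have "\<dots> = I (s k) k"
        unfolding integral_orbit_measure_shift[OF sub g] I_def
        by (subst integral_orbit_measure[OF borel_measurable_continuous_onI[OF cF]])
          (auto simp: \<phi>_id n less_imp_le u_def intro!: Bochner_Integration.integral_cong)
      finally show ?thesis .
    qed
    have t1: "(\<lambda>k. I (s k) k) \<longlonglongrightarrow> (\<integral>x. h (hyp_act g (\<phi> x)) \<partial>\<mu>)"
      unfolding shift[symmetric] using h by (intro conv[OF hg\<phi>, of 1]) auto
    have t2: "I \<delta> \<longlonglongrightarrow> (\<integral>x. h (\<phi> x) * exp (- \<delta> * u x) \<partial>\<mu>)"
      unfolding I_def
    proof (rule conv[OF cF])
      fix x show "\<bar>h (\<phi> x) * exp (- \<delta> * u x)\<bar> \<le> exp (\<bar>\<delta>\<bar> * B)"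
        using h mult_mono[OF h(3) expB[of \<delta> x]] by (simp add: abs_mult)
    qed
    define E where "E k = exp (\<bar>\<delta>\<bar> * B) * (exp (\<bar>s k - \<delta>\<bar> * B) - 1)" for k
    \<comment> \<open>Total mass, which tends to 1 by testing with the constant 1. Where it is
      nonzero the constant is integrable, since the integral would otherwise be 0.\<close>
    define c :: "nat \<Rightarrow> real" where "c k = (\<integral>x. 1 \<partial>orbit_measure \<Gamma> (s k))" for k
    have c1: "c \<longlonglongrightarrow> 1"
      unfolding c_def using conv[of "\<lambda>_. 1" 1] by (simp add: \<mu>.prob_space)
    have "E \<longlonglongrightarrow> exp (\<bar>\<delta>\<bar> * B) * (exp (\<bar>\<delta> - \<delta>\<bar> * B) - 1)"
      unfolding E_def by (intro tendsto_intros s)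
    then have Ec: "(\<lambda>k. E k * c k) \<longlonglongrightarrow> 0" using tendsto_mult[OF _ c1, of E 0] by simp
    have "\<forall>\<^sub>F k in sequentially. 1/2 < c k" using c1 by (rule order_tendstoD) simp
    then have "\<forall>\<^sub>F k in sequentially. norm (I (s k) k - I \<delta> k) \<le> E k * c k"
    proof eventually_elim
      case (elim k)
      let ?M = "orbit_measure \<Gamma> (s k)"
      have sM: "sets ?M = sets borel" by (simp add: orbit_measure_def)
      have one: "integrable ?M (\<lambda>_. 1 :: real)"
        using elim not_integrable_integral_eq[of ?M "\<lambda>_. 1 :: real"] unfolding c_def by fastforce
      have int: "integrable ?M (\<lambda>x. h (\<phi> x) * exp (- t * u x))" for t
      proof (rule Bochner_Integration.integrable_bound)
        show "integrable ?M (\<lambda>_. exp (\<bar>t\<bar> * B) * 1)" by (intro integrable_mult_right one)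
        show "(\<lambda>x. h (\<phi> x) * exp (- t * u x)) \<in> borel_measurable ?M"
          using borel_measurable_continuous_onI[OF cF] sM by (simp cong: measurable_cong_sets)
        show "AE x in ?M. norm (h (\<phi> x) * exp (- t * u x)) \<le> norm (exp (\<bar>t\<bar> * B) * 1)"
        proof (rule AE_I2)
          fix x show "norm (h (\<phi> x) * exp (- t * u x)) \<le> norm (exp (\<bar>t\<bar> * B) * 1)"
            using h mult_mono[OF h(3) expB[of t x]] by (simp add: abs_mult)
        qed
      qed
      have "norm (I (s k) k - I \<delta> k) = norm (\<integral>x. h (\<phi> x) * exp (- s k * u x) - h (\<phi> x) * exp (- \<delta> * u x) \<partial>?M)"
        unfolding I_def by (subst Bochner_Integration.integral_diff[OF int int]) simp
      also have "\<dots> \<le> (\<integral>x. norm (h (\<phi> x) * exp (- s k * u x) - h (\<phi> x) * exp (- \<delta> * u x)) \<partial>?M)"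
        by (rule integral_norm_bound)
      also have "\<dots> \<le> (\<integral>x. E k * 1 \<partial>?M)"
      proof (rule integral_mono)
        show "integrable ?M (\<lambda>x. norm (h (\<phi> x) * exp (- s k * u x) - h (\<phi> x) * exp (- \<delta> * u x)))"
          by (intro integrable_norm Bochner_Integration.integrable_diff int)
        show "integrable ?M (\<lambda>x. E k * 1)" by (intro integrable_mult_right one)
        fix x
        have "norm (h (\<phi> x) * exp (- s k * u x) - h (\<phi> x) * exp (- \<delta> * u x)) =
            h (\<phi> x) * \<bar>exp (- s k * u x) - exp (- \<delta> * u x)\<bar>"
          using h(2)[of "\<phi> x"] by (simp add: abs_mult flip: right_diff_distrib)
        also have "\<dots> \<le> 1 * E k"
          unfolding E_def using h by (intro mult_mono abs_exp_diff_le uB) auto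
        finally show "norm (h (\<phi> x) * exp (- s k * u x) - h (\<phi> x) * exp (- \<delta> * u x)) \<le> E k * 1" by simp
      qed
      also have "\<dots> = E k * c k" unfolding c_def by (rule Bochner_Integration.integral_mult_right_zero)
      finally show ?case .
    qed
    then have "(\<lambda>k. I (s k) k - I \<delta> k) \<longlonglongrightarrow> 0" by (rule Lim_null_comparison[OF _ Ec])
    from tendsto_add[OF this t2] have "(\<lambda>k. I (s k) k) \<longlonglongrightarrow> (\<integral>x. h (\<phi> x) * exp (- \<delta> * u x) \<partial>\<mu>)"
      by simp
    then show ?thesis using LIMSEQ_unique[OF t1] by blast
  qed
  have [measurable]: "hyp_act g \<in> measurable \<mu> borel"
    using borel_measurable_hyp_act[of g] \<mu>(2) by (simp cong: measurable_cong_sets)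
  have um: "(\<lambda>x. exp (- \<delta> * u x)) \<in> borel_measurable \<mu>" by (intro meas_\<mu>) measurable
  have "distr \<mu> borel (hyp_act g) = density \<mu> (\<lambda>x. ennreal (exp (- \<delta> * u x)))"
  proof (rule measure_eqI_continuous)
    show "finite_measure (distr \<mu> borel (hyp_act g))"
      by (intro prob_space.finite_measure \<mu>.prob_space_distr) measurable
    show "finite_measure (density \<mu> (\<lambda>x. ennreal (exp (- \<delta> * u x))))"
    proof
      have "emeasure (density \<mu> (\<lambda>x. ennreal (exp (- \<delta> * u x)))) (space \<mu>) = (\<integral>\<^sup>+x. ennreal (exp (- \<delta> * u x)) \<partial>\<mu>)"
        using um by (subst emeasure_density) (auto intro!: nn_integral_cong)
      also have "\<dots> \<le> (\<integral>\<^sup>+x. ennreal (exp (\<bar>\<delta>\<bar> * B)) \<partial>\<mu>)"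
        using expB[of \<delta>] by (intro nn_integral_mono ennreal_leI) auto
      also have "\<dots> < \<infinity>" by (simp add: \<mu>.emeasure_space_1 less_top)
      finally show "emeasure (density \<mu> (\<lambda>x. ennreal (exp (- \<delta> * u x))))
          (space (density \<mu> (\<lambda>x. ennreal (exp (- \<delta> * u x))))) \<noteq> \<infinity>" by simp
    qed
    fix F :: "real ^ 'n \<Rightarrow> real"
    assume F: "continuous_on UNIV F" "\<And>x. 0 \<le> F x" "\<And>x. F x \<le> 1"
    have Fm: "F \<in> borel_measurable borel" by (rule borel_measurable_continuous_onI[OF F(1)])
    have c1: "continuous_on UNIV (\<lambda>x. F (\<phi> x))" by (intro continuous_on_compose2[OF F(1) \<phi>_cont]) auto
    have c2: "continuous_on UNIV (\<lambda>x. hyp_act g (\<phi> x))"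
      using \<phi>_in by (intro continuous_on_compose2[OF continuous_on_hyp_act[OF gG] \<phi>_cont]) auto
    have c3: "continuous_on UNIV (\<lambda>x. F (hyp_act g (\<phi> x)))"
      by (intro continuous_on_compose2[OF F(1) c2]) auto
    have "integral\<^sup>L (distr \<mu> borel (hyp_act g)) F = (\<integral>x. F (hyp_act g x) \<partial>\<mu>)"
      by (rule integral_distr) (use Fm in measurable)
    also have "\<dots> = (\<integral>x. F (hyp_act g (\<phi> x)) \<partial>\<mu>)"
    proof (rule integral_cong_AE)
      show "(\<lambda>x. F (hyp_act g x)) \<in> borel_measurable \<mu>" by (rule measurable_compose[OF _ Fm]) measurable
      show "(\<lambda>x. F (hyp_act g (\<phi> x))) \<in> borel_measurable \<mu>"
        by (intro meas_\<mu> borel_measurable_continuous_onI c3)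
      show "AE x in \<mu>. F (hyp_act g x) = F (hyp_act g (\<phi> x))"
        using supp by eventually_elim (simp add: \<phi>_id)
    qed
    also have "\<dots> = (\<integral>x. F (\<phi> x) * exp (- \<delta> * u x) \<partial>\<mu>)" by (rule main[OF F])
    also have "\<dots> = (\<integral>x. exp (- \<delta> * u x) *\<^sub>R F x \<partial>\<mu>)"
    proof (rule integral_cong_AE)
      show "(\<lambda>x. F (\<phi> x) * exp (- \<delta> * u x)) \<in> borel_measurable \<mu>"
        by (intro borel_measurable_times um meas_\<mu> borel_measurable_continuous_onI c1)
      show "(\<lambda>x. exp (- \<delta> * u x) *\<^sub>R F x) \<in> borel_measurable \<mu>"
        by (intro borel_measurable_scaleR um meas_\<mu> Fm)
      show "AE x in \<mu>. F (\<phi> x) * exp (- \<delta> * u x) = exp (- \<delta> * u x) *\<^sub>R F x"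
        using supp by eventually_elim (simp add: \<phi>_id)
    qed
    also have "\<dots> = integral\<^sup>L (density \<mu> (\<lambda>x. ennreal (exp (- \<delta> * u x)))) F"
      by (rule integral_density[symmetric]) (use um meas_\<mu>[OF Fm] in auto)
    finally show "integral\<^sup>L (distr \<mu> borel (hyp_act g)) F = integral\<^sup>L (density \<mu> (\<lambda>x. ennreal (exp (- \<delta> * u x)))) F" .
  qed (use \<mu>(2) in auto)
  also have "\<dots> = density \<mu> (\<lambda>x. ennreal (conf_factor g x powr (- \<delta>)))"
  proof (rule density_cong)
    show "(\<lambda>x. ennreal (exp (- \<delta> * u x))) \<in> borel_measurable \<mu>" using um by measurable
    have "continuous_on UNIV (conf_factor g)" unfolding conf_factor_def by (intro continuous_intros)
    then have "conf_factor g \<in> borel_measurable \<mu>" by (intro meas_\<mu> borel_measurable_continuous_onI)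
    then show "(\<lambda>x. ennreal (conf_factor g x powr (- \<delta>))) \<in> borel_measurable \<mu>" by measurable
    show "AE x in \<mu>. ennreal (exp (- \<delta> * u x)) = ennreal (conf_factor g x powr (- \<delta>))"
      using supp
    proof eventually_elim
      case (elim x)
      then show ?case using conf_factor_pos[OF gG elim]
        by (simp add: u_def \<phi>_id busemann_ratio_sphere[OF gG] powr_def)
    qed
  qed
  finally show ?thesis .
qed

section \<open>The stationary measure\<close>

lemma hyp_dist_0_nonneg: "norm x < 1 \<Longrightarrow> 0 \<le> hyp_dist 0 x"
proof -
  assume x: "norm x < 1"
  have "0 < 1 - x \<bullet> x" using inner_less_one[of x x] x by simp
  then have "1 \<le> 1 / sqrt (1 - x \<bullet> x)" by simp
  then show ?thesis by (simp add: hyp_dist_alt arcosh_nonneg_real)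
qed

text \<open>A limit point forces \<Gamma> to be infinite, and for negative \<open>s\<close> every
  term of the series is at least 1.\<close>

lemma critical_exponent_nonneg:
  fixes \<Gamma> :: "(real ^ ('n::finite) option ^ 'n option) set"
  assumes sub: "subgroup \<Gamma> SO0_mink" and ne: "limit_set \<Gamma> \<noteq> {}"
  shows "0 \<le> critical_exponent \<Gamma>"
  unfolding critical_exponent_def
proof (rule INF_greatest)
  fix s :: real
  assume "s \<in> {s. (\<lambda>\<gamma>. exp (- s * hyp_dist 0 (hyp_act \<gamma> 0))) summable_on \<Gamma>}"
  then have sum: "(\<lambda>\<gamma>. exp (- s * hyp_dist 0 (hyp_act \<gamma> 0))) summable_on \<Gamma>" by simp
  obtain \<xi> where "\<xi> islimpt (\<lambda>\<gamma>. hyp_act \<gamma> 0) ` \<Gamma>" using ne by (auto simp: limit_set_def)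
  then have inf: "infinite \<Gamma>" using islimpt_finite finite_imageI by blast
  show "0 \<le> ereal s"
  proof (rule ccontr)
    assume "\<not> 0 \<le> ereal s"
    then have s: "s < 0" by simp
    have "(\<lambda>_. 1 :: real) summable_on \<Gamma>"
    proof (rule summable_on_comparison_test[OF sum])
      fix \<gamma> assume "\<gamma> \<in> \<Gamma>"
      then have "\<gamma> \<in> carrier SO0_mink" using sub subgroup.subset by blast
      then have "0 \<le> hyp_dist 0 (hyp_act \<gamma> 0)"
        using hyp_act_ball[of \<gamma> 0] by (intro hyp_dist_0_nonneg) simp
      then show "1 \<le> exp (- s * hyp_dist 0 (hyp_act \<gamma> 0))" using s by (simp add: mult_nonpos_nonneg)
    qed simp
    then show False using infsum_diverge_constant[OF inf, of "1 :: real"] by simp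
  qed
qed

text \<open>Points of the closed ball stay in it, so spatial coordinates of an image are bounded by
  its time coordinate: by \<open>boost A\<close> at the origin, by \<open>2 * boost A\<close> at a
  unit vector. A remaining entry is a difference of two such coordinates.\<close>

lemma entry_le_boost:
  fixes A :: "real ^ ('n::finite) option ^ 'n option"
  assumes A: "A \<in> carrier SO0_mink" shows "\<bar>A $ i $ j\<bar> \<le> 3 * boost A"
proof -
  have b: "1 \<le> boost A" by (rule boost_ge_1[OF A])
  have row: "\<bar>(A *v lift_mink x) $ Some k\<bar> \<le> 2 * boost A" if x: "x \<in> cball 0 1" for x k
  proof -
    define t where "t = (A *v lift_mink x) $ None"
    have t: "0 < t" "t \<le> 2 * boost A"
      using SO0_mink_time_pos[OF A x] time_coordinate_bounds(2)[OF A, of x 1] x by (auto simp: t_def)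
    have "norm (hyp_act A x) \<le> 1"
      using hyp_act_ball[OF A, of x] hyp_act_sphere[OF A, of x] x by (cases "norm x = 1") auto
    then have "\<bar>hyp_act A x $ k\<bar> \<le> 1" using component_le_norm_cart[of "hyp_act A x" k] by linarith
    then have "\<bar>(A *v lift_mink x) $ Some k\<bar> \<le> t" using t by (simp add: hyp_act_def t_def abs_divide)
    then show ?thesis using t by linarith
  qed
  have col: "\<bar>A $ Some k $ None\<bar> \<le> boost A" for k
  proof -
    have "norm (hyp_act A 0) < 1" using hyp_act_ball[OF A, of 0] by simp
    then have "\<bar>hyp_act A 0 $ k\<bar> \<le> 1" using component_le_norm_cart[of "hyp_act A 0" k] by linarith
    then show ?thesis using b by (simp add: hyp_act_def matrix_lift_mink abs_divide flip: boost_def)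
  qed
  show ?thesis
  proof (cases i)
    case None
    show ?thesis
    proof (cases j)
      case None
      then show ?thesis using \<open>i = None\<close> b by (simp flip: boost_def)
    next
      case (Some l)
      then show ?thesis
        using \<open>i = None\<close> b norm_first_row[OF A] component_le_norm_cart[of "\<chi> i. A $ None $ Some i" l] by simp
    qed
  next
    case (Some k)
    show ?thesis
    proof (cases j)
      case None
      then show ?thesis using \<open>i = Some k\<close> b col[of k] by simp
    next
      case (Some l)
      have "\<bar>A $ Some k $ None + A $ Some k $ Some l\<bar> \<le> 2 * boost A"
        using row[of "axis l 1" k] by (simp add: matrix_lift_mink inner_axis)
      then show ?thesis using \<open>i = Some k\<close> Some col[of k] by (auto simp: abs_le_iff)
    qed
  qed
qed

section \<open>From weights to a stationary measure\<close>

text \<open>The measure \<open>\<nu>\<close> is the sum of point masses \<open>p \<gamma>\<close>.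
  Stationarity is Tonelli's theorem for the densities; positive weights and closedness of \<Gamma>
  make the support exactly \<Gamma>.\<close>

lemma stationary_measure_from_weights:
  fixes \<Gamma> :: "(real ^ ('n::finite) option ^ 'n option) set" and \<mu> :: "(real ^ 'n) measure"
  assumes sub: "subgroup \<Gamma> SO0_mink" and cl: "closed \<Gamma>" and cnt: "countable \<Gamma>"
    and \<mu>: "prob_space \<mu>" "sets \<mu> = sets borel"
    and f_meas: "\<And>\<gamma>. \<gamma> \<in> \<Gamma> \<Longrightarrow> f \<gamma> \<in> borel_measurable \<mu>"
    and f: "\<And>\<gamma>. \<gamma> \<in> \<Gamma> \<Longrightarrow> distr \<mu> borel (hyp_act \<gamma>) = density \<mu> (f \<gamma>)"
    and p_pos: "\<And>\<gamma>. \<gamma> \<in> \<Gamma> \<Longrightarrow> 0 < p \<gamma>"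
    and p_sum: "AE x in \<mu>. (\<integral>\<^sup>+\<gamma>. p \<gamma> * f \<gamma> x \<partial>count_space \<Gamma>) = 1"
    and e: "0 < \<epsilon>" "(\<integral>\<^sup>+\<gamma>. p \<gamma> * ennreal (boost \<gamma> powr \<epsilon>) \<partial>count_space \<Gamma>) < \<infinity>"
  shows "\<exists>\<nu> :: (real ^ 'n option ^ 'n option) measure.
           prob_space \<nu> \<and> sets \<nu> = sets borel \<and> emeasure \<nu> \<Gamma> = 1 \<and>
           finite_exponential_moment \<nu> \<and> stationary \<nu> \<mu> \<and> generated_subgroup \<nu> = \<Gamma>"
proof -
  interpret \<mu>: prob_space \<mu> by (rule \<mu>(1))
  interpret G: group "SO0_mink :: (real ^ 'n option ^ 'n option) monoid" by (rule group_SO0_mink)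
  define \<nu> where "\<nu> = distr (density (count_space \<Gamma>) p) borel (\<lambda>\<gamma>. \<gamma>)"
  have sets_\<nu>: "sets \<nu> = sets borel" by (simp add: \<nu>_def)
  have int_\<nu>: "(\<integral>\<^sup>+\<gamma>. \<phi> \<gamma> \<partial>\<nu>) = (\<integral>\<^sup>+\<gamma>. p \<gamma> * \<phi> \<gamma> \<partial>count_space \<Gamma>)"
    if "\<phi> \<in> borel_measurable borel" for \<phi>
    unfolding \<nu>_def by (subst nn_integral_distr) (simp_all add: that nn_integral_density)
  have em_\<nu>: "emeasure \<nu> B = (\<integral>\<^sup>+\<gamma>. p \<gamma> * indicator B \<gamma> \<partial>count_space \<Gamma>)" if "B \<in> sets borel" for B
    using int_\<nu>[of "indicator B"] that sets_\<nu> by simp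
  have hyp_meas: "hyp_act \<gamma> \<in> measurable \<mu> borel" for \<gamma>
    using borel_measurable_hyp_act[of \<gamma>] \<mu>(2) by (simp cong: measurable_cong_sets)
  have swap: "(\<integral>\<^sup>+\<gamma>. p \<gamma> * emeasure (distr \<mu> borel (hyp_act \<gamma>)) B \<partial>count_space \<Gamma>) = emeasure \<mu> B"
    if B: "B \<in> sets borel" for B
  proof -
    have B': "B \<in> sets \<mu>" using B \<mu>(2) by simp
    have "(\<integral>\<^sup>+\<gamma>. p \<gamma> * emeasure (distr \<mu> borel (hyp_act \<gamma>)) B \<partial>count_space \<Gamma>) =
        (\<integral>\<^sup>+\<gamma>. \<integral>\<^sup>+x. p \<gamma> * (f \<gamma> x * indicator B x) \<partial>\<mu> \<partial>count_space \<Gamma>)"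
      using f f_meas B' by (intro nn_integral_cong) (simp add: emeasure_density nn_integral_cmult)
    also have "\<dots> = (\<integral>\<^sup>+x. \<integral>\<^sup>+\<gamma>. p \<gamma> * (f \<gamma> x * indicator B x) \<partial>count_space \<Gamma> \<partial>\<mu>)"
      using f_meas B' by (intro nn_integral_count_space_nn_integral[symmetric] cnt) auto
    also have "\<dots> = (\<integral>\<^sup>+x. (\<integral>\<^sup>+\<gamma>. p \<gamma> * f \<gamma> x \<partial>count_space \<Gamma>) * indicator B x \<partial>\<mu>)"
      by (simp add: mult.assoc[symmetric] nn_integral_multc)
    also have "\<dots> = (\<integral>\<^sup>+x. indicator B x \<partial>\<mu>)"
      by (rule nn_integral_cong_AE) (use p_sum in \<open>eventually_elim, simp\<close>)
    also have "\<dots> = emeasure \<mu> B" using B' by simp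
    finally show ?thesis .
  qed
  \<comment> \<open>All translates of \<open>\<mu>\<close> and \<open>\<mu>\<close> itself have mass
    1, so \<open>swap\<close> with \<open>B = UNIV\<close> gives the sum of the weights.\<close>
  have p1: "(\<integral>\<^sup>+\<gamma>. p \<gamma> \<partial>count_space \<Gamma>) = 1"
  proof -
    have "emeasure (distr \<mu> borel (hyp_act \<gamma>)) UNIV = 1" for \<gamma>
      using prob_space.emeasure_space_1[OF \<mu>.prob_space_distr[OF hyp_meas[of \<gamma>]]] by simp
    moreover have "emeasure \<mu> UNIV = 1"
      using \<mu>.emeasure_space_1 sets_eq_imp_space_eq[OF \<mu>(2)] by simp
    ultimately show ?thesis using swap[of UNIV] by simp
  qed
  have prob: "prob_space \<nu>"
    by (rule prob_spaceI) (use em_\<nu>[of UNIV] p1 sets_eq_imp_space_eq[OF sets_\<nu>] in simp)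
  have \<Gamma>B: "\<Gamma> \<in> sets borel" using cl by simp
  have "emeasure \<nu> \<Gamma> = (\<integral>\<^sup>+\<gamma>. p \<gamma> \<partial>count_space \<Gamma>)"
    unfolding em_\<nu>[OF \<Gamma>B] by (rule nn_integral_cong) simp
  then have em_\<Gamma>: "emeasure \<nu> \<Gamma> = 1" by (simp add: p1)
  have supp: "measure_support \<nu> = \<Gamma>"
  proof (intro equalityI subsetI)
    fix x assume x: "x \<in> measure_support \<nu>"
    show "x \<in> \<Gamma>"
    proof (rule ccontr)
      assume "x \<notin> \<Gamma>"
      then have "0 < emeasure \<nu> (- \<Gamma>)" using x cl by (auto simp: measure_support_def)
      moreover have "emeasure \<nu> (- \<Gamma>) = (\<integral>\<^sup>+\<gamma>. p \<gamma> * indicator (- \<Gamma>) \<gamma> \<partial>count_space \<Gamma>)"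
        using \<Gamma>B by (intro em_\<nu>) simp
      moreover have "\<dots> = (\<integral>\<^sup>+\<gamma>. 0 \<partial>count_space \<Gamma>)" by (rule nn_integral_cong) simp
      ultimately show False by simp
    qed
  next
    fix x assume x: "x \<in> \<Gamma>"
    have "0 < emeasure \<nu> U" if U: "open U" "x \<in> U" for U
    proof -
      have "p x * indicator U x \<le> (\<integral>\<^sup>+\<gamma>. p \<gamma> * indicator U \<gamma> \<partial>count_space \<Gamma>)"
        by (rule nn_integral_ge_point[OF x])
      then show ?thesis using p_pos[OF x] U by (simp add: em_\<nu>)
    qed
    then show "x \<in> measure_support \<nu>" by (simp add: measure_support_def)
  qed
  have "generate SO0_mink \<Gamma> = \<Gamma>"
    using G.generate_subgroup_incl[OF subset_refl sub] generate.incl[of _ \<Gamma> SO0_mink] by blast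
  then have gen: "generated_subgroup \<nu> = \<Gamma>" by (simp add: generated_subgroup_def supp)
  \<comment> \<open>Each entry is at most \<open>3 * boost\<close>, and the operator norm is at most
    this bound times the number of entries.\<close>
  define c where "c = 3 * (real CARD('n option))\<^sup>2"
  \<comment> \<open>The complement of \<Gamma> is null, so the integrand may be set to 0 there; as
    \<Gamma> is countable, this makes any function Borel measurable.\<close>
  have int_all: "(\<integral>\<^sup>+\<gamma>. \<phi> \<gamma> \<partial>\<nu>) = (\<integral>\<^sup>+\<gamma>. p \<gamma> * \<phi> \<gamma> \<partial>count_space \<Gamma>)" for \<phi>
  proof -
    have "prob_space.prob \<nu> \<Gamma> = 1" using em_\<Gamma> by (simp add: measure_def)
    then have ae: "AE \<gamma> in \<nu>. \<gamma> \<in> \<Gamma>" by (rule prob_space.AE_prob_1[OF prob])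
    have "(\<integral>\<^sup>+\<gamma>. \<phi> \<gamma> \<partial>\<nu>) = (\<integral>\<^sup>+\<gamma>. (if \<gamma> \<in> \<Gamma> then \<phi> \<gamma> else 0) \<partial>\<nu>)"
      by (rule nn_integral_cong_AE) (use ae in \<open>eventually_elim, simp\<close>)
    also have "\<dots> = (\<integral>\<^sup>+\<gamma>. p \<gamma> * (if \<gamma> \<in> \<Gamma> then \<phi> \<gamma> else 0) \<partial>count_space \<Gamma>)"
    proof (rule int_\<nu>)
      show "(\<lambda>\<gamma>. if \<gamma> \<in> \<Gamma> then \<phi> \<gamma> else 0) \<in> borel_measurable borel"
        by (rule measurable_discrete_difference[where f = "\<lambda>_. 0" and X = \<Gamma>]) (use cnt in auto)
    qed
    also have "\<dots> = (\<integral>\<^sup>+\<gamma>. p \<gamma> * \<phi> \<gamma> \<partial>count_space \<Gamma>)" by (rule nn_integral_cong) simp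
    finally show ?thesis .
  qed
  have "(\<integral>\<^sup>+\<gamma>. ennreal (onorm ((*v) \<gamma>) powr \<epsilon>) \<partial>\<nu>) =
      (\<integral>\<^sup>+\<gamma>. p \<gamma> * ennreal (onorm ((*v) \<gamma>) powr \<epsilon>) \<partial>count_space \<Gamma>)" by (rule int_all)
  also have "\<dots> \<le> (\<integral>\<^sup>+\<gamma>. ennreal (c powr \<epsilon>) * (p \<gamma> * ennreal (boost \<gamma> powr \<epsilon>)) \<partial>count_space \<Gamma>)"
  proof (rule nn_integral_mono)
    fix \<gamma> assume "\<gamma> \<in> space (count_space \<Gamma>)"
    then have \<gamma>: "\<gamma> \<in> carrier SO0_mink" using sub subgroup.subset by auto
    have "onorm ((*v) \<gamma>) \<le> c * boost \<gamma>"
      using onorm_le_matrix_component[OF entry_le_boost[OF \<gamma>]] by (simp add: c_def power2_eq_square mult.assoc)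
    then have "onorm ((*v) \<gamma>) powr \<epsilon> \<le> (c * boost \<gamma>) powr \<epsilon>"
      using e(1) by (intro powr_mono2) (auto intro!: onorm_pos_le matrix_vector_mul_bounded_linear)
    also have "\<dots> = c powr \<epsilon> * boost \<gamma> powr \<epsilon>" by (rule powr_mult)
    finally have "p \<gamma> * ennreal (onorm ((*v) \<gamma>) powr \<epsilon>) \<le> p \<gamma> * ennreal (c powr \<epsilon> * boost \<gamma> powr \<epsilon>)"
      by (intro mult_left_mono ennreal_leI) auto
    then show "p \<gamma> * ennreal (onorm ((*v) \<gamma>) powr \<epsilon>) \<le> ennreal (c powr \<epsilon>) * (p \<gamma> * ennreal (boost \<gamma> powr \<epsilon>))"
      by (simp add: ennreal_mult mult.left_commute)
  qed
  also have "\<dots> = ennreal (c powr \<epsilon>) * (\<integral>\<^sup>+\<gamma>. p \<gamma> * ennreal (boost \<gamma> powr \<epsilon>) \<partial>count_space \<Gamma>)"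
    by (rule nn_integral_cmult) simp
  also have "\<dots> < \<infinity>" using e(2) by (simp add: ennreal_mult_less_top)
  finally have mom: "finite_exponential_moment \<nu>"
    unfolding finite_exponential_moment_def using e(1) by blast
  have "stationary \<nu> \<mu>"
    unfolding stationary_def
  proof (rule measure_eqI)
    have "space \<nu> \<noteq> {}" using sets_eq_imp_space_eq[OF sets_\<nu>] by simp
    then have "sets (convolve \<nu> \<mu>) = sets borel"
      unfolding convolve_def by (intro sets_bind) auto
    then show "sets \<mu> = sets (convolve \<nu> \<mu>)" using \<mu>(2) by simp
    fix B assume "B \<in> sets \<mu>"
    then have B: "B \<in> sets borel" using \<mu>(2) by simp
    have "emeasure (convolve \<nu> \<mu>) B = (\<integral>\<^sup>+\<gamma>. emeasure (distr \<mu> borel (hyp_act \<gamma>)) B \<partial>\<nu>)"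
      by (rule emeasure_convolve[OF \<mu> sets_\<nu> B])
    also have "\<dots> = (\<integral>\<^sup>+\<gamma>. p \<gamma> * emeasure (distr \<mu> borel (hyp_act \<gamma>)) B \<partial>count_space \<Gamma>)"
      by (rule int_all)
    also have "\<dots> = emeasure \<mu> B" by (rule swap[OF B])
    finally show "emeasure \<mu> B = emeasure (convolve \<nu> \<mu>) B" by simp
  qed
  then show ?thesis using prob sets_\<nu> em_\<Gamma> mom gen by blast
qed

text \<open>Almost everywhere the density equals its value at the point, and total mass 1 forces
  that value to be 1.\<close>

lemma density_preserving_concentrated:
  assumes \<mu>: "prob_space \<mu>" and \<xi>: "{\<xi>} \<in> sets \<mu>" "emeasure \<mu> {\<xi>} = 1"
    and F: "F \<in> borel_measurable \<mu>" and D: "prob_space (density \<mu> F)"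
  shows "density \<mu> F = \<mu>"
proof (rule measure_eqI)
  interpret prob_space \<mu> by (rule \<mu>)
  have "AE x in \<mu>. x \<in> {\<xi>}" using \<xi> by (intro AE_prob_1) (simp add: measure_def)
  then have ae: "AE x in \<mu>. x = \<xi>" by simp
  fix B assume "B \<in> sets (density \<mu> F)"
  then have B: "B \<in> sets \<mu>" by simp
  have "emeasure (density \<mu> F) B = (\<integral>\<^sup>+x. F \<xi> * indicator B \<xi> \<partial>\<mu>)"
    unfolding emeasure_density[OF F B] by (rule nn_integral_cong_AE) (use ae in \<open>eventually_elim, simp\<close>)
  then have 1: "emeasure (density \<mu> F) B = F \<xi> * indicator B \<xi>" by (simp add: emeasure_space_1)
  have "1 = emeasure (density \<mu> F) (space \<mu>)" using prob_space.emeasure_space_1[OF D] by simp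
  also have "\<dots> = (\<integral>\<^sup>+x. F \<xi> \<partial>\<mu>)"
    unfolding emeasure_density[OF F sets.top]
    by (rule nn_integral_cong_AE) (use ae AE_space in \<open>eventually_elim, simp\<close>)
  finally have "F \<xi> = 1" by (simp add: emeasure_space_1)
  moreover have "emeasure \<mu> B = (\<integral>\<^sup>+x. indicator B \<xi> \<partial>\<mu>)"
    unfolding nn_integral_indicator[OF B, symmetric]
    by (rule nn_integral_cong_AE) (use ae in \<open>eventually_elim, simp\<close>)
  ultimately show "emeasure (density \<mu> F) B = emeasure \<mu> B" using 1 by (simp add: emeasure_space_1)
qed simp

theorem theoremA1:
  fixes \<Gamma> :: "(real ^ ('n::finite) option ^ 'n option) set"
    and \<mu> :: "(real ^ 'n) measure"
  assumes "2 \<le> CARD('n)"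
    and "convex_cocompact \<Gamma>"
    and "patterson_sullivan \<Gamma> \<mu>"
  shows "\<exists>\<nu> :: (real ^ 'n option ^ 'n option) measure.
           prob_space \<nu> \<and> sets \<nu> = sets borel \<and> emeasure \<nu> \<Gamma> = 1 \<and>
           finite_exponential_moment \<nu> \<and> stationary \<nu> \<mu> \<and> generated_subgroup \<nu> = \<Gamma>"
proof -
  define \<Lambda> where "\<Lambda> = limit_set \<Gamma>"
  have sub: "subgroup \<Gamma> SO0_mink" and disc: "topological_space_class.discrete \<Gamma>"
    using assms(2) by (auto simp: convex_cocompact_def)
  have cl: "closed \<Gamma>" by (rule discrete_subgroup_closed[OF sub disc])
  have cnt: "countable \<Gamma>" by (rule closed_discrete_countable[OF cl disc])
  have \<Gamma>: "\<gamma> \<in> carrier SO0_mink" if "\<gamma> \<in> \<Gamma>" for \<gamma> using that sub subgroup.subset by blast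
  have one: "mat 1 \<in> \<Gamma>" using sub subgroup.one_closed by (fastforce simp: SO0_mink_simps)
  have \<mu>: "prob_space \<mu>" "sets \<mu> = sets borel" "emeasure \<mu> \<Lambda> = 1"
    using assms(3) by (auto simp: patterson_sullivan_def \<Lambda>_def)
  interpret \<mu>: prob_space \<mu> by (rule \<mu>(1))
  have \<Lambda>_sets: "\<Lambda> \<in> sets \<mu>" using closed_limit_set[of \<Gamma>] \<mu>(2) by (simp add: \<Lambda>_def)
  have \<Lambda>_norm: "norm x = 1" if "x \<in> \<Lambda>" for x using that limit_set_subset[of \<Gamma>] by (auto simp: \<Lambda>_def)
  have ae: "AE x in \<mu>. x \<in> \<Lambda>" using \<mu>(3) by (intro \<mu>.AE_prob_1) (simp add: measure_def)
  then have supp: "AE x in \<mu>. norm x = 1" by eventually_elim (rule \<Lambda>_norm)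
  have \<Lambda>_ne: "\<Lambda> \<noteq> {}" using \<mu>(3) by auto
  obtain s where s: "\<And>k. critical_exponent \<Gamma> < ereal (s k)"
    "(\<lambda>k. ereal (s k)) \<longlonglongrightarrow> critical_exponent \<Gamma>"
    "weakly_converges (\<lambda>k. orbit_measure \<Gamma> (s k)) \<mu>"
    using assms(3) by (auto simp: patterson_sullivan_def)
  have "0 \<le> critical_exponent \<Gamma>"
    by (rule critical_exponent_nonneg[OF sub]) (use \<Lambda>_ne in \<open>simp add: \<Lambda>_def\<close>)
  \<comment> \<open>Bounded below by 0 and above by \<open>s 0\<close>, the exponent is a real
    number.\<close>
  then obtain \<delta> where \<delta>: "critical_exponent \<Gamma> = ereal \<delta>" "0 \<le> \<delta>"
    using s(1)[of 0] by (cases "critical_exponent \<Gamma>") auto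
  have s_lim: "s \<longlonglongrightarrow> \<delta>" using s(2) unfolding \<delta>(1) lim_ereal .
  have conf: "distr \<mu> borel (hyp_act \<gamma>) = density \<mu> (\<lambda>x. ennreal (conf_factor \<gamma> x powr (- \<delta>)))"
    if "\<gamma> \<in> \<Gamma>" for \<gamma>
    by (rule weak_limit_conformal[OF sub \<mu>(1,2) supp s_lim s(3) that])
  have cf_meas: "conf_factor \<gamma> \<in> borel_measurable \<mu>" for \<gamma>
  proof -
    have "continuous_on UNIV (conf_factor \<gamma>)" unfolding conf_factor_def by (intro continuous_intros)
    then show ?thesis
      using borel_measurable_continuous_onI \<mu>(2) by (simp cong: measurable_cong_sets)
  qed
  have f_meas: "(\<lambda>x. ennreal (conf_factor \<gamma> x powr (- \<delta>))) \<in> borel_measurable \<mu>" for \<gamma>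
    using cf_meas[of \<gamma>] by measurable
  have dens_prob: "prob_space (density \<mu> (\<lambda>x. ennreal (conf_factor \<gamma> x powr (- \<delta>))))" if "\<gamma> \<in> \<Gamma>" for \<gamma>
    unfolding conf[OF that, symmetric]
    using borel_measurable_hyp_act[of \<gamma>] \<mu>(2)
    by (intro \<mu>.prob_space_distr) (simp cong: measurable_cong_sets)
  show ?thesis
  \<comment> \<open>Splitting on invariance covers both degenerate cases at once: its failure yields
    \<open>\<delta> > 0\<close> and a second limit point.\<close>
  proof (cases "\<forall>\<gamma>\<in>\<Gamma>. distr \<mu> borel (hyp_act \<gamma>) = \<mu>")
    case True
    define b :: "real ^ 'n option ^ 'n option \<Rightarrow> real" where "b \<gamma> = 1 + \<bar>boost \<gamma>\<bar>" for \<gamma>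
    obtain w where w: "\<And>\<gamma>. \<gamma> \<in> \<Gamma> \<Longrightarrow> 0 < w \<gamma>"
      "(\<integral>\<^sup>+\<gamma>. ennreal (w \<gamma> * b \<gamma>) \<partial>count_space \<Gamma>) \<le> ennreal (1/2)"
      by (rule ex_pos_weights[OF cnt, of b]) (auto simp: b_def)
    define W where "W = (\<integral>\<^sup>+\<gamma>. ennreal (w \<gamma>) \<partial>count_space \<Gamma>)"
    have le: "ennreal (w \<gamma>) \<le> ennreal (w \<gamma> * b \<gamma>)" "ennreal (w \<gamma>) * ennreal (boost \<gamma> powr 1) \<le> ennreal (w \<gamma> * b \<gamma>)"
      if "\<gamma> \<in> \<Gamma>" for \<gamma>
      using w(1)[OF that] boost_pos[OF \<Gamma>[OF that]]
      by (auto simp: b_def ennreal_mult[symmetric] intro!: ennreal_leI)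
    have "W \<le> (\<integral>\<^sup>+\<gamma>. ennreal (w \<gamma> * b \<gamma>) \<partial>count_space \<Gamma>)"
      unfolding W_def by (intro nn_integral_mono) (simp add: le)
    then have W_fin: "W < \<top>" using le_less_trans[OF order_trans[OF _ w(2)] ennreal_less_top] by blast
    have "ennreal (w (mat 1)) \<le> W" unfolding W_def by (rule nn_integral_ge_point[OF one])
    then have W_pos: "0 < W" using w(1)[OF one] by (metis ennreal_less_zero_iff less_le_trans)
    have "(\<integral>\<^sup>+\<gamma>. ennreal (w \<gamma>) * ennreal (boost \<gamma> powr 1) \<partial>count_space \<Gamma>)
        \<le> (\<integral>\<^sup>+\<gamma>. ennreal (w \<gamma> * b \<gamma>) \<partial>count_space \<Gamma>)"
      by (intro nn_integral_mono) (use le(2) in simp)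
    then have mom: "(\<integral>\<^sup>+\<gamma>. ennreal (w \<gamma>) * ennreal (boost \<gamma> powr 1) \<partial>count_space \<Gamma>) < \<top>"
      using le_less_trans[OF order_trans[OF _ w(2)] ennreal_less_top] by blast
    obtain v where v: "W = ennreal v" "0 < v" using W_pos W_fin by (cases W) auto
    have inv: "inverse W < \<top>" "0 < inverse W" "inverse W * W = 1"
      using v by (simp_all add: inverse_ennreal ennreal_mult[symmetric])
    show ?thesis
    proof (rule stationary_measure_from_weights[OF sub cl cnt \<mu>(1,2), where f = "\<lambda>_ _. 1" and p = "\<lambda>\<gamma>. inverse W * ennreal (w \<gamma>)" and \<epsilon> = 1])
      show "distr \<mu> borel (hyp_act \<gamma>) = density \<mu> (\<lambda>_. 1)" if "\<gamma> \<in> \<Gamma>" for \<gamma>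
        using True that by (simp add: density_1)
      show "0 < inverse W * ennreal (w \<gamma>)" if "\<gamma> \<in> \<Gamma>" for \<gamma>
        using inv w(1)[OF that] by (simp add: ennreal_zero_less_mult_iff)
      show "AE x in \<mu>. (\<integral>\<^sup>+\<gamma>. inverse W * ennreal (w \<gamma>) * 1 \<partial>count_space \<Gamma>) = 1"
        using inv(3) by (simp add: nn_integral_cmult flip: W_def)
      show "(\<integral>\<^sup>+\<gamma>. inverse W * ennreal (w \<gamma>) * ennreal (boost \<gamma> powr 1) \<partial>count_space \<Gamma>) < \<infinity>"
        using mom inv unfolding mult.assoc by (simp add: nn_integral_cmult ennreal_mult_less_top)
    qed auto
  next
    case False
    then obtain \<gamma>\<^sub>0 where \<gamma>0: "\<gamma>\<^sub>0 \<in> \<Gamma>" "distr \<mu> borel (hyp_act \<gamma>\<^sub>0) \<noteq> \<mu>" by blast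
    have "\<delta> \<noteq> 0"
    proof
      assume "\<delta> = 0"
      have "density \<mu> (\<lambda>x. ennreal (conf_factor \<gamma>\<^sub>0 x powr (- \<delta>))) = density \<mu> (\<lambda>_. 1)"
      proof (rule density_cong[OF f_meas])
        show "AE x in \<mu>. ennreal (conf_factor \<gamma>\<^sub>0 x powr (- \<delta>)) = 1"
          using supp
        proof eventually_elim
          case (elim x)
          then show ?case using conf_factor_pos[OF \<Gamma>[OF \<gamma>0(1)] elim] \<open>\<delta> = 0\<close> by simp
        qed
      qed simp
      then show False using \<gamma>0 conf by (simp add: density_1)
    qed
    then have \<delta>_pos: "0 < \<delta>" using \<delta>(2) by simp
    obtain \<xi>\<^sub>1 where \<xi>1: "\<xi>\<^sub>1 \<in> \<Lambda>" using \<Lambda>_ne by blast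
    have "\<Lambda> \<noteq> {\<xi>\<^sub>1}"
    proof
      assume "\<Lambda> = {\<xi>\<^sub>1}"
      then have "density \<mu> (\<lambda>x. ennreal (conf_factor \<gamma>\<^sub>0 x powr (- \<delta>))) = \<mu>"
        using \<mu>(3) \<Lambda>_sets by (intro density_preserving_concentrated[OF \<mu>(1) _ _ f_meas dens_prob[OF \<gamma>0(1)]]) auto
      then show False using \<gamma>0 conf by simp
    qed
    then obtain \<xi>\<^sub>2 where \<xi>2: "\<xi>\<^sub>2 \<in> \<Lambda>" "\<xi>\<^sub>1 \<noteq> \<xi>\<^sub>2" using \<xi>1 by blast
    obtain C where C: "1 \<le> C" "\<And>\<xi> k. \<xi> \<in> \<Lambda> \<Longrightarrow>
        \<exists>\<gamma>\<in>\<Gamma>. 2 ^ k / C \<le> boost \<gamma> \<and> boost \<gamma> \<le> C * 2 ^ k \<and> dist (hyp_act \<gamma> 0) \<xi> \<le> C / 2 ^ k"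
      using limit_set_shadowing[OF assms(2), of \<xi>\<^sub>1 \<xi>\<^sub>2] \<xi>1 \<xi>2 unfolding \<Lambda>_def by metis
    \<comment> \<open>A condition closed in \<open>\<xi>\<close>, as the measurable selection
      requires.\<close>
    define P where "P k \<gamma> \<xi> \<longleftrightarrow> 2 ^ k / C \<le> boost \<gamma> \<and> boost \<gamma> \<le> C * 2 ^ k \<and> dist (hyp_act \<gamma> 0) \<xi> \<le> C / 2 ^ k"
      for k :: nat and \<gamma> :: "real ^ 'n option ^ 'n option" and \<xi> :: "real ^ 'n"
    have "\<exists>\<sigma>. \<sigma> \<in> measurable (restrict_space borel \<Lambda>) (count_space \<Gamma>) \<and> (\<forall>x\<in>\<Lambda>. P k (\<sigma> x) x)" for k
    proof -
      have "closed {x. P k \<gamma> x}" for \<gamma>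
        unfolding P_def by (intro closed_Collect_conj closed_Collect_const closed_Collect_le continuous_intros)
      then show ?thesis
        using countable_measurable_selection[OF cnt, of \<Lambda> "P k"] C(2) unfolding P_def by metis
    qed
    then obtain \<sigma> where \<sigma>: "\<And>k. \<sigma> k \<in> measurable (restrict_space borel \<Lambda>) (count_space \<Gamma>)"
      "\<And>k x. x \<in> \<Lambda> \<Longrightarrow> P k (\<sigma> k x) x"
      by metis
    define M where "M = restrict_space \<mu> \<Lambda>"
    have sets_M: "sets M = sets (restrict_space borel \<Lambda>)"
      unfolding M_def by (rule sets_restrict_space_cong[OF \<mu>(2)])
    have \<sigma>M: "\<sigma> k \<in> measurable M (count_space \<Gamma>)" for k
      unfolding measurable_cong_sets[OF sets_M refl] by (rule \<sigma>(1))
    have \<sigma>\<Gamma>: "\<sigma> k x \<in> \<Gamma>" if "x \<in> \<Lambda>" for k x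
      using measurable_space[OF \<sigma>(1)[of k], of x] that by (simp add: space_restrict_space)
    \<comment> \<open>One constant for both the size bound and the kernel inequality.\<close>
    define C' where "C' = max C ((200 * C ^ 10) powr \<delta>)"
    interpret shadow_system M \<Lambda> \<Gamma> "\<lambda>\<gamma> x. conf_factor \<gamma> x powr (- \<delta>)" boost \<sigma> "2 * \<delta>" C' "2 powr (- \<delta>)"
    proof (intro shadow_system.intro shadow_system_axioms.intro)
      show "prob_space M" unfolding M_def by (rule prob_space_restrict_space[OF \<Lambda>_sets \<mu>(3)])
      show "dist x y \<le> 2" if "x \<in> \<Lambda>" "y \<in> \<Lambda>" for x y
        using norm_triangle_ineq4[of x y] \<Lambda>_norm that by (simp add: dist_norm)
      show "log_lipschitz_on (2 * \<delta> * boost \<gamma>) \<Lambda> (\<lambda>x. conf_factor \<gamma> x powr (- \<delta>))" if "\<gamma> \<in> \<Gamma>" for \<gamma>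
        using \<Lambda>_norm by (intro conf_factor_powr_log_lipschitz[OF \<Gamma>[OF that] _ \<delta>(2)]) auto
      show "(\<integral>x. conf_factor \<gamma> x powr (- \<delta>) \<partial>M) = 1" if "\<gamma> \<in> \<Gamma>" for \<gamma>
      proof -
        have "(\<lambda>x. conf_factor \<gamma> x powr (- \<delta>)) \<in> borel_measurable \<mu>" using cf_meas[of \<gamma>] by measurable
        then have "(\<lambda>x. conf_factor \<gamma> x powr (- \<delta>)) \<in> borel_measurable M"
          unfolding M_def by (rule measurable_restrict_space1)
        then have "(\<integral>x. conf_factor \<gamma> x powr (- \<delta>) \<partial>M) = enn2real (\<integral>\<^sup>+x. ennreal (conf_factor \<gamma> x powr (- \<delta>)) \<partial>M)"
          by (intro integral_eq_nn_integral) auto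
        also have "(\<integral>\<^sup>+x. ennreal (conf_factor \<gamma> x powr (- \<delta>)) \<partial>M) =
            (\<integral>\<^sup>+x. ennreal (conf_factor \<gamma> x powr (- \<delta>)) * indicator \<Lambda> x \<partial>\<mu>)"
          unfolding M_def using \<Lambda>_sets by (intro nn_integral_restrict_space) auto
        also have "\<dots> = (\<integral>\<^sup>+x. ennreal (conf_factor \<gamma> x powr (- \<delta>)) * indicator (space \<mu>) x \<partial>\<mu>)"
          by (rule nn_integral_cong_AE) (use ae AE_space in \<open>eventually_elim, simp\<close>)
        also have "\<dots> = emeasure (density \<mu> (\<lambda>x. ennreal (conf_factor \<gamma> x powr (- \<delta>)))) (space \<mu>)"
          by (rule emeasure_density[OF f_meas sets.top, symmetric])
        also have "\<dots> = 1" using prob_space.emeasure_space_1[OF dens_prob[OF that]] by simp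
        finally show ?thesis by simp
      qed
      show "boost (\<sigma> k x) \<le> C' * 2 ^ k" if "x \<in> \<Lambda>" for k x
      proof -
        have "boost (\<sigma> k x) \<le> C * 2 ^ k" using \<sigma>(2)[OF that, of k] by (simp add: P_def)
        also have "\<dots> \<le> C' * 2 ^ k" by (intro mult_right_mono) (auto simp: C'_def)
        finally show ?thesis .
      qed
      show "conf_factor (\<sigma> k y) x powr (- \<delta>) \<le>
          C' * (2 powr (- \<delta>)) ^ (k - j) * conf_factor (\<sigma> j x) y powr (- \<delta>)"
        if "x \<in> \<Lambda>" "y \<in> \<Lambda>" "j \<le> k" "j = k \<or> 1 / 2 ^ j < dist x y" for x y j k
      proof -
        have "conf_factor (\<sigma> k y) x powr (- \<delta>) \<le>
            (200 * C ^ 10) powr \<delta> * (2 powr (- \<delta>)) ^ (k - j) * conf_factor (\<sigma> j x) y powr (- \<delta>)"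
          using \<sigma>(2)[OF that(2), of k] \<sigma>(2)[OF that(1), of j] that \<sigma>\<Gamma> \<Gamma> \<Lambda>_norm
          by (intro conf_factor_kernel[OF _ _ _ _ C(1) \<delta>(2)]) (auto simp: P_def)
        also have "\<dots> \<le> C' * (2 powr (- \<delta>)) ^ (k - j) * conf_factor (\<sigma> j x) y powr (- \<delta>)"
          by (intro mult_right_mono) (auto simp: C'_def)
        finally show ?thesis .
      qed
      show "2 powr (- \<delta>) < (1 :: real)" using powr_less_mono[of "- \<delta>" 0 2] \<delta>_pos by simp
    qed (use sets_M cnt \<delta>(2) \<sigma>M C(1) boost_ge_1 \<Gamma> in \<open>auto simp: C'_def\<close>)
    obtain p \<epsilon> where p: "\<And>\<gamma>. \<gamma> \<in> \<Gamma> \<Longrightarrow> 0 < p \<gamma>"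
      "\<And>x. x \<in> \<Lambda> \<Longrightarrow> (\<integral>\<^sup>+\<gamma>. p \<gamma> * ennreal (conf_factor \<gamma> x powr (- \<delta>)) \<partial>count_space \<Gamma>) = 1"
      "0 < \<epsilon>" "(\<integral>\<^sup>+\<gamma>. p \<gamma> * ennreal (boost \<gamma> powr \<epsilon>) \<partial>count_space \<Gamma>) < \<infinity>"
      by (rule kernel_decomposition) blast
    show ?thesis
    proof (rule stationary_measure_from_weights[OF sub cl cnt \<mu>(1,2) f_meas conf p(1) _ p(3,4)])
      show "AE x in \<mu>. (\<integral>\<^sup>+\<gamma>. p \<gamma> * ennreal (conf_factor \<gamma> x powr (- \<delta>)) \<partial>count_space \<Gamma>) = 1"
        using ae by eventually_elim (rule p(2))
    qed
  qed
qed

end
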